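(* Let $G$ be an $m$-uniform hypergraph on $n$ nodes, without isolated nodes, whose connected components are properly connected. Suppose $G$ has $c$ connected components and $\mathrm{Vol}_{n-1}(F(G))\neq0$ (equivalently, suppose that in each connected component of $G$ all nodes are pivot equivalent). Then $$\mathrm{Vol}_{n-1}(F(G))=m^{c-1}\,e(\Bbbk[G]).$$
   Context: A hypergraph $G$ has a finite non-empty node set $V(G)=\{x_1,\dots,x_n\}$ and an edge set $E(G)$ consisting of subsets of $V(G)$; it is $m$-uniform ($m\ge1$) if every edge has exactly $m$ elements. A node is isolated if it lies in no edge. $G$ is connected if any two nodes can be joined by a sequence of edges, the first containing one node and the last the other, with consecutive edges sharing a node. An $m$-uniform hypergraph is properly connected if for any two edges $u,v$ there is a sequence of edges starting with $u$ and ending with $v$ such that consecutive edges intersect in exactly $m-1$ nodes. Pivot equivalence: $x_i\approx x_j$ if there is a subset $A\subset V(G)\setminus\{x_i,x_j\}$ such that $\{x_i\}\cup A$ and $\{x_j\}\cup A$ are both edges; two nodes are pivot equivalent if they are linked by a chain $x_i=x_{i_1}\approx\cdots\approx x_{i_r}=x_j$. The edge polytope $F(G)\subset\mathbb{R}^n$ is the convex hull of the vectors $e_{i_1}+\dots+e_{i_m}$ over all edges $\{x_{i_1},\dots,x_{i_m}\}\in E(G)$. It lies in the hyperplane $L=\{z\in\mathbb{R}^n: z_1+\dots+z_n=m\}$, and $\mathrm{Vol}_{n-1}(F(G))$ is its $(n-1)$-dimensional volume normalized with respect to the lattice $L\cap\mathbb{Z}^n$, i.e. so that every simplex in $L$ whose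 vertices $v_0,\dots,v_{n-1}\in L\cap\mathbb{Z}^n$ are such that the differences $v_i-v_0$ form a basis of the lattice $\{z\in\mathbb{Z}^n:\sum z_i=0\}$ has volume $1$ (it is $0$ if $\dim F(G)<n-1$). Fix a field $\Bbbk$ and view nodes as indeterminates. The edge subring $\Bbbk[G]$ is the $\Bbbk$-subalgebra of $\Bbbk[x_1,\dots,x_n]$ generated by the monomials $x_{i_1}\cdots x_{i_m}$ with $\{x_{i_1},\dots,x_{i_m}\}\in E(G)$, regarded as a standard graded algebra by giving these generators degree $1$; $e(\Bbbk[G])$ is its Hilbert–Samuel multiplicity. *)

theory Defs
  imports
    "HOL-Analysis.Analysis"
    "HOL-Library.Poly_Mapping"
    "HOL-Computational_Algebra.Polynomial"
begin

section \<open>Hypergraphs\<close>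

definition uniform_hypergraph :: "nat \<Rightarrow> 'v set \<Rightarrow> 'v set set \<Rightarrow> bool" where
  "uniform_hypergraph m V E \<longleftrightarrow>
     finite V \<and> V \<noteq> {} \<and> E \<subseteq> Pow V \<and> 1 \<le> m \<and> (\<forall>e\<in>E. card e = m)"

definition isolated_node :: "'v set set \<Rightarrow> 'v \<Rightarrow> bool" where
  "isolated_node E x \<longleftrightarrow> (\<forall>e\<in>E. x \<notin> e)"

definition joined :: "'v set set \<Rightarrow> 'v \<Rightarrow> 'v \<Rightarrow> bool" where
  "joined E x y \<longleftrightarrow> x = y \<or>
     (\<exists>es. es \<noteq> [] \<and> set es \<subseteq> E \<and> x \<in> hd es \<and> y \<in> last es \<and>
           successively (\<lambda>e f. e \<inter> f \<noteq> {}) es)"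

text \<open>A connected component is represented by its node set \<open>C\<close>; as a hypergraph it
  is \<open>(C, induced_edges E C)\<close>.\<close>

definition conn_components :: "'v set \<Rightarrow> 'v set set \<Rightarrow> 'v set set" where
  "conn_components V E = V // {(x, y). x \<in> V \<and> y \<in> V \<and> joined E x y}"

definition induced_edges :: "'v set set \<Rightarrow> 'v set \<Rightarrow> 'v set set" where
  "induced_edges E C = {e \<in> E. e \<subseteq> C}"

definition properly_connected :: "nat \<Rightarrow> 'v set set \<Rightarrow> bool" where
  "properly_connected m E \<longleftrightarrow>
     (\<forall>u\<in>E. \<forall>v\<in>E. \<exists>es. es \<noteq> [] \<and> set es \<subseteq> E \<and> hd es = u \<and> last es = v \<and>
        successively (\<lambda>e f. card (e \<inter> f) = m - 1) es)"

definition pivot_adjacent :: "'v set \<Rightarrow> 'v set set \<Rightarrow> 'v \<Rightarrow> 'v \<Rightarrow> bool" where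
  "pivot_adjacent V E x y \<longleftrightarrow> (\<exists>A \<subseteq> V - {x, y}. insert x A \<in> E \<and> insert y A \<in> E)"

definition pivot_equivalent :: "'v set \<Rightarrow> 'v set set \<Rightarrow> 'v \<Rightarrow> 'v \<Rightarrow> bool" where
  "pivot_equivalent V E = (pivot_adjacent V E)\<^sup>*\<^sup>*"


section \<open>The edge polytope and its normalized volume\<close>

definition edge_polytope :: "'v::finite set set \<Rightarrow> (real^'v) set" where
  "edge_polytope E = convex hull ((\<lambda>e. \<Sum>x\<in>e. axis x 1) ` E)"

definition unit_normal :: "real^'n::finite" where
  "unit_normal = (1 / sqrt (real CARD('n))) *\<^sub>R (\<chi> i. 1)"

text \<open>For \<open>S\<close> contained in a hyperplane \<open>{z. (\<Sum>i. z $ i) = a}\<close>, the Euclidean volume of \<open>S\<close>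
  of dimension \<open>CARD('n) - 1\<close> is the Lebesgue measure of the right cylinder of height 1
  over \<open>S\<close>.\<close>

definition hyperplane_volume :: "(real^'n::finite) set \<Rightarrow> real" where
  "hyperplane_volume S =
     measure lebesgue {z + t *\<^sub>R unit_normal | z t. z \<in> S \<and> 0 \<le> t \<and> t \<le> 1}"

text \<open>The standard simplex lies in the hyperplane of coordinate sum 1 and is unimodular;
  dividing by its volume normalizes the volume on all parallel hyperplanes, see
  \<open>normalized_volume_unimodular_simplex\<close> below.\<close>

definition normalized_volume :: "(real^'n::finite) set \<Rightarrow> real" where
  "normalized_volume S =
     hyperplane_volume S / hyperplane_volume (convex hull range (\<lambda>i::'n. axis i 1))"


lemma sum_coord_axis: "(\<Sum>j\<in>UNIV. axis i (1::real) $ j) = 1"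
  by (simp add: axis_def)

lemma det_Ints:
  fixes A :: "real^'n^'n"
  assumes "\<And>i j. A $ i $ j \<in> \<int>"
  shows "det A \<in> \<int>"
  unfolding det_def using assms by (intro Ints_sum Ints_mult Ints_prod) auto

lemma hyperplane_volume_standard_simplex_pos:
  "hyperplane_volume (convex hull range (\<lambda>i::'n::finite. axis i 1)) > 0"
proof -
  let ?n = "real CARD('n)"
  let ?S = "convex hull range (\<lambda>i::'n. axis i (1::real))"
  let ?C = "{z + t *\<^sub>R unit_normal | z t. z \<in> ?S \<and> 0 \<le> t \<and> t \<le> 1}"
  let ?s = "\<lambda>x::real^'n. \<Sum>j\<in>UNIV. x $ j"
  have n: "?n > 0" by simp
  have "compact ((\<lambda>(z, t). z + t *\<^sub>R unit_normal) ` (?S \<times> {0..1::real}))"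
    by (intro compact_continuous_image compact_Times finite_imp_compact_convex_hull)
      (auto intro!: continuous_intros simp: case_prod_unfold)
  moreover have "(\<lambda>(z, t). z + t *\<^sub>R unit_normal) ` (?S \<times> {0..1::real}) = ?C" by fastforce
  ultimately have meas: "?C \<in> lmeasurable" by (simp add: lmeasurable_compact)
  let ?O = "{x. 1 < ?s x} \<inter> {x. ?s x < 1 + sqrt ?n} \<inter> (\<Inter>i. {x. (?s x - 1) / ?n < x $ i})"
  have op: "open ?O"
    by (intro open_Int open_INT ballI open_Collect_less continuous_intros) auto
  have ne: "((1 + sqrt ?n / 2) / ?n) *\<^sub>R (\<chi> i. 1) \<in> ?O"
    using n by (auto simp: field_simps)
  have "x \<in> ?C" if x: "x \<in> ?O" for x
  proof -
    define t where "t = (?s x - 1) / sqrt ?n"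
    have t: "0 \<le> t" "t \<le> 1" using x n by (auto simp: t_def field_simps)
    have tn: "t *\<^sub>R (unit_normal :: real^'n) = ((?s x - 1) / ?n) *\<^sub>R (\<chi> i. 1)"
      unfolding t_def unit_normal_def by simp
    define z where "z = x - t *\<^sub>R unit_normal"
    have zi: "z $ i = x $ i - (?s x - 1) / ?n" for i unfolding z_def tn by simp
    have "z = (\<Sum>i\<in>UNIV. z $ i *\<^sub>R axis i 1)" 
      by (simp add: vec_eq_iff axis_def if_distrib cong: if_cong)
    also have "\<dots> \<in> ?S"
    proof (rule convex_sum)
      show "(\<Sum>i\<in>UNIV. z $ i) = 1" using n by (simp add: zi sum_subtractf)
      show "\<And>i. i \<in> UNIV \<Longrightarrow> 0 \<le> z $ i" using x by (auto simp: zi less_imp_le)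
    qed (auto intro: hull_inc)
    finally show ?thesis using t by (auto simp: z_def intro!: exI[of _ "x - t *\<^sub>R unit_normal"] exI[of _ t])
  qed
  then have sub: "?O \<subseteq> ?C" by (rule subsetI)
  have "\<not> negligible ?O" using ne by (intro open_not_negligible[OF op]) (erule ex_in_conv[THEN iffD1, OF exI])
  then have "\<not> negligible ?C" using negligible_subset[OF _ sub] by (rule contrapos_nn)
  then have "measure lebesgue ?C \<noteq> 0" using meas by (simp only: negligible_iff_measure not_False_eq_True simp_thms)
  then show ?thesis
    unfolding hyperplane_volume_def using measure_nonneg[of lebesgue ?C] by (simp only: less_le not_sym simp_thms)
qed

text \<open>The sort \<open>wellorder\<close> below is needed only because the library states the effect of
  linear maps on Lebesgue measure for well-ordered index types.\<close>

lemma normalized_volume_unimodular_simplex: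
  fixes v :: "'n::{finite,wellorder} \<Rightarrow> real^'n::_" and k :: 'n and a :: real
  assumes int: "\<And>i j. v i $ j \<in> \<int>"
    and sum_v: "\<And>i. (\<Sum>j\<in>UNIV. v i $ j) = a"
    and basis: "\<And>z. (\<forall>j. z $ j \<in> \<int>) \<Longrightarrow> (\<Sum>j\<in>UNIV. z $ j) = 0 \<Longrightarrow>
      \<exists>c :: 'n \<Rightarrow> int. z = (\<Sum>i\<in>UNIV - {k}. of_int (c i) *\<^sub>R (v i - v k))"
  shows "normalized_volume (convex hull range v) = 1"
proof -
  let ?n = "real CARD('n)"
  let ?s = "\<lambda>x::real^'n::_. \<Sum>j\<in>UNIV. x $ j"
  let ?e = "\<lambda>i::'n. axis i (1::real)"
  define u :: "real^'n::_" where "u = (1 / ?n) *\<^sub>R (\<chi> i. 1)"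
  define P where "P x = (\<Sum>i\<in>UNIV. x $ i *\<^sub>R (if i = k then u else ?e i - ?e k))" for x :: "real^'n::_"
  define Q :: "real^'n::_ \<Rightarrow> real^'n::_" where "Q y = (\<chi> j. if j = k then ?s y else y $ j - ?s y / ?n)" for y
  define M where "M x = (\<Sum>i\<in>UNIV. x $ i *\<^sub>R (if i = k then ?e k else Q (v i - v k)))" for x :: "real^'n::_"
  have "\<exists>c. \<forall>i. ?e i - ?e k = (\<Sum>j\<in>UNIV - {k}. of_int (c i j :: int) *\<^sub>R (v j - v k))"
    by (intro choice allI basis) (auto simp: axis_def sum_subtractf)
  then obtain c :: "'n \<Rightarrow> 'n \<Rightarrow> int" where
    c: "\<And>i. ?e i - ?e k = (\<Sum>j\<in>UNIV - {k}. of_int (c i j) *\<^sub>R (v j - v k))" by blast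
  define N where "N x = (\<Sum>i\<in>UNIV. x $ i *\<^sub>R (if i = k then ?e k else
    (\<Sum>j\<in>UNIV - {k}. of_int (c i j) *\<^sub>R ?e j)))" for x :: "real^'n::_"
  have lincomb: "linear (\<lambda>x::real^'n::_. \<Sum>i\<in>UNIV. x $ i *\<^sub>R (w i :: real^'n::_))" for w
    by (rule linearI) (simp_all add: scaleR_left_distrib sum.distrib scaleR_sum_right)
  have lP: "linear P" and lM: "linear M" and lN: "linear N"
    unfolding P_def[abs_def] M_def[abs_def] N_def[abs_def] by (rule lincomb)+
  have lQ: "linear Q"
    unfolding Q_def[abs_def]
    by (rule linearI) (auto simp: vec_eq_iff sum.distrib sum_distrib_left field_simps)
  have ax: "(\<Sum>i\<in>UNIV. ?e j $ i *\<^sub>R (w i :: real^'n::_)) = w j" for w j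
    by (simp add: axis_def if_distrib[of "\<lambda>r. r *\<^sub>R _"] cong: if_cong)
  have P_ax: "P (?e j) = (if j = k then u else ?e j - ?e k)" for j unfolding P_def by (rule ax)
  have M_ax: "M (?e j) = (if j = k then ?e k else Q (v j - v k))" for j unfolding M_def by (rule ax)
  have N_ax: "N (?e j) = (if j = k then ?e k else (\<Sum>i\<in>UNIV - {k}. of_int (c j i) *\<^sub>R ?e i))" for j
    unfolding N_def by (rule ax)
  have su: "?s u = 1" by (simp add: u_def)
  have Qu: "Q u = ?e k" by (auto simp: vec_eq_iff Q_def su) (simp_all add: u_def axis_def)
  have sd: "?s (?e i - ?e k) = 0" for i by (simp add: sum_subtractf sum_coord_axis)
  have Qe: "Q (?e i - ?e k) = ?e i" if "i \<noteq> k" for i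
    using that sd[of i] by (auto simp: vec_eq_iff Q_def axis_def)
  have eqI: "f = g" if "linear f" "linear g" "\<And>i. f (?e i) = g (?e i)" for f g :: "real^'n::_ \<Rightarrow> real^'n::_"
    using that by (intro linear_eq_stdbasis) (auto simp: Basis_vec_def)
  have QP: "Q \<circ> P = id"
    by (rule eqI) (auto simp: P_ax Qu Qe intro: linear_compose[OF lP lQ] linear_id)
  have PQ: "P \<circ> Q = id"
    using QP lP lQ by (metis left_inverse_linear linear_inverse_left o_def)
  have MN: "M \<circ> N = id"
  proof (rule eqI)
    fix i
    show "(M \<circ> N) (?e i) = id (?e i)"
    proof (cases "i = k")
      case False
      have "M (\<Sum>j\<in>UNIV - {k}. of_int (c i j) *\<^sub>R ?e j) = (\<Sum>j\<in>UNIV - {k}. of_int (c i j) *\<^sub>R Q (v j - v k))"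
        by (simp add: linear_sum[OF lM] linear_scale[OF lM] M_ax)
      also have "\<dots> = Q (?e i - ?e k)"
        unfolding c by (simp add: linear_sum[OF lQ] linear_scale[OF lQ])
      finally show ?thesis using False by (simp add: N_ax Qe)
    qed (simp add: N_ax M_ax)
  qed (auto intro: linear_compose[OF lN lM] linear_id)
  have detMN: "det (matrix M) * det (matrix N) = 1"
    using matrix_compose[OF lN lM] MN by (metis det_I det_mul matrix_id_mat_1)
  have detPQ: "det (matrix P) * det (matrix Q) = 1"
    using matrix_compose[OF lQ lP] PQ by (metis det_I det_mul matrix_id_mat_1)
  have "det (matrix M) \<in> \<int>"
  proof (rule det_Ints)
    fix i j
    have "?s (v j - v k) = 0" by (simp add: sum_subtractf sum_v)
    moreover have "matrix M $ i $ j = (if j = k then ?e k else Q (v j - v k)) $ i"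
      unfolding matrix_def by (simp add: M_ax)
    ultimately show "matrix M $ i $ j \<in> \<int>"
      using int by (auto simp: Q_def axis_def)
  qed
  moreover have "det (matrix N) \<in> \<int>"
  proof (rule det_Ints)
    fix i j
    have "matrix N $ i $ j =
      (if j = k then ?e k else (\<Sum>l\<in>UNIV - {k}. of_int (c j l) *\<^sub>R ?e l)) $ i"
      unfolding matrix_def by (simp add: N_ax)
    then show "matrix N $ i $ j \<in> \<int>" by (auto simp: axis_def intro!: Ints_sum)
  qed
  ultimately obtain x y :: int where "det (matrix M) = of_int x" "det (matrix N) = of_int y"
    by (auto elim!: Ints_cases)
  with detMN have "x * y = 1" by (metis of_int_eq_1_iff of_int_mult)
  then have "\<bar>x\<bar> = 1" by (metis abs_zmult_eq_1 abs_1)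
  then have detM: "\<bar>det (matrix M)\<bar> = 1" using \<open>det (matrix M) = of_int x\<close> by simp
  define f where "f = P \<circ> (M \<circ> Q)"
  have lf: "linear f" unfolding f_def by (intro linear_compose lP lM lQ)
  have detf: "\<bar>det (matrix f)\<bar> = 1"
    unfolding f_def using detM detPQ
    by (simp add: matrix_compose lP lM lQ linear_compose det_mul abs_mult)
      (metis abs_mult abs_1)
  have fu: "f u = u" by (simp add: f_def Qu M_ax P_ax)
  have f_diff: "f (?e i) - f (?e k) = v i - v k" for i
  proof (cases "i = k")
    case False
    have "f (?e i - ?e k) = P (Q (v i - v k))" using False by (simp add: f_def Qe M_ax)
    also have "\<dots> = v i - v k" using PQ by (simp add: fun_eq_iff)
    finally show ?thesis by (simp add: linear_diff[OF lf])
  qed simp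
  define w where "w = f (?e k) - v k"
  have f_ax: "f (?e i) = w + v i" for i using f_diff[of i] by (simp add: w_def algebra_simps)
  have nu: "unit_normal = (sqrt ?n) *\<^sub>R u"
    by (simp add: unit_normal_def u_def real_div_sqrt flip: divide_inverse)
      (simp add: field_simps flip: real_sqrt_mult)
  have f_nu: "f unit_normal = unit_normal" by (simp add: nu linear_scale[OF lf] fu)
  let ?C = "\<lambda>S. {z + t *\<^sub>R unit_normal | z t. z \<in> S \<and> 0 \<le> t \<and> t \<le> (1::real)}"
  let ?S = "convex hull range ?e"
  have "f ` ?S = convex hull (f ` range ?e)" by (rule convex_hull_linear_image[OF lf])
  also have "f ` range ?e = (+) w ` range v" by (simp add: image_image f_ax)
  finally have fS: "f ` ?S = (+) w ` (convex hull range v)" by (simp add: convex_hull_translation)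
  have C: "?C S = (\<lambda>(z, t). z + t *\<^sub>R unit_normal) ` (S \<times> {0..1})" for S :: "(real^'n::_) set"
    by fastforce
  have "f ` ?C ?S = (\<lambda>(z, t). f z + t *\<^sub>R unit_normal) ` (?S \<times> {0..1})"
    unfolding C by (simp add: image_image case_prod_unfold linear_add[OF lf] linear_scale[OF lf] f_nu)
  also have "\<dots> = (\<lambda>(z, t). z + t *\<^sub>R unit_normal) ` ((f ` ?S) \<times> {0..1})" by force
  also have "\<dots> = (+) w ` ?C (convex hull range v)"
    unfolding C fS by (force simp: add.assoc)
  finally have im: "f ` ?C ?S = (+) w ` ?C (convex hull range v)" .
  have "compact ((\<lambda>(z, t). z + t *\<^sub>R unit_normal) ` (?S \<times> {0..1::real}))"
    by (intro compact_continuous_image compact_Times finite_imp_compact_convex_hull)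
      (auto intro!: continuous_intros simp: case_prod_unfold)
  then have meas: "?C ?S \<in> lmeasurable" unfolding C by (rule lmeasurable_compact)
  have "hyperplane_volume (convex hull range v) = measure lebesgue (f ` ?C ?S)"
    unfolding im hyperplane_volume_def by (rule measure_translation[symmetric])
  also have "\<dots> = hyperplane_volume ?S"
    using measure_linear_image[OF lf meas] detf by (simp add: hyperplane_volume_def)
  finally show ?thesis
    using hyperplane_volume_standard_simplex_pos[where 'n = 'n] by (simp add: normalized_volume_def)
qed


section \<open>The edge subring and its multiplicity\<close>

text \<open>The polynomial ring over \<open>'k\<close> with indeterminates indexed by \<open>'v\<close>.\<close>

type_synonym ('v, 'k) mpol = "('v \<Rightarrow>\<^sub>0 nat) \<Rightarrow>\<^sub>0 'k"

definition mconst :: "'k::field \<Rightarrow> ('v, 'k) mpol" where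
  "mconst c = Poly_Mapping.single 0 c"

definition mvar :: "'v \<Rightarrow> ('v, 'k::field) mpol" where
  "mvar x = Poly_Mapping.single (Poly_Mapping.single x 1) 1"

global_interpretation mpol: vector_space "\<lambda>(c::'k::field) (p::('v, 'k) mpol). mconst c * p"
  defines mpol_dim = mpol.dim and mpol_span = mpol.span
  by unfold_locales
    (simp_all add: mconst_def algebra_simps single_add mult_single flip: mult.assoc)

definition subalgebra :: "('v, 'k::field) mpol set \<Rightarrow> bool" where
  "subalgebra A \<longleftrightarrow> range mconst \<subseteq> A \<and> (\<forall>p\<in>A. \<forall>q\<in>A. p + q \<in> A \<and> p * q \<in> A)"

definition edge_monomial :: "'v set \<Rightarrow> ('v, 'k::field) mpol" where
  "edge_monomial e = (\<Prod>x\<in>e. mvar x)"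

definition edge_subring :: "'v set set \<Rightarrow> ('v, 'k::field) mpol set" where
  "edge_subring E = subalgebra hull (edge_monomial ` E)"

definition total_degree :: "('v \<Rightarrow>\<^sub>0 nat) \<Rightarrow> nat" where
  "total_degree t = (\<Sum>x\<in>Poly_Mapping.keys t. Poly_Mapping.lookup t x)"

text \<open>If \<open>A\<close> is generated by monomials of total degree \<open>m \<ge> 1\<close>, giving these generators degree 1
  amounts to dividing total degrees by \<open>m\<close>; see \<open>graded_component_edge_subring\<close> below.\<close>

definition graded_component :: "nat \<Rightarrow> ('v, 'k::field) mpol set \<Rightarrow> nat \<Rightarrow> ('v, 'k) mpol set" where
  "graded_component m A d = {p \<in> A. \<forall>t\<in>Poly_Mapping.keys p. total_degree t = m * d}"

lemma subalgebra_span_monoid: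
  fixes M :: "('v, 'k::field) mpol set"
  assumes "1 \<in> M" and mult: "\<And>a b. a \<in> M \<Longrightarrow> b \<in> M \<Longrightarrow> a * b \<in> M"
  shows "subalgebra (mpol_span M)"
proof -
  have 1: "mconst c \<in> mpol_span M" for c
    using mpol.span_scale[OF mpol.span_base[OF assms(1)], of c] by simp
  have 2: "a * q \<in> mpol_span M" if "a \<in> M" "q \<in> mpol_span M" for a q
    using that(2)
  proof (induction rule: mpol.span_induct_alt)
    case base show ?case by (simp add: mpol.span_zero)
  next
    case (step c x y)
    have "a * (mconst c * x + y) = mconst c * (a * x) + a * y" by (simp add: algebra_simps)
    then show ?case
      using mpol.span_add[OF mpol.span_scale[OF mpol.span_base[OF mult[OF that(1) step(1)]], of c] step(2)]
      by simp
  qed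
  have 3: "p * q \<in> mpol_span M" if "p \<in> mpol_span M" "q \<in> mpol_span M" for p q
    using that(1)
  proof (induction rule: mpol.span_induct_alt)
    case base show ?case by (simp add: mpol.span_zero)
  next
    case (step c x y)
    have "(mconst c * x + y) * q = mconst c * (x * q) + y * q" by (simp add: algebra_simps)
    then show ?case
      using mpol.span_add[OF mpol.span_scale[OF 2[OF step(1) that(2)], of c] step(2)] by simp
  qed
  show ?thesis using 1 3 by (auto simp: subalgebra_def intro: mpol.span_add)
qed

lemma total_degree_add: "total_degree (s + t) = total_degree s + total_degree t"
proof -
  have eq: "total_degree r = (\<Sum>x\<in>Poly_Mapping.keys s \<union> Poly_Mapping.keys t. Poly_Mapping.lookup r x)"
    if "Poly_Mapping.keys r \<subseteq> Poly_Mapping.keys s \<union> Poly_Mapping.keys t" for r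
    unfolding total_degree_def using that
    by (intro sum.mono_neutral_left) (auto simp: in_keys_iff)
  show ?thesis
    using Poly_Mapping.keys_add[of s t] by (simp add: eq lookup_add sum.distrib)
qed

lemma homogeneous_mult:
  fixes p q :: "('v, 'k::field) mpol"
  assumes "\<forall>t\<in>Poly_Mapping.keys p. total_degree t = i"
    and "\<forall>t\<in>Poly_Mapping.keys q. total_degree t = j"
  shows "\<forall>t\<in>Poly_Mapping.keys (p * q). total_degree t = i + j"
  using assms keys_mult[of p q] by (fastforce simp: total_degree_add)

lemma homogeneous_edge_monomial:
  assumes "finite e"
  shows "\<forall>t\<in>Poly_Mapping.keys (edge_monomial e :: ('v, 'k::field) mpol). total_degree t = card e"
  using assms unfolding edge_monomial_def
proof (induction e rule: finite_induct)
  case empty then show ?case by (simp add: total_degree_def)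
next
  case (insert x F)
  have "\<forall>t\<in>Poly_Mapping.keys (mvar x :: ('v, 'k) mpol). total_degree t = 1"
    by (simp add: mvar_def total_degree_def)
  from homogeneous_mult[OF this insert.IH] show ?case using insert by simp
qed

lemma homogeneous_prod_list:
  fixes gs :: "('v, 'k::field) mpol list"
  assumes "\<And>g. g \<in> set gs \<Longrightarrow> \<forall>t\<in>Poly_Mapping.keys g. total_degree t = m"
  shows "\<forall>t\<in>Poly_Mapping.keys (prod_list gs). total_degree t = m * length gs"
  using assms
proof (induction gs)
  case Nil then show ?case by (simp add: total_degree_def)
next
  case (Cons g gs)
  have "\<forall>t\<in>Poly_Mapping.keys g. total_degree t = m" by (rule Cons.prems) simp
  moreover have "\<forall>t\<in>Poly_Mapping.keys (prod_list gs). total_degree t = m * length gs"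
    by (rule Cons.IH, rule Cons.prems) simp
  ultimately have "\<forall>t\<in>Poly_Mapping.keys (g * prod_list gs). total_degree t = m + m * length gs"
    by (rule homogeneous_mult)
  then show ?case by simp
qed

lemma subalgebra_hull: "subalgebra (subalgebra hull X)"
  by (rule hull_in) (unfold subalgebra_def, blast)

lemma graded_component_edge_subring:
  fixes E :: "'v set set"
  assumes "uniform_hypergraph m V E"
  shows "graded_component m (edge_subring E :: ('v, 'k::field) mpol set) d =
    mpol_span {prod_list gs | gs. length gs = d \<and> set gs \<subseteq> edge_monomial ` E}"
    (is "?L = mpol_span (?M d)")
proof
  have m: "m \<ge> 1" and E: "\<And>e. e \<in> E \<Longrightarrow> finite e \<and> card e = m"
    using assms by (auto simp: uniform_hypergraph_def intro: finite_subset)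
  have gen: "\<forall>t\<in>Poly_Mapping.keys g. total_degree t = m"
    if "g \<in> edge_monomial ` E" for g :: "('v, 'k) mpol"
    using that E homogeneous_edge_monomial by fastforce
  have hom: "\<forall>t\<in>Poly_Mapping.keys p. total_degree t = m * i" if "p \<in> ?M i" for p i
    using that homogeneous_prod_list[of _ m] gen by blast
  have hom_span: "\<forall>t\<in>Poly_Mapping.keys p. total_degree t = m * i" if "p \<in> mpol_span (?M i)" for p i
    using that
  proof (induction rule: mpol.span_induct_alt)
    case base show ?case by simp
  next
    case (step c x y)
    have "\<forall>t\<in>Poly_Mapping.keys (mconst c). total_degree t = 0"
      by (simp add: mconst_def total_degree_def)
    from homogeneous_mult[OF this hom[OF step(1)]] step(2) show ?case
      using Poly_Mapping.keys_add[of "mconst c * x" y] by fastforce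
  qed
  have alg: "subalgebra (edge_subring E :: ('v, 'k) mpol set)"
    unfolding edge_subring_def by (rule subalgebra_hull)
  have "mconst 1 \<in> (edge_subring E :: ('v, 'k) mpol set)"
    using alg by (auto simp: subalgebra_def)
  then have one: "1 \<in> (edge_subring E :: ('v, 'k) mpol set)"
    by (simp add: mconst_def)
  have prods: "prod_list gs \<in> edge_subring E" if "set gs \<subseteq> edge_monomial ` E"
    for gs :: "('v, 'k) mpol list"
    using that
  proof (induction gs)
    case Nil then show ?case using one by simp
  next
    case (Cons g gs)
    have "g \<in> edge_subring E"
      using Cons.prems unfolding edge_subring_def by (auto intro: hull_inc)
    then show ?case using Cons alg by (simp add: subalgebra_def)
  qed
  have "p \<in> edge_subring E" if "p \<in> mpol_span (?M d)" for p
    using that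
  proof (induction rule: mpol.span_induct_alt)
    case base
    have "mconst 0 \<in> (edge_subring E :: ('v, 'k) mpol set)" using alg by (auto simp: subalgebra_def)
    then show ?case by (simp add: mconst_def)
  next
    case (step c x y)
    obtain gs where "x = prod_list gs" "set gs \<subseteq> edge_monomial ` E" using step(1) by blast
    then have "x \<in> edge_subring E" using prods by blast
    moreover have "mconst c \<in> (edge_subring E :: ('v, 'k) mpol set)"
      using alg by (auto simp: subalgebra_def)
    ultimately show ?case using alg step(2) by (simp add: subalgebra_def)
  qed
  with hom_span show "mpol_span (?M d) \<subseteq> ?L" by (auto simp: graded_component_def)

  let ?U = "\<Union>i. ?M i"
  have "subalgebra (mpol_span ?U)"
  proof (rule subalgebra_span_monoid)
    have "1 = prod_list []" by simp
    then show "1 \<in> ?U" by fastforce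
  next
    fix a b :: "('v, 'k) mpol" assume "a \<in> ?U" "b \<in> ?U"
    then obtain g h where "a = prod_list g" "set g \<subseteq> edge_monomial ` E"
      "b = prod_list h" "set h \<subseteq> edge_monomial ` E" by auto
    then have "a * b = prod_list (g @ h)" "set (g @ h) \<subseteq> edge_monomial ` E" by auto
    then show "a * b \<in> ?U" by blast
  qed
  moreover have "edge_monomial ` E \<subseteq> mpol_span ?U"
  proof
    fix g :: "('v, 'k) mpol" assume g: "g \<in> edge_monomial ` E"
    have "g = prod_list [g]" by simp
    then have "g \<in> ?U" using g by fastforce
    then show "g \<in> mpol_span ?U" by (rule mpol.span_base)
  qed
  ultimately have sub: "edge_subring E \<subseteq> mpol_span ?U"
    unfolding edge_subring_def by (rule hull_minimal[rotated])
  have part: "\<exists>q\<in>mpol_span (?M d). \<forall>t. total_degree t = m * d \<longrightarrow>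
      Poly_Mapping.lookup p t = Poly_Mapping.lookup q t" if "p \<in> mpol_span ?U" for p
    using that
  proof (induction rule: mpol.span_induct_alt)
    case base show ?case using mpol.span_zero by blast
  next
    case (step c x y)
    from step(1) obtain i where i: "x \<in> ?M i" by (rule UN_E)
    from step(2) obtain q where q: "q \<in> mpol_span (?M d)"
      "\<forall>t. total_degree t = m * d \<longrightarrow> Poly_Mapping.lookup y t = Poly_Mapping.lookup q t" ..
    show ?case
    proof (cases "i = d")
      case True
      have "x \<in> ?M d" using i unfolding True .
      from mpol.span_add[OF mpol.span_scale[OF mpol.span_base[OF this], of c] q(1)]
      have "mconst c * x + q \<in> mpol_span (?M d)" .
      then show ?thesis using q(2) by (intro bexI[of _ "mconst c * x + q"]) (auto simp: lookup_add)
    next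
      case False
      have "\<forall>t\<in>Poly_Mapping.keys (mconst c). total_degree t = 0"
        by (simp add: mconst_def total_degree_def)
      from homogeneous_mult[OF this hom[OF i]]
      have "t \<notin> Poly_Mapping.keys (mconst c * x)" if "total_degree t = m * d" for t
        using that False m \<open>\<forall>t\<in>Poly_Mapping.keys (mconst c * x). total_degree t = 0 + m * i\<close>
        by auto
      then have "Poly_Mapping.lookup (mconst c * x) t = 0" if "total_degree t = m * d" for t
        using that by (simp add: in_keys_iff)
      then show ?thesis using q by (intro bexI[of _ q]) (auto simp: lookup_add)
    qed
  qed
  show "?L \<subseteq> mpol_span (?M d)"
  proof
    fix p :: "('v, 'k) mpol" assume p: "p \<in> ?L"
    then obtain q where q: "q \<in> mpol_span (?M d)"
      "\<forall>t. total_degree t = m * d \<longrightarrow> Poly_Mapping.lookup p t = Poly_Mapping.lookup q t"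
      using part sub by (force simp: graded_component_def)
    have "Poly_Mapping.lookup p t = Poly_Mapping.lookup q t" for t
    proof (cases "total_degree t = m * d")
      case False
      then have "t \<notin> Poly_Mapping.keys p" "t \<notin> Poly_Mapping.keys q"
        using p hom_span[OF q(1)] by (auto simp: graded_component_def)
      then show ?thesis by (simp add: in_keys_iff)
    qed (use q in auto)
    then have "p = q" by (intro poly_mapping_eqI)
    with q show "p \<in> mpol_span (?M d)" by simp
  qed
qed

text \<open>For a standard graded algebra \<open>A\<close> with irrelevant ideal \<open>I\<close>, the following is the length
  of \<open>A / I^(d+1)\<close>.  It agrees for large \<open>d\<close> with a unique polynomial in \<open>d\<close>, whose degree is
  the Krull dimension of \<open>A\<close>.\<close>

definition hilbert_samuel_function :: "nat \<Rightarrow> ('v, 'k::field) mpol set \<Rightarrow> nat \<Rightarrow> nat" where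
  "hilbert_samuel_function m A d = (\<Sum>i\<le>d. mpol_dim (graded_component m A i))"

definition hilbert_samuel_polynomial :: "nat \<Rightarrow> ('v, 'k::field) mpol set \<Rightarrow> real poly" where
  "hilbert_samuel_polynomial m A =
     (THE P. \<forall>\<^sub>F d in sequentially. real (hilbert_samuel_function m A d) = poly P (real d))"

definition hs_multiplicity :: "nat \<Rightarrow> ('v, 'k::field) mpol set \<Rightarrow> real" where
  "hs_multiplicity m A =
     (let P = hilbert_samuel_polynomial m A in fact (degree P) * lead_coeff P)"

end

theory Submission
  imports Defs "HOL-Analysis.Simplex_Content" "HOL-Library.Fun_Lexorder"
begin

text \<open>Let \<open>n\<close> be the number of nodes, \<open>S\<close> the set of indicator vectors of the edges and
  \<open>K\<close> the convex hull of \<open>S\<close> and the origin. Since \<open>K\<close> is the pyramid over the edge polytope,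
  the normalized volume of the polytope is \<open>n! vol(K) / m\<close>. The value of the Hilbert-Samuel function
  at \<open>d\<close> is the number of sums of at most \<open>d\<close> elements of \<open>S\<close>; it is eventually polynomial by
  Khovanskii's argument, and its growth rate is that of the number of points of the lattice \<open>L\<close>
  generated by \<open>S\<close> in the dilate \<open>d K\<close>. If the nodes of each component are pivot equivalent, then
  \<open>L\<close> contains \<open>e\<^sub>x - e\<^sub>y\<close> for all \<open>x\<close>, \<open>y\<close> in the same component, so it is cut out by requiring each
  component sum to be divisible by \<open>m\<close>. It has index \<open>m\<^sup>c\<close>, whence the multiplicity is
  \<open>n! vol(K) / m\<^sup>c\<close>. Otherwise some component has two pivot classes, and since
  every edge of the component meets a class in the same number of nodes, \<open>S\<close> lies in a linear
  hyperplane.\<close>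

section \<open>Eventually polynomial functions\<close>

text \<open>The pyramid \<open>K\<close> is used because the Hilbert-Samuel function adds up all
  degrees at most \<open>d\<close>: its growth exponent is then \<open>n\<close>, the dimension of
  \<open>K\<close>, and no lattice inside the hyperplane has to be parametrized. The exponent
  \<open>c - 1\<close> is the difference of two effects: the index divides by \<open>m ^ c\<close>,
  while the height of the pyramid, which is proportional to \<open>m\<close>, divides the volume of
  the polytope by \<open>m\<close> only once.

  A limit of normalized counts does not determine the multiplicity by itself, since
  \<open>hilbert_samuel_polynomial\<close> is a definite description. A polynomial that agrees
  eventually must first be shown to exist; only then does a nonzero limit fix its degree and its
  leading coefficient.

  The main obstacle in the count is that sums of vectors from \<open>S\<close> may miss lattice
  points of the cone over \<open>S\<close>. A fixed translation moves every lattice point of a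
  slightly smaller dilate into the set of sums. Since neither the translation nor the loss in the
  dilation factor depends on \<open>d\<close>, the gaps do not affect the leading term.\<close>

definition eventually_polynomial :: "(nat \<Rightarrow> nat) \<Rightarrow> bool" where
  "eventually_polynomial F \<longleftrightarrow> (\<exists>P::real poly. \<forall>\<^sub>F d in sequentially. real (F d) = poly P (real d))"

text \<open>Summing \<open>(i + 1) ^ Suc k - i ^ Suc k\<close> telescopes, while the binomial
  expansion expresses the same sum through power sums of exponent at most \<open>k\<close>.
  \<open>Q\<close> is this identity solved for the sum of exponent \<open>k\<close>, the lower ones
  being polynomial by induction.\<close>

lemma sum_power_eq_poly:
  "\<exists>q::real poly. \<forall>d::nat. (\<Sum>i\<le>d. real i ^ k) = poly q (real d)"
proof (induction k rule: less_induct)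
  case (less k)
  then obtain q where q: "\<And>j d. j < k \<Longrightarrow> (\<Sum>i\<le>d. real i ^ j) = poly (q j) (real d)" by metis
  define Q where "Q = smult (1 / real (Suc k)) ([:1, 1:] ^ Suc k - (\<Sum>j<k. smult (real (Suc k choose j)) (q j)))"
  have "(\<Sum>i\<le>d. real i ^ k) = poly Q (real d)" for d
  proof -
    have expand: "(real i + 1) ^ Suc k - real i ^ Suc k
        = (\<Sum>j<k. real (Suc k choose j) * real i ^ j) + real (Suc k) * real i ^ k" for i
    proof -
      have "(real i + 1) ^ Suc k = (\<Sum>j\<le>Suc k. real (Suc k choose j) * real i ^ j)"
        by (subst binomial_ring) simp
      also have "\<dots> = (\<Sum>j<k. real (Suc k choose j) * real i ^ j) + real (Suc k) * real i ^ k + real i ^ Suc k"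
        by (simp flip: lessThan_Suc_atMost)
      finally show ?thesis by simp
    qed
    have "(\<Sum>i\<le>d. (real i + 1) ^ Suc k - real i ^ Suc k) = (real d + 1) ^ Suc k"
      by (induction d) (simp_all add: algebra_simps)
    also have "(\<Sum>i\<le>d. (real i + 1) ^ Suc k - real i ^ Suc k)
        = (\<Sum>j<k. real (Suc k choose j) * (\<Sum>i\<le>d. real i ^ j)) + real (Suc k) * (\<Sum>i\<le>d. real i ^ k)"
      unfolding expand sum.distrib
      by (subst sum.swap) (simp add: sum_distrib_left)
    also have "(\<Sum>j<k. real (Suc k choose j) * (\<Sum>i\<le>d. real i ^ j))
        = (\<Sum>j<k. real (Suc k choose j) * poly (q j) (real d))"
      using q by simp
    finally have "real (Suc k) * (\<Sum>i\<le>d. real i ^ k)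
        = (real d + 1) ^ Suc k - (\<Sum>j<k. real (Suc k choose j) * poly (q j) (real d))"
      by linarith
    then have "(\<Sum>i\<le>d. real i ^ k) = ((real d + 1) ^ Suc k - (\<Sum>j<k. real (Suc k choose j) * poly (q j) (real d))) / real (Suc k)"
      by (simp add: field_simps del: power_Suc)
    then show ?thesis
      unfolding Q_def by (simp add: poly_sum poly_power add.commute del: power_Suc)
  qed
  then show ?case by blast
qed

lemma sum_poly_eq_poly:
  fixes p :: "real poly"
  shows "\<exists>q::real poly. \<forall>d::nat. (\<Sum>i\<le>d. poly p (real i)) = poly q (real d)"
proof -
  obtain q where q: "\<And>k d. (\<Sum>i\<le>d. real i ^ k) = poly (q k) (real d)"
    using sum_power_eq_poly by metis
  have "(\<Sum>i\<le>d. poly p (real i)) = poly (\<Sum>k\<le>degree p. smult (coeff p k) (q k)) (real d)" for d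
    unfolding poly_altdef[of p] by (subst sum.swap) (simp add: poly_sum q flip: sum_distrib_left)
  then show ?thesis by blast
qed

lemma eventually_polynomial_const: "eventually_polynomial (\<lambda>_. c)"
  unfolding eventually_polynomial_def by (rule exI[of _ "[:real c:]"]) simp

lemma eventually_polynomial_add:
  assumes "eventually_polynomial F" "eventually_polynomial G"
  shows "eventually_polynomial (\<lambda>d. F d + G d)"
proof -
  from assms obtain P Q where
    "\<forall>\<^sub>F d in sequentially. real (F d) = poly P (real d)"
    "\<forall>\<^sub>F d in sequentially. real (G d) = poly Q (real d)"
    unfolding eventually_polynomial_def by blast
  then have "\<forall>\<^sub>F d in sequentially. real (F d + G d) = poly (P + Q) (real d)"
    by eventually_elim simp
  then show ?thesis unfolding eventually_polynomial_def by blast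
qed

lemma eventually_polynomial_sum:
  assumes "finite I" "\<And>i. i \<in> I \<Longrightarrow> eventually_polynomial (F i)"
  shows "eventually_polynomial (\<lambda>d. \<Sum>i\<in>I. F i d)"
  using assms
  by (induction I rule: finite_induct) (simp_all add: eventually_polynomial_const eventually_polynomial_add)

text \<open>Natural subtraction is truncated, so composition with \<open>d - j\<close> is polynomial
  only from \<open>j\<close> on, which suffices.\<close>

lemma eventually_polynomial_shift:
  assumes "eventually_polynomial F"
  shows "eventually_polynomial (\<lambda>d. F (d - j))"
proof -
  from assms obtain P where P: "\<forall>\<^sub>F d in sequentially. real (F d) = poly P (real d)"
    unfolding eventually_polynomial_def by blast
  have "filterlim (\<lambda>d. d - j) sequentially sequentially"
    by (rule filterlim_minus_const_nat_at_top)
  with P have "\<forall>\<^sub>F d in sequentially. real (F (d - j)) = poly P (real (d - j))"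
    by (rule eventually_compose_filterlim)
  with eventually_ge_at_top[of j]
  have "\<forall>\<^sub>F d in sequentially. real (F (d - j)) = poly (pcompose P [:- real j, 1:]) (real d)"
    by eventually_elim (simp add: poly_pcompose of_nat_diff add.commute)
  then show ?thesis unfolding eventually_polynomial_def by blast
qed

lemma eventually_polynomial_cumulative:
  assumes "eventually_polynomial F"
  shows "eventually_polynomial (\<lambda>d. \<Sum>i\<le>d. F i)"
proof -
  from assms obtain P N where P: "\<And>d. d \<ge> N \<Longrightarrow> real (F d) = poly P (real d)"
    unfolding eventually_polynomial_def eventually_sequentially by blast
  obtain Q where Q: "\<And>d. (\<Sum>i\<le>d. poly P (real i)) = poly Q (real d)"
    using sum_poly_eq_poly by blast
  \<comment> \<open>The finitely many arguments at which \<open>F\<close> may deviate from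
    \<open>P\<close> contribute a constant to all later partial sums.\<close>
  define c where "c = (\<Sum>i<N. real (F i) - poly P (real i))"
  have "real (\<Sum>i\<le>d. F i) = poly (Q + [:c:]) (real d)" if "d \<ge> N" for d
  proof -
    have "(\<Sum>i\<le>d. real (F i) - poly P (real i)) = c"
      unfolding c_def using that P by (intro sum.mono_neutral_right) auto
    then show ?thesis by (simp add: sum_subtractf Q)
  qed
  then show ?thesis
    unfolding eventually_polynomial_def eventually_sequentially by blast
qed

section \<open>Chain conditions and counts for down-closed sets of exponents\<close>

lemma monotone_subsequence_coordinatewise:
  fixes f :: "nat \<Rightarrow> 'a \<Rightarrow> nat"
  assumes "finite I"
  shows "\<exists>r::nat \<Rightarrow> nat. strict_mono r \<and> (\<forall>i\<in>I. incseq (\<lambda>n. f (r n) i))"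
  using assms
proof (induction I rule: finite_induct)
  case empty
  show ?case by (rule exI[of _ id]) (simp add: strict_mono_def)
next
  case (insert a I)
  then obtain r where r: "strict_mono r" "\<forall>i\<in>I. incseq (\<lambda>n. f (r n) i)" by blast
  obtain s where s: "strict_mono s" "monoseq (\<lambda>n. f (r (s n)) a)"
    using seq_monosub[of "\<lambda>n. f (r n) a"] by blast
  have "\<exists>k. incseq (\<lambda>n. f (r (s (n + k))) a)"
  proof (cases "incseq (\<lambda>n. f (r (s n)) a)")
    case True
    then show ?thesis by (intro exI[of _ 0]) simp
  next
    case False
    with s have dec: "decseq (\<lambda>n. f (r (s n)) a)" by (simp add: monoseq_iff)
    \<comment> \<open>A decreasing sequence of naturals is constant from the index of its minimum
      on, so dropping the first \<open>k\<close> terms makes it increasing too.\<close>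
    obtain k where k: "\<And>n. f (r (s k)) a \<le> f (r (s n)) a"
      using ex_has_least_nat[of "\<lambda>_. True" 0 "\<lambda>n. f (r (s n)) a"] by auto
    have "f (r (s (n + k))) a = f (r (s k)) a" for n
      using decseqD[OF dec, of k "n + k"] k[of "n + k"] by simp
    then show ?thesis by (intro exI[of _ k]) (simp add: incseq_def)
  qed
  then obtain k where k: "incseq (\<lambda>n. f (r (s (n + k))) a)" by blast
  have "strict_mono (\<lambda>n. r (s (n + k)))"
    using r(1) s(1) by (simp add: strict_mono_def)
  moreover have "incseq (\<lambda>n. f (r (s (n + k))) i)" if "i \<in> insert a I" for i
  proof (cases "i = a")
    case False
    then have "incseq (\<lambda>n. f (r n) i)" using r(2) that by blast
    moreover have "s (x + k) \<le> s (y + k)" if "x \<le> y" for x y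
      using s(1) that by (simp add: strict_mono_less_eq)
    ultimately show ?thesis by (simp add: incseq_def)
  qed (use k in simp)
  ultimately show ?case by blast
qed

text \<open>Complements of down-closed sets are the exponent sets of monomial ideals, so this is the
  ascending chain condition for such ideals, in the form of Dickson's lemma.\<close>

lemma antitone_down_closed_stabilizes:
  fixes D :: "nat \<Rightarrow> ('a \<Rightarrow> nat) set"
  assumes "finite I" and supp: "\<And>j f x. f \<in> D j \<Longrightarrow> x \<notin> I \<Longrightarrow> f x = 0"
    and down: "\<And>j f g. f \<in> D j \<Longrightarrow> g \<le> f \<Longrightarrow> g \<in> D j"
    and anti: "\<And>i j. i \<le> j \<Longrightarrow> D j \<subseteq> D i"
  shows "\<exists>J. \<forall>j\<ge>J. D j = D J"
proof (rule ccontr)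
  assume "\<not> ?thesis"
  then have "\<forall>J. \<exists>f j. f \<in> D J \<and> j \<ge> J \<and> f \<notin> D j" using anti by blast
  then obtain f j where fj: "\<And>J. f J \<in> D J" "\<And>J. f J \<notin> D (j J)" by metis
  obtain r :: "nat \<Rightarrow> nat" where r: "strict_mono r" "\<forall>i\<in>I. incseq (\<lambda>n. f (r n) i)"
    using monotone_subsequence_coordinatewise[OF assms(1)] by blast
  \<comment> \<open>The element \<open>f (r 0)\<close> has left the chain at stage \<open>l\<close>.
    Since \<open>r l\<close> is at least \<open>l\<close>, the element \<open>f (r l)\<close> still
    lies in \<open>D l\<close>, and being above \<open>f (r 0)\<close> it would force
    \<open>f (r 0)\<close> to lie there as well.\<close>
  define l where "l = j (r 0)"
  have "f (r 0) \<le> f (r l)"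
  proof (rule le_funI)
    fix x show "f (r 0) x \<le> f (r l) x"
      using r(2) supp[OF fj(1)] by (cases "x \<in> I") (auto simp: incseq_def)
  qed
  moreover have "f (r l) \<in> D l"
    using fj(1) anti[OF strict_mono_imp_increasing[OF r(1)], of l] by blast
  ultimately show False using down fj(2) unfolding l_def by blast
qed

lemma finite_bounded_sum_functions:
  fixes I :: "'a set"
  assumes "finite I"
  shows "finite {f::'a \<Rightarrow> nat. (\<forall>x. x \<notin> I \<longrightarrow> f x = 0) \<and> sum f I \<le> d}"
proof (rule finite_subset)
  show "finite {f. \<forall>x. (x \<in> I \<longrightarrow> f x \<in> {..d}) \<and> (x \<notin> I \<longrightarrow> f x = 0)}"
    by (rule finite_set_of_finite_funs[OF assms]) simp
  show "{f. (\<forall>x. x \<notin> I \<longrightarrow> f x = 0) \<and> sum f I \<le> d}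
      \<subseteq> {f. \<forall>x. (x \<in> I \<longrightarrow> f x \<in> {..d}) \<and> (x \<notin> I \<longrightarrow> f x = 0)}"
  proof (intro subsetI CollectI allI conjI impI)
    fix f :: "'a \<Rightarrow> nat" and x
    assume f: "f \<in> {f. (\<forall>x. x \<notin> I \<longrightarrow> f x = 0) \<and> sum f I \<le> d}"
    show "f x \<in> {..d}" if "x \<in> I"
      using member_le_sum[OF that _ assms, of f] f by simp
    show "f x = 0" if "x \<notin> I" using f that by simp
  qed
qed

text \<open>This is the Hilbert function, summed over degrees, of the quotient by a monomial ideal.
  Induction on the number of variables cuts \<open>D\<close> into slices by the exponent of
  \<open>a\<close>. The slices decrease and hence take only finitely many shapes.\<close>

lemma eventually_polynomial_down_closed:
  fixes I :: "'a set" and D :: "('a \<Rightarrow> nat) set"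
  assumes "finite I" and "\<And>f x. f \<in> D \<Longrightarrow> x \<notin> I \<Longrightarrow> f x = 0"
    and "\<And>f g. f \<in> D \<Longrightarrow> g \<le> f \<Longrightarrow> g \<in> D"
  shows "eventually_polynomial (\<lambda>d. card {f \<in> D. sum f I \<le> d})"
  using assms
proof (induction I arbitrary: D rule: finite_induct)
  case empty
  then show ?case by (simp add: eventually_polynomial_const)
next
  case (insert a I)
  \<comment> \<open>The slice at exponent \<open>j\<close> is stored with entry 0 at
    \<open>a\<close>, so that it is supported on \<open>I\<close> and slices of different level can
    be compared.\<close>
  define S where "S j = {f. f a = 0 \<and> f(a := j) \<in> D}" for j
  define c where "c j d = card {f \<in> S j. sum f I \<le> d}" for j d
  have supp: "f x = 0" if "f \<in> S j" "x \<notin> I" for f x j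
  proof (cases "x = a")
    case False
    have "f(a := j) \<in> D" "x \<notin> insert a I" using that False by (simp_all add: S_def)
    from insert.prems(1)[OF this] have "(f(a := j)) x = 0" .
    with False show ?thesis by simp
  qed (use that in \<open>simp add: S_def\<close>)
  have down: "g \<in> S j" if "f \<in> S j" "g \<le> f" for f g j
  proof -
    have "g(a := j) \<le> f(a := j)" using that(2) by (auto simp: le_fun_def)
    moreover have "g a = 0" using that le_funD[of g f a] by (simp add: S_def)
    ultimately show ?thesis using that insert.prems(2) by (auto simp: S_def)
  qed
  have anti: "S j \<subseteq> S i" if "i \<le> j" for i j
  proof
    fix f assume f: "f \<in> S j"
    have "f(a := i) \<le> f(a := j)" using that by (auto simp: le_fun_def)
    with f insert.prems(2) show "f \<in> S i" by (auto simp: S_def)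
  qed
  have "\<exists>J. \<forall>j\<ge>J. S j = S J"
  proof (rule antitone_down_closed_stabilizes[OF insert.hyps(1)])
    show "f x = 0" if "f \<in> S j" "x \<notin> I" for j f x using that by (rule supp)
    show "g \<in> S j" if "f \<in> S j" "g \<le> f" for j f g using that by (rule down)
    show "S j \<subseteq> S i" if "i \<le> j" for i j using that by (rule anti)
  qed
  then obtain J where J: "\<And>j. j \<ge> J \<Longrightarrow> S j = S J" by blast
  have poly: "eventually_polynomial (c j)" for j
    unfolding c_def by (rule insert.IH) (use supp down in blast)+
  have fin: "finite {f \<in> S j. sum f I \<le> d}" for j d
    by (rule finite_subset[OF _ finite_bounded_sum_functions[OF insert.hyps(1), of d]]) (auto dest: supp)
  have count: "card {f \<in> D. sum f (insert a I) \<le> d} = (\<Sum>j\<le>d. c j (d - j))" for d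
  proof -
    have "{f \<in> D. sum f (insert a I) \<le> d}
        = (\<Union>j\<in>{..d}. (\<lambda>f. f(a := j)) ` {f \<in> S j. sum f I \<le> d - j})" (is "?L = ?R")
    proof
      show "?L \<subseteq> ?R"
      proof
        fix f assume f: "f \<in> ?L"
        have "sum (f(a := 0)) I = sum f I" using insert.hyps by (intro sum.cong) auto
        then have "f(a := 0) \<in> {g \<in> S (f a). sum g I \<le> d - f a}"
          using f insert.hyps by (auto simp: S_def simp del: fun_upd_apply simp: fun_upd_same)
        moreover have "f = (f(a := 0))(a := f a)" by simp
        moreover have "f a \<le> d" using f insert.hyps by simp
        ultimately show "f \<in> ?R" by blast
      qed
      show "?R \<subseteq> ?L"
      proof
        fix f assume "f \<in> ?R"
        then obtain j g where j: "j \<le> d" and g: "g \<in> S j" "sum g I \<le> d - j" and f: "f = g(a := j)"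
          by blast
        have "sum f I = sum g I" using insert.hyps f by (intro sum.cong) auto
        then show "f \<in> ?L" using insert.hyps f g j by (auto simp: S_def)
      qed
    qed
    also have "card \<dots> = (\<Sum>j\<le>d. card ((\<lambda>f. f(a := j)) ` {f \<in> S j. sum f I \<le> d - j}))"
    proof (rule card_UN_disjoint)
      show "\<forall>i\<in>{..d}. \<forall>j\<in>{..d}. i \<noteq> j \<longrightarrow>
          (\<lambda>f. f(a := i)) ` {f \<in> S i. sum f I \<le> d - i} \<inter> (\<lambda>f. f(a := j)) ` {f \<in> S j. sum f I \<le> d - j} = {}"
        by (auto dest: fun_cong[of _ _ a])
    qed (use fin in auto)
    also have "\<dots> = (\<Sum>j\<le>d. c j (d - j))"
      unfolding c_def
    proof (intro sum.cong refl card_image inj_onI)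
      fix j f g assume *: "f \<in> {f \<in> S j. sum f I \<le> d - j}" "g \<in> {f \<in> S j. sum f I \<le> d - j}" "f(a := j) = g(a := j)"
      show "f = g"
      proof
        fix x
        have "(f(a := j)) x = (g(a := j)) x" using *(3) by simp
        then show "f x = g x" using *(1,2) by (cases "x = a") (simp_all add: S_def)
      qed
    qed
    finally show ?thesis .
  qed
  \<comment> \<open>From \<open>J\<close> on all slices coincide. Their contributions form a
    cumulative sum of one function, while the slices below \<open>J\<close> give finitely many
    shifted functions.\<close>
  have split: "(\<Sum>j\<le>d. c j (d - j)) = (\<Sum>j<J. c j (d - j)) + (\<Sum>i\<le>d - J. c J i)" if "d \<ge> J" for d
  proof -
    have "{..d} = {..<J} \<union> {J..d}" using that by auto
    then have "(\<Sum>j\<le>d. c j (d - j)) = (\<Sum>j<J. c j (d - j)) + (\<Sum>j=J..d. c j (d - j))"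
      by (simp add: sum.union_disjoint ivl_disj_int)
    also have "(\<Sum>j=J..d. c j (d - j)) = (\<Sum>j=J..d. c J (d - j))"
    proof (rule sum.cong[OF refl])
      fix j assume "j \<in> {J..d}"
      then have "S j = S J" by (intro J) simp
      then show "c j (d - j) = c J (d - j)" by (simp only: c_def)
    qed
    also have "\<dots> = (\<Sum>i\<le>d - J. c J i)"
      by (rule sum.reindex_bij_witness[of _ "\<lambda>i. d - i" "\<lambda>j. d - j"]) (use that in auto)
    finally show ?thesis .
  qed
  have "eventually_polynomial (\<lambda>d. (\<Sum>j<J. c j (d - j)) + (\<Sum>i\<le>d - J. c J i))"
    by (intro eventually_polynomial_add eventually_polynomial_sum eventually_polynomial_shift
        eventually_polynomial_shift[of "\<lambda>d. \<Sum>i\<le>d. c J i"] eventually_polynomial_cumulative poly) simp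
  then obtain P where "\<forall>\<^sub>F d in sequentially.
      real ((\<Sum>j<J. c j (d - j)) + (\<Sum>i\<le>d - J. c J i)) = poly P (real d)"
    unfolding eventually_polynomial_def by blast
  then have "\<forall>\<^sub>F d in sequentially. real (card {f \<in> D. sum f (insert a I) \<le> d}) = poly P (real d)"
    using eventually_ge_at_top[of J] by eventually_elim (simp add: count split)
  then show ?case unfolding eventually_polynomial_def by blast
qed

text \<open>Every fibre of \<open>\<phi>\<close> is represented by its lexicographically least element, and these
  representatives form a down-closed set.\<close>

lemma eventually_polynomial_image:
  fixes \<phi> :: "(nat \<Rightarrow> nat) \<Rightarrow> 'b"
  assumes add: "\<And>f g h. \<phi> f = \<phi> g \<Longrightarrow> \<phi> (\<lambda>i. f i + h i) = \<phi> (\<lambda>i. g i + h i)"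
    and deg: "\<And>f g. \<phi> f = \<phi> g \<Longrightarrow> sum f {..<k} = sum g {..<k}"
  shows "eventually_polynomial (\<lambda>d. card (\<phi> ` {f. (\<forall>i\<ge>k. f i = 0) \<and> sum f {..<k} \<le> d}))"
proof -
  define N where "N = {f::nat \<Rightarrow> nat. \<forall>i\<ge>k. f i = 0}"
  define D where "D = {f \<in> N. \<forall>g\<in>N. \<phi> g = \<phi> f \<longrightarrow> \<not> less_fun g f}"
  have "eventually_polynomial (\<lambda>d. card {f \<in> D. sum f {..<k} \<le> d})"
  proof (rule eventually_polynomial_down_closed)
    fix f g assume f: "f \<in> D" and g: "g \<le> f"
    have gf: "g i \<le> f i" for i using g by (rule le_funD)
    have gN: "g \<in> N" unfolding N_def
    proof (intro CollectI allI impI)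
      fix i assume "k \<le> i"
      then show "g i = 0" using gf[of i] f by (simp add: D_def N_def)
    qed
    have "\<not> less_fun g' g" if g': "g' \<in> N" "\<phi> g' = \<phi> g" for g'
    proof
      assume less: "less_fun g' g"
      \<comment> \<open>\<open>h\<close> arises from the smaller element \<open>g'\<close> by adding
        the same difference that leads from \<open>g\<close> to \<open>f\<close>. It therefore lies
        in the fibre of \<open>f\<close> and precedes \<open>f\<close> lexicographically.\<close>
      define h where "h = (\<lambda>i. g' i + (f i - g i))"
      have "\<phi> h = \<phi> (\<lambda>i. g i + (f i - g i))" unfolding h_def using g'(2) by (rule add)
      also have "(\<lambda>i. g i + (f i - g i)) = f" using gf by simp
      finally have "\<phi> h = \<phi> f" .
      moreover have "h \<in> N" using g' f by (simp add: h_def N_def D_def)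
      moreover have "less_fun h f"
      proof -
        obtain i where i: "g' i < g i" "\<And>j. j < i \<Longrightarrow> g' j = g j" using less by (auto elim: less_funE)
        have "h i < f i" using i(1) gf[of i] by (simp add: h_def)
        moreover have "h j = f j" if "j < i" for j using i(2)[OF that] gf[of j] by (simp add: h_def)
        ultimately show ?thesis by (auto intro: less_funI)
      qed
      ultimately show False using f by (auto simp: D_def)
    qed
    with gN show "g \<in> D" by (simp add: D_def)
  qed (auto simp: D_def N_def)
  moreover have "card {f \<in> D. sum f {..<k} \<le> d} = card (\<phi> ` {f \<in> N. sum f {..<k} \<le> d})" for d
  proof (rule bij_betw_same_card[of \<phi>], rule bij_betw_imageI)
    show "inj_on \<phi> {f \<in> D. sum f {..<k} \<le> d}"
    proof (rule inj_onI, rule ccontr)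
      fix f g assume *: "f \<in> {f \<in> D. sum f {..<k} \<le> d}" "g \<in> {f \<in> D. sum f {..<k} \<le> d}" "\<phi> f = \<phi> g" "f \<noteq> g"
      define i where "i = (LEAST i. f i \<noteq> g i)"
      have i: "f i \<noteq> g i" 
        unfolding i_def by (rule LeastI_ex) (use *(4) in \<open>simp add: fun_eq_iff\<close>)
      have "\<forall>j<i. f j = g j" unfolding i_def using not_less_Least by blast
      with i have "less_fun f g \<or> less_fun g f"
        unfolding less_fun_def by (metis linorder_neqE_nat)
      with * show False by (auto simp: D_def)
    qed
    show "\<phi> ` {f \<in> D. sum f {..<k} \<le> d} = \<phi> ` {f \<in> N. sum f {..<k} \<le> d}"
    proof
      show "\<phi> ` {f \<in> N. sum f {..<k} \<le> d} \<subseteq> \<phi> ` {f \<in> D. sum f {..<k} \<le> d}"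
      proof
        fix y assume "y \<in> \<phi> ` {f \<in> N. sum f {..<k} \<le> d}"
        then obtain f where f: "f \<in> N" "sum f {..<k} \<le> d" "y = \<phi> f" by blast
        \<comment> \<open>The value of \<open>\<phi>\<close> determines the degree, so a fibre is
          finite and has a lexicographically minimal element of the same degree as
          \<open>f\<close>.\<close>
        define F where "F = {g \<in> N. \<phi> g = y}"
        have "F \<subseteq> {g. (\<forall>x. x \<notin> {..<k} \<longrightarrow> g x = 0) \<and> sum g {..<k} \<le> d}"
        proof (intro subsetI CollectI conjI allI impI)
          fix g x assume g: "g \<in> F"
          show "g x = 0" if "x \<notin> {..<k}" using g that by (simp add: F_def N_def)
          show "sum g {..<k} \<le> d" using g f deg[of g f] by (simp add: F_def)
        qed
        then have "finite F" by (rule finite_subset) (rule finite_bounded_sum_functions, simp)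
        moreover have "f \<in> F" using f by (simp add: F_def)
        moreover have "transp_on F less_fun" by (auto intro!: transp_onI intro: less_fun_trans)
        moreover have "asymp_on F less_fun" by (auto intro!: asymp_onI dest: less_fun_asym)
        ultimately obtain g where g: "g \<in> F" "\<forall>h\<in>F. h \<noteq> g \<longrightarrow> \<not> less_fun h g"
          using Finite_Set.bex_min_element[of F less_fun] by blast
        have "g \<in> D" using g less_fun_irrefl[of g] by (auto simp: D_def F_def)
        moreover have "sum g {..<k} \<le> d" using g(1) deg[of g f] f by (simp add: F_def)
        ultimately show "y \<in> \<phi> ` {f \<in> D. sum f {..<k} \<le> d}" using g(1) by (auto simp: F_def)
      qed
    qed (auto simp: D_def)
  qed
  ultimately show ?thesis by (simp add: N_def)
qed

section \<open>Lattice points in dilates\<close>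

definition integral_vec :: "real^'n \<Rightarrow> bool" where
  "integral_vec z \<longleftrightarrow> (\<forall>i. z $ i \<in> \<int>)"

definition floor_vec :: "real^'n \<Rightarrow> real^'n" where
  "floor_vec x = (\<chi> i. of_int \<lfloor>x $ i\<rfloor>)"

lemma finite_bounded_integral_vecs:
  fixes S :: "(real^'n) set"
  assumes "bounded S"
  shows "finite {z \<in> S. integral_vec z}"
proof -
  obtain B where B: "\<And>z. z \<in> S \<Longrightarrow> norm z \<le> B" using assms by (auto simp: bounded_iff)
  let ?F = "{f :: 'n \<Rightarrow> int. \<forall>i. (i \<in> UNIV \<longrightarrow> f i \<in> {-\<lceil>B\<rceil>..\<lceil>B\<rceil>}) \<and> (i \<notin> UNIV \<longrightarrow> f i = 0)}"
  have "{z \<in> S. integral_vec z} \<subseteq> (\<lambda>f. \<chi> i. of_int (f i)) ` ?F"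
  proof
    fix z assume z: "z \<in> {z \<in> S. integral_vec z}"
    define f where "f i = \<lfloor>z $ i\<rfloor>" for i
    have fz: "of_int (f i) = z $ i" for i
      using z unfolding f_def integral_vec_def by (auto simp: of_int_floor_cancel)
    have "\<bar>z $ i\<bar> \<le> of_int \<lceil>B\<rceil>" for i
    proof -
      have "norm z \<le> B" using B z by blast
      then show ?thesis using component_le_norm_cart[of z i] by linarith
    qed
    then have "(of_int \<bar>f i\<bar> :: real) \<le> of_int \<lceil>B\<rceil>" for i by (simp add: fz)
    then have "\<bar>f i\<bar> \<le> \<lceil>B\<rceil>" for i by (simp only: of_int_le_iff)
    then have "f i \<in> {-\<lceil>B\<rceil>..\<lceil>B\<rceil>}" for i by (simp add: abs_le_iff minus_le_iff)
    then have "f \<in> ?F" by blast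
    moreover have "z = (\<chi> i. of_int (f i))" by (simp add: vec_eq_iff fz)
    ultimately show "z \<in> (\<lambda>f. \<chi> i. of_int (f i)) ` ?F" by blast
  qed
  moreover have "finite ?F" by (rule finite_set_of_finite_funs) auto
  ultimately show ?thesis by (meson finite_imageI finite_subset)
qed

text \<open>The cell is a half-open cube of side \<open>\<epsilon>\<close> with lower corner
  \<open>\<epsilon> *\<^sub>R z\<close>, squeezed between the open and the closed box, which have
  equal volume.\<close>

lemma measure_floor_cell:
  fixes z :: "real^'n::finite"
  assumes z: "integral_vec z" and "0 < \<epsilon>"
  shows "{x. floor_vec ((1 / \<epsilon>) *\<^sub>R x) = z} \<in> sets borel"
    and "emeasure lborel {x. floor_vec ((1 / \<epsilon>) *\<^sub>R x) = z} = ennreal (\<epsilon> ^ CARD('n))"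
proof -
  let ?C = "{x. floor_vec ((1 / \<epsilon>) *\<^sub>R x) = z}"
  have *: "of_int \<lfloor>x $ i / \<epsilon>\<rfloor> = z $ i \<longleftrightarrow> \<epsilon> * z $ i \<le> x $ i \<and> x $ i < \<epsilon> * z $ i + \<epsilon>" for x :: "real^'n" and i
  proof -
    obtain k where k: "z $ i = of_int k" using z by (auto simp: integral_vec_def elim: Ints_cases)
    have "\<lfloor>x $ i / \<epsilon>\<rfloor> = k \<longleftrightarrow> of_int k \<le> x $ i / \<epsilon> \<and> x $ i / \<epsilon> < of_int k + 1"
      by (rule floor_eq_iff)
    then show ?thesis using \<open>0 < \<epsilon>\<close> unfolding k by (simp add: field_simps)
  qed
  have C: "?C = {x. \<forall>i. \<epsilon> * z $ i \<le> x $ i \<and> x $ i < \<epsilon> * z $ i + \<epsilon>}"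
    by (simp add: floor_vec_def vec_eq_iff *)
  show meas: "?C \<in> sets borel" unfolding C by measurable
  let ?a = "\<epsilon> *\<^sub>R z" and ?b = "\<epsilon> *\<^sub>R z + (\<chi> i. \<epsilon>)"
  have "box ?a ?b \<subseteq> ?C" "?C \<subseteq> cbox ?a ?b"
    unfolding C by (auto simp: mem_box_cart less_imp_le)
  then have "emeasure lborel (box ?a ?b) \<le> emeasure lborel ?C" "emeasure lborel ?C \<le> emeasure lborel (cbox ?a ?b)"
    using meas by (auto intro!: emeasure_mono)
  moreover have le: "?a \<bullet> b \<le> ?b \<bullet> b" if "b \<in> Basis" for b
    using that \<open>0 < \<epsilon>\<close> by (auto simp: Basis_vec_def inner_axis)
  have "(\<Prod>b\<in>Basis. (?b - ?a) \<bullet> b) = (\<Prod>b\<in>(Basis::(real^'n) set). \<epsilon>)"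
    by (rule prod.cong[OF refl]) (auto simp: Basis_vec_def inner_axis)
  then have vol: "(\<Prod>b\<in>Basis. (?b - ?a) \<bullet> b) = \<epsilon> ^ CARD('n)" by simp
  have "emeasure lborel (box ?a ?b) = ennreal (\<epsilon> ^ CARD('n))"
    using emeasure_lborel_box[of ?a ?b] le vol by simp
  moreover have "emeasure lborel (cbox ?a ?b) = ennreal (\<epsilon> ^ CARD('n))"
    using emeasure_lborel_cbox[of ?a ?b] le vol by simp
  ultimately show "emeasure lborel ?C = ennreal (\<epsilon> ^ CARD('n))" by simp
qed

lemma integral_vec_floor_vec [simp]: "integral_vec (floor_vec x)"
  by (simp add: integral_vec_def floor_vec_def)

lemma norm_floor_vec_diff: "norm (floor_vec x - x) \<le> real CARD('n::finite)" for x :: "real^'n"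
proof -
  have "norm (floor_vec x - x) \<le> (\<Sum>i\<in>UNIV. \<bar>(floor_vec x - x) $ i\<bar>)" by (rule norm_le_l1_cart)
  also have "\<dots> \<le> (\<Sum>i\<in>(UNIV::'n set). 1)"
  proof (rule sum_mono)
    fix i
    have "\<bar>of_int \<lfloor>x $ i\<rfloor> - x $ i\<bar> \<le> 1" by linarith
    then show "\<bar>(floor_vec x - x) $ i\<bar> \<le> 1" by (simp add: floor_vec_def)
  qed
  finally show ?thesis by simp
qed

text \<open>The points counted index disjoint cells of side length \<open>m / d\<close>, and the indicator function
  of the union of these cells converges to that of \<open>K\<close> off the frontier of \<open>K\<close>.\<close>

lemma lattice_point_count_limit:
  fixes K :: "(real^'n::finite) set" and q :: "real^'n" and m :: real
  assumes bK: "bounded K" and K: "K \<in> sets borel" and fr: "negligible (frontier K)" and m: "0 < m"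
  shows "(\<lambda>d. real (card {z. integral_vec z \<and> (1 / real d) *\<^sub>R (q + m *\<^sub>R z) \<in> K}) / real d ^ CARD('n))
    \<longlonglongrightarrow> measure lborel K / m ^ CARD('n)"
proof -
  let ?n = "CARD('n)"
  define Z where "Z d = {z. integral_vec z \<and> (1 / real d) *\<^sub>R (q + m *\<^sub>R z) \<in> K}" for d
  \<comment> \<open>\<open>g d x\<close> is the scaled coset point whose cell contains
    \<open>x\<close>. Thus \<open>G d\<close> is the union of the cells of counted points, and the
    distance from \<open>x\<close> to \<open>g d x\<close> is of order \<open>1 / d\<close>.\<close>
  define g where "g d x = (1 / real d) *\<^sub>R (q + m *\<^sub>R floor_vec ((1 / (m / real d)) *\<^sub>R x))" for d x
  define G where "G d = {x. g d x \<in> K}" for d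
  have finZ: "finite (Z d)" if "d > 0" for d
  proof -
    have "Z d \<subseteq> {z \<in> (\<lambda>y. (real d / m) *\<^sub>R y + - ((1 / m) *\<^sub>R q)) ` K. integral_vec z}"
    proof
      fix z assume z: "z \<in> Z d"
      have "z = (real d / m) *\<^sub>R ((1 / real d) *\<^sub>R (q + m *\<^sub>R z)) + - ((1 / m) *\<^sub>R q)"
        using that m by (simp add: algebra_simps)
      with z show "z \<in> {z \<in> (\<lambda>y. (real d / m) *\<^sub>R y + - ((1 / m) *\<^sub>R q)) ` K. integral_vec z}"
        unfolding Z_def by blast
    qed
    moreover have "bounded ((\<lambda>y. (real d / m) *\<^sub>R y + - ((1 / m) *\<^sub>R q)) ` K)"
      using bounded_translation[OF bounded_scaling[OF bK], of "- ((1 / m) *\<^sub>R q)" "real d / m"]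
      by (simp add: image_image add.commute)
    ultimately show ?thesis by (blast intro: finite_subset finite_bounded_integral_vecs)
  qed
  have GU: "G d = (\<Union>z\<in>Z d. {x. floor_vec ((1 / (m / real d)) *\<^sub>R x) = z})" for d
    unfolding G_def g_def Z_def by auto
  have Gmeas: "G d \<in> sets borel" if "d > 0" for d
    unfolding GU using finZ[OF that] measure_floor_cell(1)[of _ "m / real d"] m that
    by (intro sets.finite_UN) (auto simp: Z_def)
  have Gvol: "measure lborel (G d) = real (card (Z d)) * (m / real d) ^ ?n" if "d > 0" for d
  proof -
    have eps: "0 < m / real d" using m that by simp
    have "emeasure lborel (G d) = (\<Sum>z\<in>Z d. emeasure lborel {x. floor_vec ((1 / (m / real d)) *\<^sub>R x) = z})"
      unfolding GU using finZ[OF that] measure_floor_cell(1)[OF _ eps]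
      by (intro sum_emeasure[symmetric]) (auto simp: Z_def disjoint_family_on_def)
    also have "\<dots> = (\<Sum>z\<in>Z d. ennreal ((m / real d) ^ ?n))"
      by (intro sum.cong refl measure_floor_cell(2) eps) (auto simp: Z_def)
    also have "\<dots> = ennreal (real (card (Z d)) * (m / real d) ^ ?n)"
      using eps by (simp add: ennreal_mult ennreal_of_nat_eq_real_of_nat)
    finally show ?thesis using eps by (intro measure_eq_emeasure_eq_ennreal) auto
  qed
  have dist_g: "norm (g d x - x) \<le> (norm q + m * ?n) / real d" if "d > 0" for d x
  proof -
    let ?y = "(1 / (m / real d)) *\<^sub>R x"
    have "x = (1 / real d) *\<^sub>R (m *\<^sub>R ?y)" using m that by simp
    then have "g d x - x = (1 / real d) *\<^sub>R (q + m *\<^sub>R (floor_vec ?y - ?y))"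
      unfolding g_def by (metis (no_types, opaque_lifting) add_diff_eq scaleR_right_diff_distrib)
    moreover have "norm (q + m *\<^sub>R (floor_vec ?y - ?y)) \<le> norm q + m * ?n"
      using m norm_floor_vec_diff[of ?y]
      by (intro order_trans[OF norm_triangle_ineq]) (simp add: mult_left_mono)
    ultimately show ?thesis using that by (simp only: norm_scaleR) (simp add: divide_right_mono)
  qed
  have lim0: "(\<lambda>d. (norm q + m * ?n) / real d) \<longlonglongrightarrow> 0"
    by (rule lim_const_over_n)
  have g_lim: "(\<lambda>d. g d x) \<longlonglongrightarrow> x" for x
  proof (rule Lim_null_comparison[OF _ lim0, THEN LIM_zero_cancel])
    show "\<forall>\<^sub>F d in sequentially. norm (g d x - x) \<le> (norm q + m * ?n) / real d"
      using eventually_gt_at_top[of 0] by eventually_elim (rule dist_g)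
  qed
  obtain B where B: "\<And>x. x \<in> K \<Longrightarrow> norm x \<le> B" using bK by (auto simp: bounded_iff)
  define R where "R = B + (norm q + m * ?n)"
  have G_bound: "norm x \<le> R" if "x \<in> G d" "d > 0" for x d
  proof -
    have "(norm q + m * ?n) / real d \<le> norm q + m * ?n"
      using that m by (intro divide_left_mono[of 1, simplified]) (auto intro!: add_nonneg_nonneg)
    then have "norm (g d x - x) \<le> norm q + m * ?n" using dist_g[OF that(2), of x] by linarith
    moreover have "norm (g d x) \<le> B" using that(1) B by (simp add: G_def)
    moreover have "norm x \<le> norm (g d x) + norm (g d x - x)"
      by (metis norm_minus_commute norm_triangle_sub)
    ultimately show ?thesis by (simp add: R_def)
  qed
  \<comment> \<open>Dominated convergence asks for measurability and a bound at every index. Passing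
    to \<open>Suc d\<close> keeps the side length positive, and all these sets lie in the ball of
    radius \<open>R\<close>.\<close>
  have "(\<lambda>d. \<integral>x. indicator (G (Suc d)) x \<partial>lborel) \<longlonglongrightarrow> (\<integral>x. (indicator K x :: real) \<partial>lborel)"
  proof (rule integral_dominated_convergence[where w = "indicator (cball 0 R)"])
    show "(indicator K :: _ \<Rightarrow> real) \<in> borel_measurable lborel" using K by simp
    show "\<And>d. (indicator (G (Suc d)) :: _ \<Rightarrow> real) \<in> borel_measurable lborel" using Gmeas by simp
    show "integrable lborel (indicator (cball 0 R) :: real^'n \<Rightarrow> real)"
      using emeasure_lborel_cball_finite[of "0::real^'n" R] by simp
    show "AE x in lborel. norm (indicator (G (Suc d)) x :: real) \<le> indicator (cball 0 R) x" for d
      by (rule AE_I2) (auto simp: indicator_def dest: G_bound)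
    have "AE x in lborel. x \<notin> frontier K"
      using fr by (intro AE_not_in) (simp add: negligible_iff_null_sets null_sets_completion_iff)
    then show "AE x in lborel. (\<lambda>d. indicator (G (Suc d)) x :: real) \<longlonglongrightarrow> indicator K x"
    proof eventually_elim
      fix x assume x: "x \<notin> frontier K"
      have gs: "(\<lambda>d. g (Suc d) x) \<longlonglongrightarrow> x" using g_lim by (rule LIMSEQ_Suc)
      have "\<forall>\<^sub>F d in sequentially. indicator (G (Suc d)) x = (indicator K x :: real)"
      proof (cases "x \<in> K")
        case True
        then have "x \<in> interior K" using x closure_subset by (auto simp: frontier_def)
        then have "\<forall>\<^sub>F d in sequentially. g (Suc d) x \<in> interior K"
          using gs by (intro topological_tendstoD[OF gs open_interior])
        then show ?thesis
          by eventually_elim (use True interior_subset[of K] in \<open>auto simp: G_def indicator_def\<close>)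
      next
        case False
        then have "x \<in> - closure K" using x interior_subset by (auto simp: frontier_def)
        then have "\<forall>\<^sub>F d in sequentially. g (Suc d) x \<in> - closure K"
          using gs by (intro topological_tendstoD[OF gs]) auto
        then show ?thesis
          by eventually_elim (use False closure_subset[of K] in \<open>auto simp: G_def indicator_def\<close>)
      qed
      then show "(\<lambda>d. indicator (G (Suc d)) x :: real) \<longlonglongrightarrow> indicator K x"
        by (rule tendsto_eventually)
    qed
  qed
  then have "(\<lambda>d. measure lborel (G (Suc d))) \<longlonglongrightarrow> measure lborel K" by simp
  then have "(\<lambda>d. measure lborel (G d)) \<longlonglongrightarrow> measure lborel K" by (rule LIMSEQ_imp_Suc)
  then have "(\<lambda>d. measure lborel (G d) / m ^ ?n) \<longlonglongrightarrow> measure lborel K / m ^ ?n"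
    by (rule tendsto_divide) (use m in auto)
  moreover have "\<forall>\<^sub>F d in sequentially. measure lborel (G d) / m ^ ?n = real (card (Z d)) / real d ^ ?n"
    using eventually_gt_at_top[of 0]
    by eventually_elim (use m in \<open>simp add: Gvol power_divide\<close>)
  ultimately show ?thesis unfolding Z_def by (rule Lim_transform_eventually)
qed

section \<open>Lattices cut out by congruences on block sums\<close>

definition block_lattice :: "nat \<Rightarrow> 'n set set \<Rightarrow> (real^'n::finite) set" where
  "block_lattice m P = {z. integral_vec z \<and> (\<forall>C\<in>P. \<exists>k::int. (\<Sum>x\<in>C. z $ x) = of_int k * real m)}"

text \<open>These are representatives modulo \<open>m\<close> of the cosets that make up
  \<open>block_lattice m P\<close>, provided \<open>m\<close> is positive. They are integer
  functions rather than vectors so that \<open>mod\<close> and \<open>dvd\<close> apply.\<close>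

definition block_residues :: "nat \<Rightarrow> 'n set set \<Rightarrow> ('n \<Rightarrow> int) set" where
  "block_residues m P = {q. (\<forall>x. q x \<in> {0..<int m}) \<and> (\<forall>C\<in>P. int m dvd (\<Sum>x\<in>C. q x))}"

text \<open>Ensures that the natural subtraction in the exponent of the coset count is not
  truncated.\<close>

lemma card_partition_on_le:
  assumes "finite A" "partition_on A P"
  shows "card P \<le> card A"
proof -
  have "card P = (\<Sum>C\<in>P. 1)" by simp
  also have "\<dots> \<le> (\<Sum>C\<in>P. card C)"
  proof (rule sum_mono)
    fix C assume "C \<in> P"
    then have "C \<noteq> {}" "C \<subseteq> A" using assms(2) by (auto simp: partition_on_def)
    then show "1 \<le> card C" using finite_subset[OF _ assms(1)] by (simp add: Suc_le_eq card_gt_0_iff)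
  qed
  also have "\<dots> = card A"
  proof -
    have "finite C" if "C \<in> P" for C
      using finite_subset[OF _ assms(1)] assms(2) that by (auto simp: partition_on_def)
    then show ?thesis
      using card_Union_disjoint[OF partition_onD2[OF assms(2)]] partition_onD1[OF assms(2)] by simp
  qed
  finally show ?thesis .
qed

text \<open>A residue vector is determined by its entries outside a system of representatives of the
  blocks, and these are arbitrary.\<close>

lemma card_block_residues:
  fixes P :: "'n::finite set set"
  assumes P: "partition_on UNIV P" and m: "0 < m"
  shows "card (block_residues m P) = m ^ (CARD('n) - card P)"
proof -
  define r where "r C = (SOME x::'n. x \<in> C)" for C
  have ne: "C \<noteq> {}" if "C \<in> P" for C using P that by (auto simp: partition_on_def)
  have r: "r C \<in> C" if "C \<in> P" for C unfolding r_def using ne[OF that] by (auto intro: someI_ex)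
  have disj: "C = D" if "C \<in> P" "D \<in> P" "x \<in> C" "x \<in> D" for C D x
    using disjointD[OF partition_onD2[OF P] that(1,2)] that(3,4) by blast
  define R where "R = r ` P"
  have r_inj: "inj_on r P" using disj r by (metis inj_onI)
  have R_iff: "x \<in> R \<longleftrightarrow> x = r C" if "C \<in> P" "x \<in> C" for x C
    using that r disj by (auto simp: R_def)
  define b where "b x = (THE C. C \<in> P \<and> x \<in> C)" for x
  have b: "b x = C" if "C \<in> P" "x \<in> C" for x C
    unfolding b_def
  proof (rule the_equality)
    show "C \<in> P \<and> x \<in> C" using that by simp
    show "D = C" if "D \<in> P \<and> x \<in> D" for D using disj[of D C x] that \<open>C \<in> P\<close> \<open>x \<in> C\<close> by simp
  qed
  have ex: "\<exists>C\<in>P. x \<in> C" for x using P by (auto simp: partition_on_def)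
  have split: "(\<Sum>x\<in>C. q x) = q (r C) + (\<Sum>x\<in>C - {r C}. q x)" if "C \<in> P" for C and q :: "'n \<Rightarrow> int"
    by (rule sum.remove) (use r that in auto)
  have "bij_betw (\<lambda>q. restrict q (- R)) (block_residues m P) (PiE (- R) (\<lambda>_. {0..<int m}))"
  proof (rule bij_betw_imageI)
    show "inj_on (\<lambda>q. restrict q (- R)) (block_residues m P)"
    proof (rule inj_onI)
      fix p q assume p: "p \<in> block_residues m P" and q: "q \<in> block_residues m P"
        and eq: "restrict p (- R) = restrict q (- R)"
      have off: "p x = q x" if "x \<notin> R" for x using fun_cong[OF eq, of x] that by simp
      show "p = q"
      proof
        fix x
        obtain C where C: "C \<in> P" "x \<in> C" using ex by blast
        show "p x = q x"
        proof (cases "x = r C")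
          case True
          have "(\<Sum>x\<in>C - {r C}. p x) = (\<Sum>x\<in>C - {r C}. q x)"
            using R_iff[OF C(1)] by (intro sum.cong refl off) auto
          moreover have "int m dvd (\<Sum>x\<in>C. p x) - (\<Sum>x\<in>C. q x)"
            using p q C by (intro dvd_diff) (auto simp: block_residues_def)
          ultimately have "int m dvd p x - q x" unfolding split[OF C(1)] True by simp
          moreover have "\<bar>p x - q x\<bar> < int m" 
          proof -
            have "0 \<le> p x" "p x < int m" "0 \<le> q x" "q x < int m" using p q by (auto simp: block_residues_def)
            then show ?thesis by linarith
          qed
          ultimately show ?thesis using dvd_imp_le_int[of "p x - q x" "int m"] by (cases "p x = q x") auto
        next
          case False
          then show ?thesis using R_iff[OF C] by (intro off) simp
        qed
      qed
    qed
    show "(\<lambda>q. restrict q (- R)) ` block_residues m P = PiE (- R) (\<lambda>_. {0..<int m})"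
    proof
      show "(\<lambda>q. restrict q (- R)) ` block_residues m P \<subseteq> PiE (- R) (\<lambda>_. {0..<int m})"
        by (auto simp: block_residues_def)
      show "PiE (- R) (\<lambda>_. {0..<int m}) \<subseteq> (\<lambda>q. restrict q (- R)) ` block_residues m P"
      proof
        fix g assume g: "g \<in> PiE (- R) (\<lambda>_. {0..<int m})"
        \<comment> \<open>At a representative the remaining entry is forced: it is the residue that
          cancels the sum of the other entries of its block \<open>b x\<close>.\<close>
        define q where "q x = (if x \<in> R then (- (\<Sum>y\<in>b x - {x}. g y)) mod int m else g x)" for x
        have "q x \<in> {0..<int m}" for x using g m by (auto simp: q_def PiE_iff)
        moreover have "int m dvd (\<Sum>x\<in>C. q x)" if C: "C \<in> P" for C
        proof -
          have "(\<Sum>x\<in>C - {r C}. q x) = (\<Sum>x\<in>C - {r C}. g x)"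
            using R_iff[OF C] by (intro sum.cong) (auto simp: q_def)
          moreover have "q (r C) = (- (\<Sum>y\<in>C - {r C}. g y)) mod int m"
            using b[OF C r[OF C]] C by (simp add: q_def R_def)
          ultimately have "(\<Sum>x\<in>C. q x) = (- (\<Sum>y\<in>C - {r C}. g y)) mod int m + (\<Sum>x\<in>C - {r C}. g x)"
            by (simp add: split[OF C])
          moreover have "((- (\<Sum>y\<in>C - {r C}. g y)) mod int m + (\<Sum>x\<in>C - {r C}. g x)) mod int m = 0"
            by (simp add: mod_add_left_eq)
          ultimately show ?thesis by (simp only: dvd_eq_mod_eq_0)
        qed
        ultimately have "q \<in> block_residues m P" by (simp add: block_residues_def)
        moreover have "g = restrict q (- R)"
        proof
          fix x show "g x = restrict q (- R) x" using PiE_arb[OF g, of x] by (auto simp: q_def)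
        qed
        ultimately show "g \<in> (\<lambda>q. restrict q (- R)) ` block_residues m P" by blast
      qed
    qed
  qed
  then have "card (block_residues m P) = card (PiE (- R) (\<lambda>_. {0..<int m}))"
    by (rule bij_betw_same_card)
  also have "\<dots> = m ^ card (- R)" by (simp add: card_PiE)
  also have "card (- R) = CARD('n) - card P"
    by (simp add: Compl_eq_Diff_UNIV card_Diff_subset R_def card_image[OF r_inj])
  finally show ?thesis .
qed

text \<open>The lattice is a disjoint union of \<open>m ^ (CARD('n) - card P)\<close> translates of
  the integer lattice scaled by \<open>m\<close>. Each contributes
  \<open>measure lborel K / m ^ CARD('n)\<close>, and the powers combine to
  \<open>m ^ card P\<close>.\<close>

lemma card_block_lattice_limit:
  fixes K :: "(real^'n::finite) set"
  assumes P: "partition_on UNIV P" and m: "0 < m"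
    and bK: "bounded K" and K: "K \<in> sets borel" and fr: "negligible (frontier K)"
  shows "(\<lambda>d. real (card {z \<in> block_lattice m P. (1 / real d) *\<^sub>R z \<in> K}) / real d ^ CARD('n))
    \<longlonglongrightarrow> measure lborel K / real m ^ card P"
proof -
  let ?Q = "block_residues m P"
  define v :: "('n \<Rightarrow> int) \<Rightarrow> real^'n" where "v q = (\<chi> x. of_int (q x))" for q
  define Z where "Z d q = {z. integral_vec z \<and> (1 / real d) *\<^sub>R (v q + real m *\<^sub>R z) \<in> K}" for d q
  have finQ: "finite ?Q"
  proof (rule finite_subset)
    show "?Q \<subseteq> {q. \<forall>x. (x \<in> UNIV \<longrightarrow> q x \<in> {0..<int m}) \<and> (x \<notin> UNIV \<longrightarrow> q x = 0)}"
      by (auto simp: block_residues_def)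
  qed (rule finite_set_of_finite_funs, auto)
  \<comment> \<open>Division with remainder by \<open>m\<close> in each coordinate. The block
    conditions depend only on residues, so they pass between a vector and its remainder.\<close>
  have decompose: "block_lattice m P = (\<Union>q\<in>?Q. (\<lambda>z. v q + real m *\<^sub>R z) ` {z. integral_vec z})" (is "_ = ?U")
  proof
    show "block_lattice m P \<subseteq> ?U"
    proof
      fix z :: "real^'n" assume z: "z \<in> block_lattice m P"
      define k where "k x = \<lfloor>z $ x\<rfloor>" for x
      have k: "z $ x = of_int (k x)" for x
        using z unfolding k_def block_lattice_def integral_vec_def by (simp add: of_int_floor_cancel)
      define q where "q x = k x mod int m" for x
      have "q \<in> ?Q"
        unfolding block_residues_def
      proof (intro CollectI conjI allI ballI)
        show "q x \<in> {0..<int m}" for x using m by (simp add: q_def)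
        fix C assume "C \<in> P"
        then obtain j :: int where "(\<Sum>x\<in>C. z $ x) = of_int j * real m"
          using z by (auto simp: block_lattice_def)
        then have "of_int (\<Sum>x\<in>C. k x) = (of_int (j * int m) :: real)" by (simp add: k)
        then have "(\<Sum>x\<in>C. k x) = j * int m" by (simp only: of_int_eq_iff)
        moreover have "(\<Sum>x\<in>C. q x) mod int m = (\<Sum>x\<in>C. k x) mod int m"
          unfolding q_def by (rule mod_sum_eq)
        ultimately show "int m dvd (\<Sum>x\<in>C. q x)" by (simp add: dvd_eq_mod_eq_0)
      qed
      moreover have "z = v q + real m *\<^sub>R (\<chi> x. of_int (k x div int m))"
      proof (rule vec_eq_iff[THEN iffD2], rule allI)
        fix x
        have "of_int (k x) = (of_int (k x mod int m + int m * (k x div int m)) :: real)" by simp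
        then show "z $ x = (v q + real m *\<^sub>R (\<chi> x. of_int (k x div int m))) $ x"
          unfolding of_int_add of_int_mult by (simp add: k v_def q_def)
      qed
      moreover have "integral_vec ((\<chi> x. of_int (k x div int m)) :: real^'n)" by (simp add: integral_vec_def)
      ultimately show "z \<in> ?U" by blast
    qed
    show "?U \<subseteq> block_lattice m P"
    proof
      fix y assume "y \<in> ?U"
      then obtain q z where q: "q \<in> ?Q" and z: "integral_vec z" and y: "y = v q + real m *\<^sub>R z" by blast
      have "integral_vec y" using z unfolding y integral_vec_def v_def by simp
      moreover have "\<exists>k::int. (\<Sum>x\<in>C. y $ x) = of_int k * real m" if C: "C \<in> P" for C
      proof -
        obtain j where j: "(\<Sum>x\<in>C. q x) = int m * j" 
        proof -
          have "int m dvd (\<Sum>x\<in>C. q x)" using q C by (simp add: block_residues_def)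
          then show ?thesis by (rule dvdE) (rule that)
        qed
        obtain i :: int where i: "(\<Sum>x\<in>C. z $ x) = of_int i"
        proof -
          have "(\<Sum>x\<in>C. z $ x) \<in> \<int>" using z by (intro Ints_sum) (simp add: integral_vec_def)
          then show ?thesis using that by (rule Ints_cases)
        qed
        have "(\<Sum>x\<in>C. y $ x) = of_int (\<Sum>x\<in>C. q x) + real m * (\<Sum>x\<in>C. z $ x)"
          by (simp add: y v_def sum.distrib sum_distrib_left)
        also have "\<dots> = of_int (j + i) * real m" unfolding j i by (simp add: algebra_simps)
        finally show ?thesis by blast
      qed
      ultimately show "y \<in> block_lattice m P" by (simp add: block_lattice_def)
    qed
  qed
  have inj: "inj (\<lambda>z. v q + real m *\<^sub>R z)" for q using m by (auto intro: injI)
  have disj: "p = q" if pq: "p \<in> ?Q" "q \<in> ?Q" and yz: "integral_vec y" "integral_vec z"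
    and eq: "v p + real m *\<^sub>R y = v q + real m *\<^sub>R z" for p q y z
  proof
    fix x
    obtain i j :: int where ij: "y $ x = of_int i" "z $ x = of_int j"
    proof -
      have "y $ x \<in> \<int>" "z $ x \<in> \<int>" using yz by (simp_all add: integral_vec_def)
      then show ?thesis by (elim Ints_cases) (rule that)
    qed
    have "(v p + real m *\<^sub>R y) $ x = (v q + real m *\<^sub>R z) $ x" using eq by simp
    then have "(of_int (p x + int m * i) :: real) = of_int (q x + int m * j)" by (simp add: v_def ij)
    then have "p x + int m * i = q x + int m * j" by (simp only: of_int_eq_iff)
    then have "(p x + int m * i) mod int m = (q x + int m * j) mod int m" by simp
    then show "p x = q x" using pq by (simp add: block_residues_def)
  qed
  have finZ: "finite (Z d q)" if "d > 0" for d q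
  proof (rule finite_subset)
    show "Z d q \<subseteq> {z \<in> (\<lambda>y. (real d / real m) *\<^sub>R y + - ((1 / real m) *\<^sub>R v q)) ` K. integral_vec z}"
    proof
      fix z assume z: "z \<in> Z d q"
      have "z = (real d / real m) *\<^sub>R ((1 / real d) *\<^sub>R (v q + real m *\<^sub>R z)) + - ((1 / real m) *\<^sub>R v q)"
        using that m by (simp add: algebra_simps)
      with z show "z \<in> {z \<in> (\<lambda>y. (real d / real m) *\<^sub>R y + - ((1 / real m) *\<^sub>R v q)) ` K. integral_vec z}"
        unfolding Z_def by blast
    qed
    have "bounded ((\<lambda>y. (real d / real m) *\<^sub>R y + - ((1 / real m) *\<^sub>R v q)) ` K)"
      using bounded_translation[OF bounded_scaling[OF bK], of "- ((1 / real m) *\<^sub>R v q)" "real d / real m"]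
      by (simp add: image_image add.commute)
    then show "finite {z \<in> (\<lambda>y. (real d / real m) *\<^sub>R y + - ((1 / real m) *\<^sub>R v q)) ` K. integral_vec z}"
      by (rule finite_bounded_integral_vecs)
  qed
  have count: "card {z \<in> block_lattice m P. (1 / real d) *\<^sub>R z \<in> K} = (\<Sum>q\<in>?Q. card (Z d q))" if "d > 0" for d
  proof -
    have "{z \<in> block_lattice m P. (1 / real d) *\<^sub>R z \<in> K} = (\<Union>q\<in>?Q. (\<lambda>z. v q + real m *\<^sub>R z) ` Z d q)"
      unfolding decompose Z_def by auto
    also have "card \<dots> = (\<Sum>q\<in>?Q. card ((\<lambda>z. v q + real m *\<^sub>R z) ` Z d q))"
    proof (intro card_UN_disjoint finQ ballI impI finite_imageI finZ that)
      fix p q assume pq: "p \<in> ?Q" "q \<in> ?Q" "p \<noteq> q"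
      show "(\<lambda>z. v p + real m *\<^sub>R z) ` Z d p \<inter> (\<lambda>z. v q + real m *\<^sub>R z) ` Z d q = {}"
      proof (rule equals0I)
        fix x assume "x \<in> (\<lambda>z. v p + real m *\<^sub>R z) ` Z d p \<inter> (\<lambda>z. v q + real m *\<^sub>R z) ` Z d q"
        then obtain y z where "integral_vec y" "integral_vec z" "v p + real m *\<^sub>R y = v q + real m *\<^sub>R z"
          unfolding Z_def by blast
        with disj[OF pq(1,2)] pq(3) show False by blast
      qed
    qed
    also have "\<dots> = (\<Sum>q\<in>?Q. card (Z d q))"
      by (intro sum.cong refl card_image inj_on_subset[OF inj]) simp
    finally show ?thesis .
  qed
  have "(\<lambda>d. \<Sum>q\<in>?Q. real (card (Z d q)) / real d ^ CARD('n)) \<longlonglongrightarrow> (\<Sum>q\<in>?Q. measure lborel K / real m ^ CARD('n))"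
    unfolding Z_def using m by (intro tendsto_sum lattice_point_count_limit bK K fr) simp
  also have "(\<Sum>q\<in>?Q. measure lborel K / real m ^ CARD('n)) = measure lborel K / real m ^ card P"
  proof -
    have "card P \<le> CARD('n)"
      using card_partition_on_le[OF _ P] by simp
    then have "real m ^ CARD('n) = real m ^ (CARD('n) - card P) * real m ^ card P"
      by (simp flip: power_add)
    then show ?thesis using m by (simp add: card_block_residues[OF P m])
  qed
  finally show ?thesis
    by (rule Lim_transform_eventually)
      (use eventually_gt_at_top[of 0] in eventually_elim, simp add: count sum_divide_distrib)
qed

lemma block_lattice_0: "0 \<in> block_lattice m P"
  by (auto simp: block_lattice_def integral_vec_def intro: exI[of _ 0])

lemma block_lattice_add:
  assumes "x \<in> block_lattice m P" "y \<in> block_lattice m P"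
  shows "x + y \<in> block_lattice m P"
  unfolding block_lattice_def
proof (intro CollectI conjI ballI)
  show "integral_vec (x + y)" using assms by (simp add: block_lattice_def integral_vec_def)
  fix C assume "C \<in> P"
  then obtain j k :: int where "(\<Sum>i\<in>C. x $ i) = of_int j * real m" "(\<Sum>i\<in>C. y $ i) = of_int k * real m"
    using assms unfolding block_lattice_def by blast
  then show "\<exists>k::int. (\<Sum>i\<in>C. (x + y) $ i) = of_int k * real m"
    by (intro exI[of _ "j + k"]) (simp add: sum.distrib distrib_right)
qed

lemma block_lattice_scale:
  assumes "x \<in> block_lattice m P"
  shows "of_int l *\<^sub>R x \<in> block_lattice m P"
  unfolding block_lattice_def
proof (intro CollectI conjI ballI)
  show "integral_vec (of_int l *\<^sub>R x)" using assms by (simp add: block_lattice_def integral_vec_def)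
  fix C assume "C \<in> P"
  then obtain k :: int where "(\<Sum>i\<in>C. x $ i) = of_int k * real m"
    using assms unfolding block_lattice_def by blast
  then show "\<exists>k::int. (\<Sum>i\<in>C. (of_int l *\<^sub>R x) $ i) = of_int k * real m"
    by (intro exI[of _ "l * k"]) (simp flip: sum_distrib_left)
qed

lemma block_lattice_diff:
  "x \<in> block_lattice m P \<Longrightarrow> y \<in> block_lattice m P \<Longrightarrow> x - y \<in> block_lattice m P"
  using block_lattice_add[OF _ block_lattice_scale[of y m P "-1"], of x] by simp

lemma block_lattice_combination:
  "(\<And>s. s \<in> S \<Longrightarrow> s \<in> block_lattice m P) \<Longrightarrow> (\<Sum>s\<in>S. of_int (f s) *\<^sub>R s) \<in> block_lattice m P"
  by (induction S rule: infinite_finite_induct)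
    (simp_all add: block_lattice_0 block_lattice_add block_lattice_scale)

section \<open>Volumes of cylinders and pyramids\<close>

lemma nn_integral_lborel_translation:
  fixes f :: "'a::euclidean_space \<Rightarrow> ennreal"
  assumes "f \<in> borel_measurable borel"
  shows "(\<integral>\<^sup>+x. f (x + c) \<partial>lborel) = (\<integral>\<^sup>+x. f x \<partial>lborel)"
proof -
  have "(\<integral>\<^sup>+x. f x \<partial>lborel) = (\<integral>\<^sup>+x. f x \<partial>distr lborel borel ((+) c))"
    by (simp add: lborel_distr_plus)
  also have "\<dots> = (\<integral>\<^sup>+x. f (c + x) \<partial>lborel)"
    by (rule nn_integral_distr) (use assms in simp_all)
  finally show ?thesis by (simp add: add.commute)
qed

text \<open>Cavalieri's principle in the direction of a unit vector \<open>u\<close>. The rotation of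
  \<open>\<real> \<times> 'a\<close> that exchanges the first coordinate with the coordinate along \<open>u\<close> is a product of
  three shears, each of which preserves the volume by translation invariance.\<close>

lemma emeasure_lborel_slices:
  fixes u :: "'a::euclidean_space"
  assumes M: "M \<in> sets borel" and u: "u \<bullet> u = 1"
  shows "emeasure lborel M =
    (\<integral>\<^sup>+r. emeasure lborel {x. 0 \<le> x \<bullet> u \<and> x \<bullet> u \<le> 1 \<and> x + (r - x \<bullet> u) *\<^sub>R u \<in> M} \<partial>lborel)"
proof -
  define G0 :: "real \<Rightarrow> 'a \<Rightarrow> ennreal" where "G0 r x = indicator {-1..0} r * indicator M x" for r x
  define G1 where "G1 r x = G0 r (x + r *\<^sub>R u)" for r x
  define G2 where "G2 r x = G1 (r + - (x \<bullet> u)) x" for r x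
  define G3 where "G3 r x = G2 r (x + r *\<^sub>R u)" for r x
  note [measurable] = M
  have m0[measurable]: "(\<lambda>(r, x). G0 r x) \<in> borel_measurable (borel \<Otimes>\<^sub>M borel)"
    unfolding G0_def by measurable
  have m1[measurable]: "(\<lambda>(r, x). G1 r x) \<in> borel_measurable (borel \<Otimes>\<^sub>M borel)"
    unfolding G1_def by measurable
  have m2[measurable]: "(\<lambda>(r, x). G2 r x) \<in> borel_measurable (borel \<Otimes>\<^sub>M borel)"
    unfolding G2_def by measurable
  \<comment> \<open>Exchanging the integrals puts the variable being sheared innermost, where the
    shear is a translation by a constant.\<close>
  have fub: "(\<integral>\<^sup>+r. \<integral>\<^sup>+x. G r x \<partial>lborel \<partial>lborel) = (\<integral>\<^sup>+x. \<integral>\<^sup>+r. G r x \<partial>lborel \<partial>lborel)"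
    if "(\<lambda>(r, x). G r x) \<in> borel_measurable (borel \<Otimes>\<^sub>M borel)" for G :: "real \<Rightarrow> 'a \<Rightarrow> ennreal"
    by (rule lborel_pair.Fubini'[symmetric]) (use that in \<open>simp add: measurable_cong_sets[OF sets_pair_measure_cong[OF sets_lborel sets_lborel] refl]\<close>)
  have "emeasure lborel M = (\<integral>\<^sup>+r. indicator {-1..0::real} r * emeasure lborel M \<partial>lborel)"
    by (simp add: nn_integral_multc)
  also have "\<dots> = (\<integral>\<^sup>+r. \<integral>\<^sup>+x. G0 r x \<partial>lborel \<partial>lborel)"
    unfolding G0_def by (simp add: nn_integral_cmult)
  also have "\<dots> = (\<integral>\<^sup>+r. \<integral>\<^sup>+x. G1 r x \<partial>lborel \<partial>lborel)"
    unfolding G1_def by (intro nn_integral_cong nn_integral_lborel_translation[symmetric]) measurable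
  also have "\<dots> = (\<integral>\<^sup>+x. \<integral>\<^sup>+r. G1 r x \<partial>lborel \<partial>lborel)" by (rule fub) (rule m1)
  also have "\<dots> = (\<integral>\<^sup>+x. \<integral>\<^sup>+r. G2 r x \<partial>lborel \<partial>lborel)"
    unfolding G2_def by (intro nn_integral_cong nn_integral_lborel_translation[symmetric]) measurable
  also have "\<dots> = (\<integral>\<^sup>+r. \<integral>\<^sup>+x. G2 r x \<partial>lborel \<partial>lborel)" by (rule fub[symmetric]) (rule m2)
  also have "\<dots> = (\<integral>\<^sup>+r. \<integral>\<^sup>+x. G3 r x \<partial>lborel \<partial>lborel)"
    unfolding G3_def by (intro nn_integral_cong nn_integral_lborel_translation[symmetric]) measurable
  also have "\<dots> = (\<integral>\<^sup>+r. emeasure lborel {x. 0 \<le> x \<bullet> u \<and> x \<bullet> u \<le> 1 \<and> x + (r - x \<bullet> u) *\<^sub>R u \<in> M} \<partial>lborel)"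
  proof (rule nn_integral_cong)
    fix r :: real
    have "{x. 0 \<le> x \<bullet> u \<and> x \<bullet> u \<le> 1 \<and> x + (r - x \<bullet> u) *\<^sub>R u \<in> M} \<in> sets borel" by measurable
    moreover have "G3 r x = indicator {x. 0 \<le> x \<bullet> u \<and> x \<bullet> u \<le> 1 \<and> x + (r - x \<bullet> u) *\<^sub>R u \<in> M} x" for x
    proof -
      have "r + - ((x + r *\<^sub>R u) \<bullet> u) = - (x \<bullet> u)" using u by (simp add: inner_add_left)
      moreover have "x + r *\<^sub>R u + (- (x \<bullet> u)) *\<^sub>R u = x + (r - x \<bullet> u) *\<^sub>R u" by (simp add: algebra_simps)
      ultimately show ?thesis
        unfolding G3_def G2_def G1_def G0_def by (simp only:) (auto simp: indicator_def)
    qed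
    ultimately show "(\<integral>\<^sup>+x. G3 r x \<partial>lborel)
        = emeasure lborel {x. 0 \<le> x \<bullet> u \<and> x \<bullet> u \<le> 1 \<and> x + (r - x \<bullet> u) *\<^sub>R u \<in> M}"
      by (simp add: nn_integral_indicator)
  qed
  finally show ?thesis .
qed

text \<open>The height is a parameter because rescaling a unit cylinder over a shrunken base back to
  the original base changes its height.\<close>

definition cylinder :: "'a::euclidean_space \<Rightarrow> 'a set \<Rightarrow> real \<Rightarrow> 'a set" where
  "cylinder u P \<tau> = {z + t *\<^sub>R u | z t. z \<in> P \<and> 0 \<le> t \<and> t \<le> \<tau>}"

lemma compact_cylinder: "compact P \<Longrightarrow> compact (cylinder u P \<tau>)"
proof -
  assume "compact P"
  then have "compact ((\<lambda>(z, t). z + t *\<^sub>R u) ` (P \<times> {0..\<tau>}))"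
    by (intro compact_continuous_image compact_Times)
      (auto intro!: continuous_intros simp: case_prod_unfold)
  moreover have "(\<lambda>(z, t). z + t *\<^sub>R u) ` (P \<times> {0..\<tau>}) = cylinder u P \<tau>"
    unfolding cylinder_def by fastforce
  ultimately show ?thesis by simp
qed

lemma emeasure_lborel_compact:
  fixes S :: "'a::euclidean_space set"
  assumes "compact S"
  shows "emeasure lborel S = ennreal (measure lborel S)"
  using emeasure_compact_finite[OF assms] by (simp add: emeasure_eq_ennreal_measure less_top)

lemma measure_lborel_affine_image:
  fixes S :: "'a::euclidean_space set"
  assumes "compact S"
  shows "measure lborel ((\<lambda>x. c *\<^sub>R x + d) ` S) = \<bar>c\<bar> ^ DIM('a) * measure lborel S"
proof -
  have "compact ((\<lambda>x. c *\<^sub>R x + d) ` S)"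
    using assms by (intro compact_continuous_image continuous_intros)
  then show ?thesis
    using measure_lebesgue_affine[of c d S] assms
    by (simp add: measure_completion borel_compact)
qed

text \<open>Identifies the integrand of \<open>emeasure_lborel_slices\<close> for a set at level
  \<open>h\<close>: a unit cylinder over that set, moved along \<open>u\<close> to start at level 0.
  Cross-sections are thus measured without a measure of lower dimension.\<close>

lemma slice_eq_translated_cylinder:
  fixes u :: "'a::euclidean_space"
  assumes u: "u \<bullet> u = 1" and P: "\<And>z. z \<in> P \<Longrightarrow> z \<bullet> u = h"
  shows "{x. 0 \<le> x \<bullet> u \<and> x \<bullet> u \<le> 1 \<and> x + (h - x \<bullet> u) *\<^sub>R u \<in> P}
    = (\<lambda>x. 1 *\<^sub>R x + - (h *\<^sub>R u)) ` cylinder u P 1" (is "?L = ?R")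
proof
  show "?L \<subseteq> ?R"
  proof
    fix x assume "x \<in> ?L"
    then have "(x + (h - x \<bullet> u) *\<^sub>R u) + (x \<bullet> u) *\<^sub>R u \<in> cylinder u P 1"
      unfolding cylinder_def by blast
    moreover have "x = 1 *\<^sub>R ((x + (h - x \<bullet> u) *\<^sub>R u) + (x \<bullet> u) *\<^sub>R u) + - (h *\<^sub>R u)"
      by (simp add: algebra_simps)
    ultimately show "x \<in> ?R" by (rule image_eqI[rotated])
  qed
  show "?R \<subseteq> ?L"
  proof
    fix x assume "x \<in> ?R"
    then obtain z t where zt: "z \<in> P" "0 \<le> t" "t \<le> 1" "x = z + t *\<^sub>R u - h *\<^sub>R u"
      by (auto simp: cylinder_def)
    then have xu: "x \<bullet> u = t" using P u by (simp add: inner_add_left inner_diff_left)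
    have zeq: "x + (h - t) *\<^sub>R u = z" unfolding zt(4) by (simp add: algebra_simps)
    show "x \<in> ?L" using zt(1-3) unfolding mem_Collect_eq xu zeq by simp
  qed
qed

text \<open>Every level between \<open>h\<close> and \<open>h + \<tau>\<close> cuts out a translate
  of \<open>P\<close>, so the slicing integral has a constant integrand on an interval of length
  \<open>\<tau>\<close>.\<close>

lemma measure_cylinder:
  fixes u :: "'a::euclidean_space"
  assumes u: "u \<bullet> u = 1" and P: "\<And>z. z \<in> P \<Longrightarrow> z \<bullet> u = h" and cP: "compact P" and "0 \<le> \<tau>"
  shows "measure lborel (cylinder u P \<tau>) = \<tau> * measure lborel (cylinder u P 1)"
proof -
  let ?V = "measure lborel (cylinder u P 1)"
  have slice: "emeasure lborel {x. 0 \<le> x \<bullet> u \<and> x \<bullet> u \<le> 1 \<and> x + (r - x \<bullet> u) *\<^sub>R u \<in> cylinder u P \<tau>}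
      = indicator {h..h + \<tau>} r * ennreal ?V" for r
  proof -
    have "x + (r - x \<bullet> u) *\<^sub>R u \<in> cylinder u P \<tau> \<longleftrightarrow> r \<in> {h..h + \<tau>} \<and> x + (h - x \<bullet> u) *\<^sub>R u \<in> P" for x
    proof
      assume "x + (r - x \<bullet> u) *\<^sub>R u \<in> cylinder u P \<tau>"
      then obtain z t where zt: "x + (r - x \<bullet> u) *\<^sub>R u = z + t *\<^sub>R u" "z \<in> P" "0 \<le> t" "t \<le> \<tau>"
        unfolding cylinder_def by blast
      have "(x + (r - x \<bullet> u) *\<^sub>R u) \<bullet> u = (z + t *\<^sub>R u) \<bullet> u" using zt(1) by simp
      then have r: "r = h + t" using P[OF zt(2)] u by (simp add: inner_add_left)
      then have "x + (h - x \<bullet> u) *\<^sub>R u = z" using zt(1) by (simp add: algebra_simps)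
      with r zt show "r \<in> {h..h + \<tau>} \<and> x + (h - x \<bullet> u) *\<^sub>R u \<in> P" by simp
    next
      assume *: "r \<in> {h..h + \<tau>} \<and> x + (h - x \<bullet> u) *\<^sub>R u \<in> P"
      have "x + (r - x \<bullet> u) *\<^sub>R u = (x + (h - x \<bullet> u) *\<^sub>R u) + (r - h) *\<^sub>R u" by (simp add: algebra_simps)
      with * show "x + (r - x \<bullet> u) *\<^sub>R u \<in> cylinder u P \<tau>"
        unfolding cylinder_def by (intro CollectI exI[of _ "x + (h - x \<bullet> u) *\<^sub>R u"] exI[of _ "r - h"]) simp
    qed
    then have eq: "{x. 0 \<le> x \<bullet> u \<and> x \<bullet> u \<le> 1 \<and> x + (r - x \<bullet> u) *\<^sub>R u \<in> cylinder u P \<tau>}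
      = (if r \<in> {h..h + \<tau>} then (\<lambda>x. 1 *\<^sub>R x + - (h *\<^sub>R u)) ` cylinder u P 1 else {})"
      by (simp only: slice_eq_translated_cylinder[OF u P, symmetric] split: if_split) auto
    have "compact ((\<lambda>x. 1 *\<^sub>R x + - (h *\<^sub>R u)) ` cylinder u P 1)"
      by (intro compact_continuous_image continuous_intros compact_cylinder cP)
    then show ?thesis
      unfolding eq using measure_lborel_affine_image[OF compact_cylinder[OF cP], of 1 "- (h *\<^sub>R u)" u 1]
      by (simp add: emeasure_lborel_compact)
  qed
  have "emeasure lborel (cylinder u P \<tau>) = (\<integral>\<^sup>+r. indicator {h..h + \<tau>} r * ennreal ?V \<partial>lborel)"
    by (subst emeasure_lborel_slices[OF borel_compact[OF compact_cylinder[OF cP]] u]) (simp only: slice)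
  also have "\<dots> = ennreal (\<tau> * ?V)" using \<open>0 \<le> \<tau>\<close> by (simp add: nn_integral_multc ennreal_mult)
  finally show ?thesis
    using \<open>0 \<le> \<tau>\<close> by (simp add: emeasure_lborel_compact compact_cylinder cP)
qed

text \<open>At level \<open>r\<close> the pyramid has the cross-section \<open>P\<close> scaled by
  \<open>r / h\<close>. The integrand is therefore \<open>(r / h) ^ (DIM('a) - 1)\<close> times the
  unit cylinder volume, which integrates to the factor \<open>h / DIM('a)\<close>.\<close>

lemma measure_pyramid:
  fixes u :: "'a::euclidean_space"
  assumes u: "u \<bullet> u = 1" and P: "\<And>z. z \<in> P \<Longrightarrow> z \<bullet> u = h" and cP: "compact P" and "0 < h"
  shows "measure lborel {s *\<^sub>R z | s z. z \<in> P \<and> 0 \<le> s \<and> s \<le> 1}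
    = h / DIM('a) * measure lborel (cylinder u P 1)"
proof -
  let ?V = "measure lborel (cylinder u P 1)" and ?n = "DIM('a)"
  define K where "K = {s *\<^sub>R z | s z. z \<in> P \<and> 0 \<le> s \<and> s \<le> 1}"
  have "compact ((\<lambda>(s, z). s *\<^sub>R z) ` ({0..1::real} \<times> P))"
    by (intro compact_continuous_image compact_Times cP)
      (auto intro!: continuous_intros simp: case_prod_unfold)
  moreover have "(\<lambda>(s, z). s *\<^sub>R z) ` ({0..1::real} \<times> P) = K" unfolding K_def by fastforce
  ultimately have cK: "compact K" by simp
  have slice: "emeasure lborel {x. 0 \<le> x \<bullet> u \<and> x \<bullet> u \<le> 1 \<and> x + (r - x \<bullet> u) *\<^sub>R u \<in> K}
      = ennreal ((r / h) ^ (?n - 1) * ?V) * indicator {0..h} r" if "r \<noteq> 0" for r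
  proof (cases "r \<in> {0..h}")
    case True
    then have r: "0 < r" "r \<le> h" using that by auto
    define c where "c = r / h"
    have c: "0 < c" "c \<le> 1" "r = c * h" using r \<open>0 < h\<close> by (auto simp: c_def)
    define Q where "Q = (*\<^sub>R) c ` P"
    have Q: "z \<bullet> u = r" if "z \<in> Q" for z using that P c by (auto simp: Q_def)
    have K_iff: "y \<in> K \<longleftrightarrow> y \<in> Q" if y: "y \<bullet> u = r" for y
    proof
      assume "y \<in> K"
      then obtain s z where sz: "y = s *\<^sub>R z" "z \<in> P" by (auto simp: K_def)
      then have "s * h = c * h" using y P[OF sz(2)] c(3) by simp
      then have "s = c" using \<open>0 < h\<close> by simp
      with sz show "y \<in> Q" unfolding Q_def by blast
    next
      assume "y \<in> Q"
      then show "y \<in> K" using c unfolding Q_def K_def by (auto intro: less_imp_le)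
    qed
    have "(x + (r - x \<bullet> u) *\<^sub>R u) \<bullet> u = r" for x using u by (simp add: inner_add_left)
    then have eq: "{x. 0 \<le> x \<bullet> u \<and> x \<bullet> u \<le> 1 \<and> x + (r - x \<bullet> u) *\<^sub>R u \<in> K}
        = (\<lambda>x. 1 *\<^sub>R x + - (r *\<^sub>R u)) ` cylinder u Q 1"
      using slice_eq_translated_cylinder[OF u Q] by (simp add: K_iff)
    \<comment> \<open>Scaling by \<open>c\<close> also scales the height, so a cylinder of height
      \<open>1 / c\<close> over \<open>P\<close> is needed. This costs one of the
      \<open>DIM('a)\<close> powers of \<open>c\<close>.\<close>
    have scaled: "cylinder u Q 1 = (\<lambda>x. c *\<^sub>R x + 0) ` cylinder u P (1 / c)"
    proof
      show "cylinder u Q 1 \<subseteq> (\<lambda>x. c *\<^sub>R x + 0) ` cylinder u P (1 / c)"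
      proof
        fix x assume "x \<in> cylinder u Q 1"
        then obtain z t where "z \<in> P" "0 \<le> t" "t \<le> 1" "x = c *\<^sub>R z + t *\<^sub>R u"
          unfolding cylinder_def Q_def by blast
        moreover from this have "x = c *\<^sub>R (z + (t / c) *\<^sub>R u) + 0" using c by (simp add: algebra_simps)
        moreover have "z + (t / c) *\<^sub>R u \<in> cylinder u P (1 / c)"
          using calculation c unfolding cylinder_def
          by (intro CollectI exI[of _ z] exI[of _ "t / c"]) (simp add: divide_right_mono)
        ultimately show "x \<in> (\<lambda>x. c *\<^sub>R x + 0) ` cylinder u P (1 / c)" by blast
      qed
      show "(\<lambda>x. c *\<^sub>R x + 0) ` cylinder u P (1 / c) \<subseteq> cylinder u Q 1"
      proof
        fix x assume "x \<in> (\<lambda>x. c *\<^sub>R x + 0) ` cylinder u P (1 / c)"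
        then obtain z t where "z \<in> P" "0 \<le> t" "t \<le> 1 / c" "x = c *\<^sub>R z + (c * t) *\<^sub>R u"
          unfolding cylinder_def by (auto simp: algebra_simps)
        then show "x \<in> cylinder u Q 1"
          using c unfolding cylinder_def Q_def
          by (intro CollectI exI[of _ "c *\<^sub>R z"] exI[of _ "c * t"]) (simp add: field_simps)
      qed
    qed
    have cQ: "compact (cylinder u Q 1)"
      unfolding Q_def by (intro compact_cylinder compact_scaling cP)
    have "measure lborel ((\<lambda>x. 1 *\<^sub>R x + - (r *\<^sub>R u)) ` cylinder u Q 1) = measure lborel (cylinder u Q 1)"
      using measure_lborel_affine_image[OF cQ, of 1 "- (r *\<^sub>R u)"] by simp
    also have "\<dots> = c ^ ?n * (1 / c * ?V)"
      unfolding scaled measure_lborel_affine_image[OF compact_cylinder[OF cP]]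
      using c by (subst measure_cylinder[OF u P cP]) auto
    also have "\<dots> = c ^ (?n - 1) * ?V"
      using c DIM_positive[where 'a = 'a] by (cases ?n) auto
    finally have "measure lborel ((\<lambda>x. 1 *\<^sub>R x + - (r *\<^sub>R u)) ` cylinder u Q 1) = c ^ (?n - 1) * ?V" .
    moreover have "compact ((\<lambda>x. 1 *\<^sub>R x + - (r *\<^sub>R u)) ` cylinder u Q 1)"
      by (intro compact_continuous_image continuous_intros cQ)
    ultimately show ?thesis
      using True unfolding eq c_def by (simp add: emeasure_lborel_compact)
  next
    case False
    have "x + (r - x \<bullet> u) *\<^sub>R u \<notin> K" for x
    proof
      assume "x + (r - x \<bullet> u) *\<^sub>R u \<in> K"
      then obtain s z where sz: "x + (r - x \<bullet> u) *\<^sub>R u = s *\<^sub>R z" "z \<in> P" "0 \<le> s" "s \<le> 1"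
        unfolding K_def by blast
      have "(x + (r - x \<bullet> u) *\<^sub>R u) \<bullet> u = (s *\<^sub>R z) \<bullet> u" using sz(1) by simp
      then have "r = s * h" using P[OF sz(2)] u by (simp add: inner_add_left)
      with False sz \<open>0 < h\<close> show False by (simp add: mult_left_le_one_le)
    qed
    with False show ?thesis by simp
  qed
  \<comment> \<open>At level 0 the scaling factor degenerates to 0; a single level does not affect
    the integral.\<close>
  have AE0: "AE r in lborel. r \<noteq> (0::real)" by (rule AE_lborel_singleton)
  have "emeasure lborel K = (\<integral>\<^sup>+r. ennreal ((r / h) ^ (?n - 1) * ?V) * indicator {0..h} r \<partial>lborel)"
    by (subst emeasure_lborel_slices[OF borel_compact[OF cK] u], rule nn_integral_cong_AE)
      (use AE0 in eventually_elim, rule slice)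
  also have "\<dots> = ennreal (h / ?n * (h / h) ^ ?n * ?V - h / ?n * (0 / h) ^ ?n * ?V)"
  proof (rule nn_integral_FTC_Icc[where F = "\<lambda>r. h / ?n * (r / h) ^ ?n * ?V"])
    fix r :: real
    have "((\<lambda>r. (r / h) ^ ?n) has_real_derivative real ?n * (1 / h * (r / h) ^ (?n - Suc 0))) (at r)"
      by (rule DERIV_power[OF DERIV_cdivide[OF DERIV_ident]])
    from DERIV_cmult_right[OF DERIV_cmult[OF this, of "h / ?n"], of ?V]
    show "((\<lambda>r. h / ?n * (r / h) ^ ?n * ?V) has_real_derivative (r / h) ^ (?n - 1) * ?V) (at r)"
      using \<open>0 < h\<close> by simp
  qed (use \<open>0 < h\<close> in auto)
  also have "\<dots> = ennreal (h / ?n * ?V)" using \<open>0 < h\<close> by (simp add: zero_power)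
  finally show ?thesis
    unfolding K_def[symmetric] using \<open>0 < h\<close> by (simp add: emeasure_lborel_compact cK)
qed


section \<open>From the pyramid to the normalized volume\<close>

lemma unit_normal_inner: "z \<bullet> unit_normal = (\<Sum>i\<in>UNIV. z $ i) / sqrt (real CARD('n))"
  for z :: "real^'n::finite"
  by (simp add: unit_normal_def inner_vec_def sum_divide_distrib)

lemma unit_normal_inner_self: "unit_normal \<bullet> (unit_normal :: real^'n::finite) = 1"
proof -
  have "(\<Sum>i\<in>UNIV. (unit_normal :: real^'n) $ i) = real CARD('n) / sqrt (real CARD('n))"
    by (simp add: unit_normal_def)
  then show ?thesis by (simp add: unit_normal_inner)
qed

lemma hyperplane_volume_cylinder:
  fixes S :: "(real^'n::finite) set"
  assumes "compact S"
  shows "hyperplane_volume S = measure lborel (cylinder unit_normal S 1)"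
  unfolding hyperplane_volume_def
  using compact_cylinder[OF assms, of unit_normal 1]
  by (simp add: cylinder_def measure_completion borel_compact)

text \<open>The hull is the pyramid with apex 0 over \<open>convex hull S\<close>, whose hyperplane
  has distance \<open>a / sqrt (CARD('n))\<close> from the origin.\<close>

lemma measure_convex_hull_insert_0:
  fixes S :: "(real^'n::finite) set"
  assumes "finite S" "S \<noteq> {}" and a: "\<And>z. z \<in> S \<Longrightarrow> (\<Sum>i\<in>UNIV. z $ i) = a" "0 < a"
  shows "measure lborel (convex hull (insert 0 S))
    = a / sqrt (real CARD('n)) / real CARD('n) * hyperplane_volume (convex hull S)"
proof -
  let ?h = "a / sqrt (real CARD('n))"
  have "convex hull (insert 0 S) = {s *\<^sub>R z | s z. z \<in> convex hull S \<and> 0 \<le> s \<and> s \<le> 1}" (is "_ = ?K")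
  proof
    show "convex hull (insert 0 S) \<subseteq> ?K"
      unfolding convex_hull_insert[OF \<open>S \<noteq> {}\<close>] by force
    show "?K \<subseteq> convex hull (insert 0 S)"
    proof
      fix x assume "x \<in> ?K"
      then obtain s z where sz: "x = s *\<^sub>R z" "z \<in> convex hull S" "0 \<le> s" "s \<le> 1" by blast
      then have "z \<in> convex hull (insert 0 S)" using hull_mono[of S "insert 0 S" convex] by blast
      moreover have "0 \<in> convex hull (insert 0 S)" by (rule hull_inc) simp
      ultimately have "(1 - s) *\<^sub>R 0 + s *\<^sub>R z \<in> convex hull (insert 0 S)"
        using sz by (intro convexD convex_convex_hull) auto
      then show "x \<in> convex hull (insert 0 S)" using sz by simp
    qed
  qed
  moreover have "z \<bullet> unit_normal = ?h" if "z \<in> convex hull S" for z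
  proof -
    have "convex hull S \<subseteq> {z. unit_normal \<bullet> z = ?h}"
    proof (rule hull_minimal)
      show "S \<subseteq> {z. unit_normal \<bullet> z = ?h}"
        by (auto simp: a unit_normal_inner inner_commute[of unit_normal])
    qed (rule convex_hyperplane)
    then show ?thesis using that by (auto simp: inner_commute)
  qed
  moreover have "compact (convex hull S)" by (rule finite_imp_compact_convex_hull) fact
  moreover have "0 < ?h" using a(2) by simp
  ultimately show ?thesis
    using measure_pyramid[OF unit_normal_inner_self, of "convex hull S" ?h]
    by (simp add: hyperplane_volume_cylinder)
qed

text \<open>The pyramid over the standard simplex is the corner simplex of volume
  \<open>1 / fact CARD('n)\<close>. Applying the pyramid formula to it with \<open>a = 1\<close>
  evaluates the normalizing denominator, and the factors involving \<open>sqrt\<close> cancel in the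
  quotient.\<close>

lemma normalized_volume_eq_measure:
  fixes S :: "(real^'n::finite) set"
  assumes "finite S" "S \<noteq> {}" and a: "\<And>z. z \<in> S \<Longrightarrow> (\<Sum>i\<in>UNIV. z $ i) = a" "0 < a"
  shows "normalized_volume (convex hull S) = fact CARD('n) / a * measure lborel (convex hull (insert 0 S))"
proof -
  let ?n = "real CARD('n)"
  have Basis: "range (\<lambda>i::'n. axis i (1::real)) = Basis" by (auto simp: Basis_vec_def)
  have "1 / fact CARD('n) = measure lborel (convex hull (insert 0 (range (\<lambda>i::'n. axis i (1::real)))))"
    unfolding Basis by (simp add: content_std_simplex)
  also have "\<dots> = 1 / sqrt ?n / ?n * hyperplane_volume (convex hull range (\<lambda>i::'n. axis i (1::real)))"
    by (rule measure_convex_hull_insert_0) (auto simp: sum_coord_axis)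
  finally have "hyperplane_volume (convex hull range (\<lambda>i::'n. axis i (1::real))) = sqrt ?n * ?n / fact CARD('n)"
    by (simp add: field_simps)
  moreover have "hyperplane_volume (convex hull S) = sqrt ?n * ?n / a * measure lborel (convex hull (insert 0 S))"
    using measure_convex_hull_insert_0[OF assms] a(2) by simp
  ultimately show ?thesis unfolding normalized_volume_def by simp
qed

section \<open>Sums of vectors from a finite set\<close>

text \<open>At most \<open>d\<close> summands are allowed, rather than exactly \<open>d\<close>, to
  match the cumulative Hilbert-Samuel function.\<close>

definition bounded_sums :: "('a::real_vector) set \<Rightarrow> nat \<Rightarrow> 'a set" where
  "bounded_sums S d = {\<Sum>s\<in>S. real (f s) *\<^sub>R s | f. sum f S \<le> d}"

definition coord_sum :: "real^'n::finite \<Rightarrow> real" where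
  "coord_sum z = (\<Sum>i\<in>UNIV. z $ i)"

lemma coord_sum_sum [simp]: "coord_sum (\<Sum>s\<in>S. f s) = (\<Sum>s\<in>S. coord_sum (f s))"
  unfolding coord_sum_def by (simp add: sum.swap[of _ S])

lemma coord_sum_simps [simp]:
  "coord_sum (x + y) = coord_sum x + coord_sum y"
  "coord_sum (x - y) = coord_sum x - coord_sum y"
  "coord_sum (c *\<^sub>R x) = c * coord_sum x"
  "coord_sum 0 = 0"
  by (simp_all add: coord_sum_def sum.distrib sum_subtractf sum_distrib_left)

text \<open>When \<open>m\<close> is nonzero, the sum of the coefficients is thus determined by the
  vector alone, although its representation over \<open>S\<close> need not be unique.\<close>

lemma coord_sum_combination:
  assumes "\<And>s. s \<in> S \<Longrightarrow> coord_sum s = m"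
  shows "coord_sum (\<Sum>s\<in>S. c s *\<^sub>R s) = sum c S * m"
  using assms by (simp add: sum_distrib_right)

text \<open>The coefficient of the origin absorbs the slack \<open>1 - sum l S\<close>.\<close>

lemma convex_hull_insert_0_finite:
  assumes "finite S" "0 \<notin> S"
  shows "convex hull (insert 0 S) = {\<Sum>s\<in>S. l s *\<^sub>R s | l. (\<forall>s\<in>S. 0 \<le> l s) \<and> sum l S \<le> 1}"
    (is "_ = ?R")
proof
  show "convex hull (insert 0 S) \<subseteq> ?R"
    unfolding convex_hull_finite[OF finite.insertI[OF assms(1)]] using assms by fastforce
  show "?R \<subseteq> convex hull (insert 0 S)"
  proof
    fix x assume "x \<in> ?R"
    then obtain l where l: "\<forall>s\<in>S. 0 \<le> l s" "sum l S \<le> 1" "x = (\<Sum>s\<in>S. l s *\<^sub>R s)" by blast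
    let ?u = "l(0 := 1 - sum l S)"
    have "sum ?u S = sum l S" "(\<Sum>s\<in>S. ?u s *\<^sub>R s) = (\<Sum>s\<in>S. l s *\<^sub>R s)"
      using assms(2) by (intro sum.cong; auto)+
    then show "x \<in> convex hull (insert 0 S)"
      unfolding convex_hull_finite[OF finite.insertI[OF assms(1)]]
      using l assms by (intro CollectI exI[of _ ?u]) auto
  qed
qed

lemma dilated_convex_hull_insert_0:
  assumes "finite S" "0 \<notin> S" "0 < r"
  shows "(1 / r) *\<^sub>R z \<in> convex hull (insert 0 S) \<longleftrightarrow>
    (\<exists>l. (\<forall>s\<in>S. 0 \<le> l s) \<and> sum l S \<le> r \<and> z = (\<Sum>s\<in>S. l s *\<^sub>R s))"
proof
  assume "(1 / r) *\<^sub>R z \<in> convex hull (insert 0 S)"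
  then obtain l where l: "\<forall>s\<in>S. 0 \<le> l s" "sum l S \<le> 1" "(1 / r) *\<^sub>R z = (\<Sum>s\<in>S. l s *\<^sub>R s)"
    unfolding convex_hull_insert_0_finite[OF assms(1,2)] by blast
  have "z = r *\<^sub>R ((1 / r) *\<^sub>R z)" using \<open>0 < r\<close> by simp
  also have "\<dots> = (\<Sum>s\<in>S. (r * l s) *\<^sub>R s)" unfolding l(3) by (simp add: scaleR_sum_right)
  finally have "z = (\<Sum>s\<in>S. (r * l s) *\<^sub>R s)" .
  moreover have "(\<Sum>s\<in>S. r * l s) \<le> r"
    using l(2) \<open>0 < r\<close> by (simp flip: sum_distrib_left)
  ultimately show "\<exists>l. (\<forall>s\<in>S. 0 \<le> l s) \<and> sum l S \<le> r \<and> z = (\<Sum>s\<in>S. l s *\<^sub>R s)"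
    using l(1) \<open>0 < r\<close> by (intro exI[of _ "\<lambda>s. r * l s"]) simp
next
  assume "\<exists>l. (\<forall>s\<in>S. 0 \<le> l s) \<and> sum l S \<le> r \<and> z = (\<Sum>s\<in>S. l s *\<^sub>R s)"
  then obtain l where l: "\<forall>s\<in>S. 0 \<le> l s" "sum l S \<le> r" "z = (\<Sum>s\<in>S. l s *\<^sub>R s)" by blast
  have "(1 / r) *\<^sub>R z = (\<Sum>s\<in>S. (l s / r) *\<^sub>R s)" unfolding l(3) by (simp add: scaleR_sum_right)
  moreover have "(\<Sum>s\<in>S. l s / r) \<le> 1" using l(2) \<open>0 < r\<close> by (simp flip: sum_divide_distrib)
  ultimately show "(1 / r) *\<^sub>R z \<in> convex hull (insert 0 S)"
    unfolding convex_hull_insert_0_finite[OF assms(1,2)]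
    using l(1) \<open>0 < r\<close> by (intro CollectI exI[of _ "\<lambda>s. l s / r"]) simp
qed

lemma bounded_sums_subset_dilate:
  assumes "finite S" "0 \<notin> S" "0 < d" "z \<in> bounded_sums S d"
  shows "(1 / real d) *\<^sub>R z \<in> convex hull (insert 0 S)"
proof -
  obtain f where f: "sum f S \<le> d" "z = (\<Sum>s\<in>S. real (f s) *\<^sub>R s)"
    using assms(4) by (auto simp: bounded_sums_def)
  moreover have "(\<Sum>s\<in>S. real (f s)) \<le> real d" using f(1) by (simp flip: of_nat_sum)
  ultimately show ?thesis
    unfolding dilated_convex_hull_insert_0[OF assms(1,2) \<open>0 < d\<close>[THEN of_nat_0_less_iff[THEN iffD2]]]
    by (intro exI[of _ "\<lambda>s. real (f s)"]) simp
qed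

text \<open>Rounding down the coefficients of a point of the cone leaves one of finitely many remainders,
  each of which becomes a nonnegative combination of \<open>S\<close> after adding a fixed multiple of
  \<open>\<Sum>S\<close>.\<close>

lemma translated_dilate_subset_bounded_sums:
  fixes S L :: "(real^'n::finite) set" and m :: real
  assumes fin: "finite S" and m: "0 < m" "\<And>s. s \<in> S \<Longrightarrow> coord_sum s = m"
    and L_int: "\<And>z. z \<in> L \<Longrightarrow> integral_vec z"
    and L_diff: "\<And>z f. z \<in> L \<Longrightarrow> z - (\<Sum>s\<in>S. of_int (f s) *\<^sub>R s) \<in> L"
    and L_gen: "\<And>z. z \<in> L \<Longrightarrow> \<exists>f. z = (\<Sum>s\<in>S. of_int (f s) *\<^sub>R s)"
  shows "\<exists>w e. \<forall>d>e. (+) w ` {z \<in> L. (1 / real (d - e)) *\<^sub>R z \<in> convex hull (insert 0 S)} \<subseteq> bounded_sums S d"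
proof -
  have S0: "0 \<notin> S" using m by fastforce
  \<comment> \<open>Contains every remainder with fractional coefficients that lies in
    \<open>L\<close>: such coefficients are below 1, so the norm is at most the sum of the norms of
    \<open>S\<close>.\<close>
  define B where "B = {z. norm z \<le> (\<Sum>s\<in>S. norm s)} \<inter> L"
  have finB: "finite B"
  proof (rule finite_subset)
    show "B \<subseteq> {z \<in> cball 0 (\<Sum>s\<in>S. norm s). integral_vec z}" using L_int by (auto simp: B_def)
  qed (rule finite_bounded_integral_vecs, simp)
  obtain c :: "real^'n \<Rightarrow> real^'n \<Rightarrow> int" where c: "\<And>z. z \<in> B \<Longrightarrow> z = (\<Sum>s\<in>S. of_int (c z s) *\<^sub>R s)"
    using L_gen unfolding B_def by (metis IntD2)
  \<comment> \<open>A crude bound exceeding every negative coefficient in the chosen integer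
    representations of the remainders. Adding \<open>N\<close> to each coefficient makes them all
    nonnegative.\<close>
  define N where "N = (\<Sum>z\<in>B. \<Sum>s\<in>S. nat \<bar>c z s\<bar>)"
  have N: "- c z s \<le> int N" if "z \<in> B" "s \<in> S" for z s
  proof -
    have "nat \<bar>c z s\<bar> \<le> (\<Sum>s\<in>S. nat \<bar>c z s\<bar>)"
      using member_le_sum[OF that(2) _ fin, of "\<lambda>s. nat \<bar>c z s\<bar>"] by simp
    also have "\<dots> \<le> N" unfolding N_def
      using member_le_sum[OF that(1) _ finB, of "\<lambda>z. \<Sum>s\<in>S. nat \<bar>c z s\<bar>"] by simp
    finally show ?thesis by linarith
  qed
  define w where "w = (\<Sum>s\<in>S. real N *\<^sub>R s)"
  have "w + z \<in> bounded_sums S d"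
    if d: "d > N * card S" and z: "z \<in> L" and K: "(1 / real (d - N * card S)) *\<^sub>R z \<in> convex hull (insert 0 S)" for d z
  proof -
    have pos: "0 < real (d - N * card S)" using d by (simp only: of_nat_0_less_iff zero_less_diff)
    obtain l where l: "\<forall>s\<in>S. 0 \<le> l s" "sum l S \<le> real (d - N * card S)" "z = (\<Sum>s\<in>S. l s *\<^sub>R s)"
      using K unfolding dilated_convex_hull_insert_0[OF fin S0 pos] by blast
    define r where "r = z - (\<Sum>s\<in>S. of_int \<lfloor>l s\<rfloor> *\<^sub>R s)"
    have "r = (\<Sum>s\<in>S. frac (l s) *\<^sub>R s)"
      unfolding r_def l(3) by (simp add: frac_def scaleR_left_diff_distrib sum_subtractf)
    then have "norm r \<le> (\<Sum>s\<in>S. norm s)"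
      by (auto intro!: sum_norm_le simp: frac_ge_0 mult_left_le_one_le frac_lt_1 less_imp_le)
    then have rB: "r \<in> B" using L_diff[OF z] by (simp add: B_def r_def)
    define k where "k s = nat (int N + \<lfloor>l s\<rfloor> + c r s)" for s
    have k: "real (k s) = real N + of_int \<lfloor>l s\<rfloor> + of_int (c r s)" if "s \<in> S" for s
    proof -
      have "0 \<le> \<lfloor>l s\<rfloor>" using l(1) that by simp
      then have "0 \<le> int N + \<lfloor>l s\<rfloor> + c r s" using N[OF rB that] by linarith
      then have "real (k s) = of_int (int N + \<lfloor>l s\<rfloor> + c r s)" unfolding k_def by (rule of_nat_nat)
      then show ?thesis by simp
    qed
    have "w + z = w + (\<Sum>s\<in>S. of_int \<lfloor>l s\<rfloor> *\<^sub>R s) + r" by (simp add: r_def)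
    also have "\<dots> = (\<Sum>s\<in>S. real (k s) *\<^sub>R s)"
      by (subst c[OF rB]) (simp add: w_def k scaleR_left_distrib flip: sum.distrib)
    finally have wz: "w + z = (\<Sum>s\<in>S. real (k s) *\<^sub>R s)" .
    \<comment> \<open>Comparing coordinate sums bounds the number of summands without tracking the
      rounding. The total is \<open>N * card S + sum l S\<close>, which explains the loss
      \<open>N * card S\<close> in the dilation factor.\<close>
    have "coord_sum (w + z) = (real N * real (card S) + sum l S) * m"
      unfolding w_def l(3) using coord_sum_combination[OF m(2)]
      by (simp add: distrib_right del: coord_sum_sum)
    moreover have "coord_sum (w + z) = (\<Sum>s\<in>S. real (k s)) * m"
      unfolding wz by (rule coord_sum_combination[OF m(2)])
    ultimately have "(\<Sum>s\<in>S. real (k s)) = real N * real (card S) + sum l S" using m(1) by simp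
    then have "real (sum k S) \<le> real d" using l(2) d by (simp add: of_nat_diff)
    then have "sum k S \<le> d" by (simp only: of_nat_le_iff)
    with wz show ?thesis unfolding bounded_sums_def by blast
  qed
  then show ?thesis by (intro exI[of _ w] exI[of _ "N * card S"]) blast
qed

text \<open>The set of sums lies in the \<open>d\<close>-fold dilate and contains a translate of the
  lattice points of the \<open>(d - e)\<close>-fold one. Both bounds have the same limit because
  \<open>(d - e) / d\<close> tends to 1.\<close>

lemma card_bounded_sums_limit:
  fixes S L :: "(real^'n::finite) set" and m :: real
  assumes fin: "finite S" and m: "0 < m" "\<And>s. s \<in> S \<Longrightarrow> coord_sum s = m"
    and L_int: "\<And>z. z \<in> L \<Longrightarrow> integral_vec z"
    and L_diff: "\<And>z f. z \<in> L \<Longrightarrow> z - (\<Sum>s\<in>S. of_int (f s) *\<^sub>R s) \<in> L"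
    and L_gen: "\<And>z. z \<in> L \<Longrightarrow> \<exists>f. z = (\<Sum>s\<in>S. of_int (f s) *\<^sub>R s)"
    and L0: "0 \<in> L"
    and lim: "(\<lambda>d. real (card {z \<in> L. (1 / real d) *\<^sub>R z \<in> convex hull (insert 0 S)}) / real d ^ k) \<longlonglongrightarrow> v"
  shows "(\<lambda>d. real (card (bounded_sums S d)) / real d ^ k) \<longlonglongrightarrow> v"
proof -
  let ?K = "convex hull (insert 0 S)"
  define LK where "LK d = {z \<in> L. (1 / real d) *\<^sub>R z \<in> ?K}" for d
  have S0: "0 \<notin> S" using m by fastforce
  have SL: "(\<Sum>s\<in>S. real (f s) *\<^sub>R s) \<in> L" for f
    using L_diff[OF L0, of "\<lambda>s. - int (f s)"] by (simp add: sum_negf)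
  have finLK: "finite (LK d)" if "d > 0" for d
  proof (rule finite_subset)
    show "LK d \<subseteq> {z \<in> (*\<^sub>R) (real d) ` ?K. integral_vec z}"
    proof
      fix z assume z: "z \<in> LK d"
      have "z = real d *\<^sub>R ((1 / real d) *\<^sub>R z)" using that by simp
      with z L_int show "z \<in> {z \<in> (*\<^sub>R) (real d) ` ?K. integral_vec z}" unfolding LK_def by blast
    qed
    show "finite {z \<in> (*\<^sub>R) (real d) ` ?K. integral_vec z}"
      by (intro finite_bounded_integral_vecs bounded_scaling compact_imp_bounded
          finite_imp_compact_convex_hull) (use fin in simp)
  qed
  have upper: "bounded_sums S d \<subseteq> LK d" if "d > 0" for d
    using bounded_sums_subset_dilate[OF fin S0 that] SL unfolding LK_def bounded_sums_def by blast
  obtain w e where we: "\<And>d. d > e \<Longrightarrow> (+) w ` LK (d - e) \<subseteq> bounded_sums S d"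
    using translated_dilate_subset_bounded_sums[OF fin m L_int L_diff L_gen] unfolding LK_def by blast
  have lower: "card (LK (d - e)) \<le> card (bounded_sums S d)" if "d > e" for d
  proof -
    have "card (LK (d - e)) = card ((+) w ` LK (d - e))" by (rule card_image[symmetric]) simp
    also have "\<dots> \<le> card (bounded_sums S d)"
      using that finite_subset[OF upper finLK] by (intro card_mono we) auto
    finally show ?thesis .
  qed
  have shift: "filterlim (\<lambda>d. d - e) sequentially sequentially"
    by (rule filterlim_minus_const_nat_at_top)
  have "(\<lambda>d. real (d - e) / real d) \<longlonglongrightarrow> 1"
  proof (rule Lim_transform_eventually)
    show "(\<lambda>d. 1 - real e / real d) \<longlonglongrightarrow> 1"
      using tendsto_diff[OF tendsto_const lim_const_over_n[of "real e"], of 1] by simp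
    show "\<forall>\<^sub>F d in sequentially. 1 - real e / real d = real (d - e) / real d"
      using eventually_gt_at_top[of e] by eventually_elim (simp add: of_nat_diff field_simps)
  qed
  from tendsto_mult[OF filterlim_compose[OF lim[folded LK_def] shift] tendsto_power[OF this, of k]]
  have "(\<lambda>d. real (card (LK (d - e))) / real (d - e) ^ k * (real (d - e) / real d) ^ k) \<longlonglongrightarrow> v" by simp
  then have lim_lower: "(\<lambda>d. real (card (LK (d - e))) / real d ^ k) \<longlonglongrightarrow> v"
    by (rule Lim_transform_eventually)
      (use eventually_gt_at_top[of e] in eventually_elim, simp add: power_divide)
  show ?thesis
  proof (rule tendsto_sandwich[OF _ _ lim_lower lim[folded LK_def]])
    show "\<forall>\<^sub>F d in sequentially. real (card (LK (d - e))) / real d ^ k \<le> real (card (bounded_sums S d)) / real d ^ k"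
      using eventually_gt_at_top[of e] by eventually_elim (simp add: lower divide_right_mono)
    show "\<forall>\<^sub>F d in sequentially. real (card (bounded_sums S d)) / real d ^ k \<le> real (card (LK d)) / real d ^ k"
      using eventually_gt_at_top[of 0]
      by eventually_elim (simp add: card_mono[OF finLK upper] divide_right_mono)
  qed
qed

section \<open>The Hilbert-Samuel function of an edge subring\<close>

definition monom_of :: "('v \<Rightarrow>\<^sub>0 nat) \<Rightarrow> ('v, 'k::field) mpol" where
  "monom_of t = Poly_Mapping.single t 1"

lemma inj_monom_of: "inj (monom_of :: _ \<Rightarrow> ('v, 'k::field) mpol)"
proof (rule injI)
  fix s t assume "monom_of s = (monom_of t :: ('v, 'k) mpol)"
  then have "Poly_Mapping.lookup (monom_of s :: ('v, 'k) mpol) s = Poly_Mapping.lookup (monom_of t) s" by simp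
  then show "s = t" by (simp add: monom_of_def lookup_single when_def split: if_splits)
qed

lemma monom_of_add: "monom_of (s + t) = monom_of s * monom_of t"
  by (simp add: monom_of_def mult_single)

lemma monom_of_0: "monom_of 0 = 1"
  by (simp add: monom_of_def)

lemma lookup_mconst_mult: "Poly_Mapping.lookup (mconst c * p) t = c * Poly_Mapping.lookup p t"
  unfolding mconst_def mult_map_scale_conv_mult[symmetric]
  by (simp add: Poly_Mapping.map.rep_eq when_def)

text \<open>In a vanishing linear combination, the coefficient of the exponent \<open>t\<close>
  isolates the scalar at \<open>monom_of t\<close>. Dimensions of monomial spans thereby become
  cardinalities, over any field.\<close>

lemma independent_monom_of: "\<not> mpol.dependent (monom_of ` T :: ('v, 'k::field) mpol set)"
proof
  assume "mpol.dependent (monom_of ` T :: ('v, 'k) mpol set)"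
  then obtain U u and a :: "('v, 'k) mpol" where U: "finite U" "U \<subseteq> monom_of ` T" "(\<Sum>p\<in>U. mconst (u p) * p) = 0" "a \<in> U" "u a \<noteq> 0"
    unfolding mpol.dependent_explicit by blast
  obtain t where t: "a = monom_of t" using U by blast
  have "0 = Poly_Mapping.lookup (\<Sum>p\<in>U. mconst (u p) * p) t" using U(3) by simp
  also have "\<dots> = (\<Sum>p\<in>U. u p * Poly_Mapping.lookup p t)"
    by (simp add: lookup_sum lookup_mconst_mult)
  also have "\<dots> = (\<Sum>p\<in>{a}. u p * Poly_Mapping.lookup p t)"
  proof (rule sum.mono_neutral_right[OF U(1)])
    show "\<forall>p\<in>U - {a}. u p * Poly_Mapping.lookup p t = 0"
    proof
      fix p assume "p \<in> U - {a}"
      then obtain s where "p = monom_of s" "s \<noteq> t" using U(2) t by blast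
      then show "u p * Poly_Mapping.lookup p t = 0" by (simp add: monom_of_def lookup_single when_def)
    qed
  qed (use U in auto)
  also have "\<dots> = u a" by (simp add: t monom_of_def)
  finally show False using U by simp
qed

lemma mpol_dim_span_monom_of: "mpol_dim (mpol_span (monom_of ` T) :: ('v, 'k::field) mpol set) = card T"
  using mpol.dim_span_eq_card_independent[OF independent_monom_of[of T, where 'k = 'k]]
    card_image[OF inj_on_subset[OF inj_monom_of[where 'k = 'k]], of T]
  by simp

definition edge_exponent :: "'v set \<Rightarrow> 'v \<Rightarrow>\<^sub>0 nat" where
  "edge_exponent e = (\<Sum>x\<in>e. Poly_Mapping.single x 1)"

lemma edge_monomial_eq_monom_of: "edge_monomial e = monom_of (edge_exponent e)"
  by (cases "finite e"; induction e rule: infinite_finite_induct)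
    (simp_all add: edge_monomial_def edge_exponent_def monom_of_0 monom_of_add mvar_def
      flip: monom_of_def)

definition indicator_vec :: "'v set \<Rightarrow> real^'v::finite" where
  "indicator_vec e = (\<Sum>x\<in>e. axis x 1)"

definition exponent_vec :: "('v \<Rightarrow>\<^sub>0 nat) \<Rightarrow> real^'v::finite" where
  "exponent_vec t = (\<chi> x. real (Poly_Mapping.lookup t x))"

lemma inj_exponent_vec: "inj exponent_vec"
  by (rule injI) (simp add: exponent_vec_def vec_eq_iff poly_mapping_eq_iff fun_eq_iff)

lemma exponent_vec_edge_exponent: "exponent_vec (edge_exponent e) = indicator_vec e"
  by (simp add: exponent_vec_def edge_exponent_def indicator_vec_def vec_eq_iff axis_def
      lookup_sum lookup_single when_def)

lemma exponent_vec_sum_list: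
  "exponent_vec (sum_list ts) = sum_list (map exponent_vec ts)"
  by (induction ts) (simp_all add: exponent_vec_def vec_eq_iff lookup_add)

lemma lists_image_length:
  "{xs. length xs = i \<and> set xs \<subseteq> f ` A} = map f ` {ys. length ys = i \<and> set ys \<subseteq> A}"
proof
  show "{xs. length xs = i \<and> set xs \<subseteq> f ` A} \<subseteq> map f ` {ys. length ys = i \<and> set ys \<subseteq> A}"
  proof
    fix xs assume xs: "xs \<in> {xs. length xs = i \<and> set xs \<subseteq> f ` A}"
    then have "xs \<in> lists (f ` A)" by auto
    then obtain ys where "ys \<in> lists A" "xs = map f ys" unfolding lists_image by blast
    with xs show "xs \<in> map f ` {ys. length ys = i \<and> set ys \<subseteq> A}" by auto
  qed
  show "map f ` {ys. length ys = i \<and> set ys \<subseteq> A} \<subseteq> {xs. length xs = i \<and> set xs \<subseteq> f ` A}"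
  proof
    fix xs assume "xs \<in> map f ` {ys. length ys = i \<and> set ys \<subseteq> A}"
    then obtain ys where "xs = map f ys" "length ys = i" "set ys \<subseteq> A" by blast
    then show "xs \<in> {xs. length xs = i \<and> set xs \<subseteq> f ` A}" by (simp add: image_mono)
  qed
qed

text \<open>Products of generators are indexed by lists, the lattice argument by coefficient
  functions. The sum of a list depends only on how often each vector occurs.\<close>

lemma sum_lists_eq_combinations:
  fixes S :: "'a::real_vector set"
  assumes "finite S"
  shows "{sum_list xs | xs. length xs = i \<and> set xs \<subseteq> S} = {\<Sum>s\<in>S. real (f s) *\<^sub>R s | f. sum f S = i}"
    (is "?L i = ?R i")
proof (induction i)
  case 0
  have "?R 0 = {0}" using assms by (auto intro!: exI[of _ "\<lambda>_. 0"])
  then show ?case by auto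
next
  case (Suc i)
  have upd: "(\<Sum>s\<in>S. real ((f(a := Suc (f a))) s) *\<^sub>R s) = a + (\<Sum>s\<in>S. real (f s) *\<^sub>R s)"
    "sum (f(a := Suc (f a))) S = Suc (sum f S)" if "a \<in> S" for f a
    using that assms
    by (simp_all add: sum.remove[of S a] algebra_simps)
  have "?L (Suc i) = {a + x | a x. a \<in> S \<and> x \<in> ?L i}"
  proof
    show "?L (Suc i) \<subseteq> {a + x | a x. a \<in> S \<and> x \<in> ?L i}"
      by (auto simp: length_Suc_conv) blast
    show "{a + x | a x. a \<in> S \<and> x \<in> ?L i} \<subseteq> ?L (Suc i)"
    proof
      fix y assume "y \<in> {a + x | a x. a \<in> S \<and> x \<in> ?L i}"
      then obtain a xs where "a \<in> S" "length xs = i" "set xs \<subseteq> S" "y = sum_list (a # xs)" by auto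
      then show "y \<in> ?L (Suc i)" by (intro CollectI exI[of _ "a # xs"]) simp
    qed
  qed
  also have "\<dots> = {a + x | a x. a \<in> S \<and> x \<in> ?R i}" unfolding Suc.IH ..
  also have "\<dots> = ?R (Suc i)"
  proof
    show "{a + x | a x. a \<in> S \<and> x \<in> ?R i} \<subseteq> ?R (Suc i)"
    proof
      fix y assume "y \<in> {a + x | a x. a \<in> S \<and> x \<in> ?R i}"
      then obtain a f where "a \<in> S" "sum f S = i" "y = a + (\<Sum>s\<in>S. real (f s) *\<^sub>R s)" by blast
      then show "y \<in> ?R (Suc i)"
        using upd[of a f] by (intro CollectI exI[of _ "f(a := Suc (f a))"]) simp
    qed
    show "?R (Suc i) \<subseteq> {a + x | a x. a \<in> S \<and> x \<in> ?R i}"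
    proof
      fix y assume "y \<in> ?R (Suc i)"
      then obtain f where f: "sum f S = Suc i" "y = (\<Sum>s\<in>S. real (f s) *\<^sub>R s)" by blast
      then obtain a where a: "a \<in> S" "f a > 0" by (metis gr0I sum.neutral nat.distinct(1))
      define g where "g = f(a := f a - 1)"
      have "f = g(a := Suc (g a))" using a by (auto simp: g_def)
      with upd[OF a(1), of g] f have "sum g S = i" "y = a + (\<Sum>s\<in>S. real (g s) *\<^sub>R s)" by auto
      with a(1) show "y \<in> {a + x | a x. a \<in> S \<and> x \<in> ?R i}" by blast
    qed
  qed
  finally show ?case .
qed

lemma coord_sum_indicator_vec: "coord_sum (indicator_vec e) = real (card e)"
proof -
  have "coord_sum (indicator_vec e) = (\<Sum>x\<in>e. coord_sum (axis x 1))"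
    unfolding indicator_vec_def by (rule coord_sum_sum)
  also have "\<dots> = real (card e)" by (simp only: coord_sum_def sum_coord_axis) simp
  finally show ?thesis .
qed

text \<open>The component of degree \<open>i\<close> has as a basis the distinct products of
  \<open>i\<close> edge monomials, whose exponent vectors form \<open>Y i\<close>. Vectors in
  \<open>Y i\<close> have coordinate sum \<open>m * i\<close>, so different degrees are disjoint and
  the sum of dimensions counts a union.\<close>

lemma hilbert_samuel_function_edge_subring:
  fixes E :: "'v::finite set set"
  assumes G: "uniform_hypergraph m UNIV E"
  shows "hilbert_samuel_function m (edge_subring E :: ('v, 'k::field) mpol set) d
    = card (bounded_sums (indicator_vec ` E) d)"
proof -
  let ?S = "indicator_vec ` E"
  define T where "T i = {sum_list (map edge_exponent es) | es. length es = i \<and> set es \<subseteq> E}" for i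
  define Y where "Y i = {\<Sum>s\<in>?S. real (f s) *\<^sub>R s | f. sum f ?S = i}" for i
  have S: "coord_sum s = real m" if "s \<in> ?S" for s
    using that G by (auto simp: uniform_hypergraph_def coord_sum_indicator_vec)
  have gens: "{prod_list gs | gs. length gs = i \<and> set gs \<subseteq> edge_monomial ` E} = (monom_of ` T i :: ('v, 'k) mpol set)" for i
  proof -
    have prod: "prod_list (map edge_monomial es) = (monom_of (sum_list (map edge_exponent es)) :: ('v, 'k) mpol)" for es
      by (induction es) (simp_all add: monom_of_0 monom_of_add edge_monomial_eq_monom_of)
    have "{prod_list gs | gs. length gs = i \<and> set gs \<subseteq> edge_monomial ` E}
        = prod_list ` {gs :: ('v, 'k) mpol list. length gs = i \<and> set gs \<subseteq> edge_monomial ` E}"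
      by (simp add: image_Collect)
    also have "\<dots> = (\<lambda>es. monom_of (sum_list (map edge_exponent es))) ` {es. length es = i \<and> set es \<subseteq> E}"
      by (simp add: lists_image_length image_image prod)
    also have "\<dots> = monom_of ` T i" by (simp add: T_def image_Collect) blast
    finally show ?thesis .
  qed
  have "exponent_vec ` T i = Y i" for i
  proof -
    have "exponent_vec ` T i = (\<lambda>es. sum_list (map indicator_vec es)) ` {es. length es = i \<and> set es \<subseteq> E}"
      by (simp add: T_def setcompr_eq_image image_image exponent_vec_sum_list exponent_vec_edge_exponent comp_def)
    also have "\<dots> = sum_list ` {xs. length xs = i \<and> set xs \<subseteq> ?S}"
      by (simp add: lists_image_length image_image)
    also have "\<dots> = {sum_list xs | xs. length xs = i \<and> set xs \<subseteq> ?S}" by (simp add: image_Collect)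
    also have "\<dots> = Y i" unfolding Y_def by (rule sum_lists_eq_combinations) simp
    finally show ?thesis .
  qed
  then have T_Y: "card (T i) = card (Y i)" for i
    using card_image[OF inj_on_subset[OF inj_exponent_vec], of "T i"] by simp
  have fin: "finite (Y i)" for i
    unfolding Y_def sum_lists_eq_combinations[OF finite_imageI[OF finite], symmetric]
    using finite_lists_length_eq[of ?S i] by (simp add: setcompr_eq_image conj_commute)
  have "hilbert_samuel_function m (edge_subring E :: ('v, 'k) mpol set) d = (\<Sum>i\<le>d. card (Y i))"
    unfolding hilbert_samuel_function_def graded_component_edge_subring[OF G] gens mpol_dim_span_monom_of T_Y ..
  also have "\<dots> = card (\<Union>i\<in>{..d}. Y i)"
  proof (rule card_UN_disjoint[symmetric])
    show "\<forall>i\<in>{..d}. \<forall>j\<in>{..d}. i \<noteq> j \<longrightarrow> Y i \<inter> Y j = {}"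
    proof (intro ballI impI equals0I)
      fix i j z assume "i \<noteq> j" and "z \<in> Y i \<inter> Y j"
      then obtain f g where fg: "z = (\<Sum>s\<in>?S. real (f s) *\<^sub>R s)" "sum f ?S = i"
        "z = (\<Sum>s\<in>?S. real (g s) *\<^sub>R s)" "sum g ?S = j" unfolding Y_def by blast
      have cs: "coord_sum (\<Sum>s\<in>?S. real (h s) *\<^sub>R s) = real (sum h ?S) * real m" for h
        using coord_sum_combination[OF S, where c = "\<lambda>s. real (h s)"] by (simp only: of_nat_sum)
      have "real i * real m = real j * real m"
        using cs[of f] cs[of g] unfolding fg(2,4) fg(1)[symmetric] fg(3)[symmetric] by (simp only:)
      moreover have "m > 0" using G by (simp add: uniform_hypergraph_def)
      ultimately show False using \<open>i \<noteq> j\<close> by (metis mult_cancel_right of_nat_eq_iff of_nat_0_less_iff less_irrefl)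
    qed
  qed (use fin in auto)
  also have "(\<Union>i\<in>{..d}. Y i) = bounded_sums ?S d"
    unfolding Y_def bounded_sums_def by auto
  finally show ?thesis .
qed

section \<open>Components and pivot classes\<close>

lemma indicator_vec_nth: "indicator_vec e $ x = (if x \<in> e then 1 else 0)"
  by (simp add: indicator_vec_def axis_def)

lemma joined_sym: "joined E x y \<Longrightarrow> joined E y x"
proof -
  assume "joined E x y"
  then consider "x = y" | es where "es \<noteq> []" "set es \<subseteq> E" "x \<in> hd es" "y \<in> last es"
    "successively (\<lambda>e f. e \<inter> f \<noteq> {}) es"
    unfolding joined_def by blast
  then show ?thesis
  proof cases
    case 2
    then show ?thesis unfolding joined_def
      by (intro disjI2 exI[of _ "rev es"]) (simp add: hd_rev last_rev Int_commute)
  qed (simp add: joined_def)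
qed

lemma joined_trans: "joined E x y \<Longrightarrow> joined E y z \<Longrightarrow> joined E x z"
proof -
  assume xy: "joined E x y" and yz: "joined E y z"
  show ?thesis
  proof (cases "x = y \<or> y = z")
    case False
    obtain es where es: "es \<noteq> []" "set es \<subseteq> E" "x \<in> hd es" "y \<in> last es"
      "successively (\<lambda>e f. e \<inter> f \<noteq> {}) es" using xy False unfolding joined_def by blast
    obtain fs where fs: "fs \<noteq> []" "set fs \<subseteq> E" "y \<in> hd fs" "z \<in> last fs"
      "successively (\<lambda>e f. e \<inter> f \<noteq> {}) fs" using yz False unfolding joined_def by blast
    have "last es \<inter> hd fs \<noteq> {}" using es(4) fs(3) by blast
    then have "successively (\<lambda>e f. e \<inter> f \<noteq> {}) (es @ fs)"
      using es fs by (simp add: successively_append_iff)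
    then show ?thesis unfolding joined_def using es fs
      by (intro disjI2 exI[of _ "es @ fs"]) simp
  qed (use xy yz in auto)
qed

lemma equiv_joined: "equiv UNIV {(x, y). x \<in> UNIV \<and> y \<in> UNIV \<and> joined E x y}"
proof (rule equivI)
  show "refl_on UNIV {(x, y). x \<in> UNIV \<and> y \<in> UNIV \<and> joined E x y}"
    by (rule refl_onI) (simp_all add: joined_def)
qed (auto intro!: symI transI dest: joined_sym joined_trans)

lemma partition_on_conn_components: "partition_on UNIV (conn_components UNIV E)"
  unfolding conn_components_def by (rule partition_on_quotient[OF equiv_joined])

lemma edge_subset_component:
  assumes "C \<in> conn_components UNIV E" "e \<in> E" "x \<in> e" "x \<in> C"
  shows "e \<subseteq> C"
proof
  fix y assume "y \<in> e"
  then have "joined E x y" unfolding joined_def using assms by (intro disjI2 exI[of _ "[e]"]) simp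
  then show "y \<in> C"
    using in_quotient_imp_closed[OF equiv_joined, of C E x y] assms unfolding conn_components_def by simp
qed

lemma component_contains_edge:
  assumes "\<forall>x. \<not> isolated_node E x" "C \<in> conn_components UNIV E" "x \<in> C"
  obtains e where "e \<in> induced_edges E C" "x \<in> e"
proof -
  obtain e where "e \<in> E" "x \<in> e" using assms(1) unfolding isolated_node_def by blast
  then show ?thesis
    using edge_subset_component[OF assms(2) _ _ assms(3)] by (intro that[of e]) (auto simp: induced_edges_def)
qed

text \<open>An edge that meets a component lies inside it, so its block sums are \<open>m\<close> or
  0.\<close>

lemma indicator_vec_block_lattice:
  fixes E :: "'v::finite set set"
  assumes G: "uniform_hypergraph m UNIV E" and e: "e \<in> E"
  shows "indicator_vec e \<in> block_lattice m (conn_components UNIV E)"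
  unfolding block_lattice_def
proof (intro CollectI conjI ballI)
  show "integral_vec (indicator_vec e)" by (simp add: integral_vec_def indicator_vec_nth)
  fix C assume C: "C \<in> conn_components UNIV E"
  have sum: "(\<Sum>x\<in>C. indicator_vec e $ x) = real (card (C \<inter> e))"
    by (simp add: indicator_vec_nth sum.If_cases)
  show "\<exists>k::int. (\<Sum>x\<in>C. indicator_vec e $ x) = of_int k * real m"
  proof (cases "C \<inter> e = {}")
    case True
    then show ?thesis unfolding sum by (intro exI[of _ 0]) simp
  next
    case False
    then have "C \<inter> e = e" using edge_subset_component[OF C e] by blast
    then show ?thesis unfolding sum using G e
      by (intro exI[of _ 1]) (simp add: uniform_hypergraph_def)
  qed
qed

section \<open>The lattice generated by the edge vectors\<close>

definition int_span :: "('a::real_vector) set \<Rightarrow> 'a set" where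
  "int_span S = {\<Sum>s\<in>S. of_int (f s) *\<^sub>R s | f. True}"

lemma int_span_base: "finite S \<Longrightarrow> s \<in> S \<Longrightarrow> s \<in> int_span S"
proof -
  assume S: "finite S" "s \<in> S"
  have "(\<Sum>t\<in>S. of_int (if t = s then 1 else 0) *\<^sub>R t) = (\<Sum>t\<in>S. if t = s then t else 0)"
    by (intro sum.cong) auto
  also have "\<dots> = s" using S by simp
  finally show ?thesis unfolding int_span_def by (intro CollectI exI[of _ "\<lambda>t. if t = s then 1 else 0"]) simp
qed

lemma int_span_add: "x \<in> int_span S \<Longrightarrow> y \<in> int_span S \<Longrightarrow> x + y \<in> int_span S"
proof -
  assume "x \<in> int_span S" "y \<in> int_span S"
  then obtain f g where "x = (\<Sum>s\<in>S. of_int (f s) *\<^sub>R s)" "y = (\<Sum>s\<in>S. of_int (g s) *\<^sub>R s)"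
    unfolding int_span_def by blast
  then have "x + y = (\<Sum>s\<in>S. of_int (f s + g s) *\<^sub>R s)"
    by (simp add: scaleR_left_distrib sum.distrib)
  then show ?thesis unfolding int_span_def by (intro CollectI exI[of _ "\<lambda>s. f s + g s"]) simp
qed

lemma int_span_scale: "x \<in> int_span S \<Longrightarrow> of_int k *\<^sub>R x \<in> int_span S"
proof -
  assume "x \<in> int_span S"
  then obtain f where "x = (\<Sum>s\<in>S. of_int (f s) *\<^sub>R s)" unfolding int_span_def by blast
  then have "of_int k *\<^sub>R x = (\<Sum>s\<in>S. of_int (k * f s) *\<^sub>R s)"
    by (simp add: scaleR_sum_right)
  then show ?thesis unfolding int_span_def by (intro CollectI exI[of _ "\<lambda>s. k * f s"]) simp
qed

lemma int_span_0: "0 \<in> int_span S"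
  unfolding int_span_def by (intro CollectI exI[of _ "\<lambda>_. 0"]) simp

lemma int_span_diff: "x \<in> int_span S \<Longrightarrow> y \<in> int_span S \<Longrightarrow> x - y \<in> int_span S"
  using int_span_add[OF _ int_span_scale[of y S "-1"], of x] by simp

lemma int_span_sum: "(\<And>i. i \<in> I \<Longrightarrow> g i \<in> int_span S) \<Longrightarrow> sum g I \<in> int_span S"
  by (induction I rule: infinite_finite_induct) (auto intro: int_span_0 int_span_add)

text \<open>One pivot exchange replaces a single node of an edge by another, so the difference of
  the two edge vectors is a difference of unit vectors. These differences add up along a
  chain.\<close>

lemma axis_diff_int_span:
  fixes E :: "'v::finite set set"
  assumes "pivot_equivalent C (induced_edges E C) x y"
  shows "axis y 1 - axis x 1 \<in> int_span (indicator_vec ` E)"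
  using assms unfolding pivot_equivalent_def
proof (induction rule: rtranclp_induct)
  case base
  show ?case by (simp add: int_span_0)
next
  case (step y z)
  obtain A where A: "A \<subseteq> C - {y, z}" "insert y A \<in> E" "insert z A \<in> E"
    using step(2) unfolding pivot_adjacent_def induced_edges_def by blast
  have "axis z 1 - axis y 1 = indicator_vec (insert z A) - (indicator_vec (insert y A) :: real^'v)"
    using A(1) unfolding indicator_vec_def by (subst (1 2) sum.insert) auto
  also have "\<dots> \<in> int_span (indicator_vec ` E)"
    using A by (intro int_span_diff int_span_base) auto
  finally show ?case using int_span_add[OF step(3)] by fastforce
qed

text \<open>Take an edge through \<open>x\<close> and move each of its \<open>m\<close> nodes to
  \<open>x\<close>; every move subtracts a vector already known to lie in the span.\<close>

lemma scaled_axis_int_span: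
  fixes E :: "'v::finite set set"
  assumes G: "uniform_hypergraph m UNIV E" and NI: "\<forall>x. \<not> isolated_node E x"
    and C: "C \<in> conn_components UNIV E" "x \<in> C"
    and piv: "\<And>x y. x \<in> C \<Longrightarrow> y \<in> C \<Longrightarrow> pivot_equivalent C (induced_edges E C) x y"
  shows "real m *\<^sub>R axis x 1 \<in> int_span (indicator_vec ` E)"
proof -
  obtain e where e: "e \<in> induced_edges E C" "x \<in> e" by (rule component_contains_edge[OF NI C])
  then have eE: "e \<in> E" "e \<subseteq> C" by (auto simp: induced_edges_def)
  have "card e = m" using G eE by (simp add: uniform_hypergraph_def)
  then have "real m *\<^sub>R axis x 1 = (indicator_vec e :: real^'v) - (\<Sum>y\<in>e. axis y 1 - axis x 1)"
    unfolding indicator_vec_def by (simp add: sum_subtractf scaleR_conv_of_real)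
  also have "\<dots> \<in> int_span (indicator_vec ` E)"
  proof (rule int_span_diff)
    show "indicator_vec e \<in> int_span (indicator_vec ` E)" using eE by (intro int_span_base) auto
    show "(\<Sum>y\<in>e. axis y 1 - axis x 1) \<in> int_span (indicator_vec ` E)"
      using eE C by (intro int_span_sum axis_diff_int_span[of C] piv) auto
  qed
  finally show ?thesis .
qed

text \<open>Within each block all weight is moved to one node \<open>a\<close>. What remains is the
  block sum times the unit vector at \<open>a\<close>, an integer multiple of
  \<open>m *\<^sub>R axis a 1\<close> by the congruence.\<close>

lemma block_lattice_subset_int_span:
  fixes E :: "'v::finite set set"
  assumes G: "uniform_hypergraph m UNIV E" and NI: "\<forall>x. \<not> isolated_node E x"
    and piv: "\<And>C x y. C \<in> conn_components UNIV E \<Longrightarrow> x \<in> C \<Longrightarrow> y \<in> C \<Longrightarrow>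
      pivot_equivalent C (induced_edges E C) x y"
  shows "block_lattice m (conn_components UNIV E) \<subseteq> int_span (indicator_vec ` E)"
proof
  fix z :: "real^'v" assume z: "z \<in> block_lattice m (conn_components UNIV E)"
  let ?P = "conn_components UNIV E" and ?I = "int_span (indicator_vec ` E)"
  have block: "(\<Sum>x\<in>C. z $ x *\<^sub>R axis x 1) \<in> ?I" if C: "C \<in> ?P" for C
  proof -
    have "C \<noteq> {}" using partition_onD3[OF partition_on_conn_components] C by metis
    then obtain a where a: "a \<in> C" by blast
    obtain k :: int where k: "(\<Sum>x\<in>C. z $ x) = of_int k * real m"
      using z C by (auto simp: block_lattice_def)
    have "(\<Sum>x\<in>C. z $ x *\<^sub>R axis x 1) = (\<Sum>x\<in>C. z $ x *\<^sub>R (axis x 1 - axis a 1)) + (\<Sum>x\<in>C. z $ x) *\<^sub>R axis a 1"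
      by (simp add: scaleR_right_diff_distrib sum_subtractf scaleR_sum_left)
    also have "(\<Sum>x\<in>C. z $ x) *\<^sub>R axis a 1 = of_int k *\<^sub>R (real m *\<^sub>R (axis a 1 :: real^'v))" by (simp add: k)
    also have "(\<Sum>x\<in>C. z $ x *\<^sub>R (axis x 1 - axis a 1)) + of_int k *\<^sub>R (real m *\<^sub>R (axis a 1 :: real^'v)) \<in> ?I"
    proof (intro int_span_add int_span_sum int_span_scale)
      show "real m *\<^sub>R axis a 1 \<in> ?I" by (rule scaled_axis_int_span[OF G NI C a piv[OF C]])
      fix x assume "x \<in> C"
      have "z $ x \<in> \<int>" using z by (simp add: block_lattice_def integral_vec_def)
      then obtain j where "z $ x = of_int j" by (rule Ints_cases)
      then show "z $ x *\<^sub>R (axis x 1 - axis a 1) \<in> ?I"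
        using int_span_scale[OF axis_diff_int_span[OF piv[OF C a \<open>x \<in> C\<close>]]] by simp
    qed
    finally show ?thesis .
  qed
  have "z = (\<Sum>x\<in>UNIV. z $ x *\<^sub>R axis x 1)"
    by (simp add: vec_eq_iff axis_def if_distrib cong: if_cong)
  also have "\<dots> = (\<Sum>x\<in>\<Union>?P. z $ x *\<^sub>R axis x 1)"
    using partition_onD1[OF partition_on_conn_components, of E] by simp
  also have "\<dots> = (\<Sum>C\<in>?P. \<Sum>x\<in>C. z $ x *\<^sub>R axis x 1)"
    using disjointD[OF partition_onD2[OF partition_on_conn_components]]
    by (subst sum.Union_disjoint) auto
  also have "\<dots> \<in> ?I" by (rule int_span_sum) (rule block)
  finally show "z \<in> ?I" .
qed

section \<open>Pivot classes and linear relations between edges\<close>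

lemma pivot_adjacent_sym: "pivot_adjacent V E x y \<Longrightarrow> pivot_adjacent V E y x"
  unfolding pivot_adjacent_def insert_commute[of x y] by blast

lemma successively_invariant:
  assumes "successively R xs" "xs \<noteq> []" "\<And>x y. x \<in> set xs \<Longrightarrow> y \<in> set xs \<Longrightarrow> R x y \<Longrightarrow> f x = f y"
  shows "f (hd xs) = f (last xs)"
  using assms
proof (induction xs)
  case (Cons x xs)
  show ?case
  proof (cases "xs = []")
    case False
    then have "R x (hd xs)" "successively R xs" using Cons.prems by (auto simp: successively_Cons)
    moreover have "f (hd xs) = f (last xs)"
      using Cons.prems(3) by (intro Cons.IH calculation False) auto
    ultimately show ?thesis using Cons.prems(3)[of x "hd xs"] False by simp
  qed simp
qed simp

text \<open>Consecutive edges of a proper chain share \<open>m - 1\<close> nodes and so differ by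
  exchanging one node \<open>a\<close> for one node \<open>b\<close>. Their intersection witnesses
  that \<open>a\<close> and \<open>b\<close> are pivot adjacent, so both or neither belong to the
  class.\<close>

lemma card_edge_inter_pivot_class:
  assumes unif: "\<And>e. e \<in> E \<Longrightarrow> finite e \<and> card e = m \<and> e \<subseteq> C" and m: "1 \<le> m"
    and proper: "properly_connected m E" and "u \<in> E" "v \<in> E"
  shows "card (u \<inter> {w. pivot_equivalent C E x w}) = card (v \<inter> {w. pivot_equivalent C E x w})"
proof -
  let ?X = "{w. pivot_equivalent C E x w}"
  obtain es where es: "es \<noteq> []" "set es \<subseteq> E" "hd es = u" "last es = v"
    "successively (\<lambda>e f. card (e \<inter> f) = m - 1) es"
    using proper \<open>u \<in> E\<close> \<open>v \<in> E\<close> unfolding properly_connected_def by blast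
  have "card (e \<inter> ?X) = card (f \<inter> ?X)" if ef: "e \<in> E" "f \<in> E" "card (e \<inter> f) = m - 1" for e f
  proof -
    let ?A = "e \<inter> f"
    have fin: "finite e" "finite f" "card e = m" "card f = m" "e \<subseteq> C" "f \<subseteq> C" using unif ef by auto
    have "card (e - f) = 1" "card (f - e) = 1"
      using fin ef(3) m card_Diff_subset_Int[of e f] card_Diff_subset_Int[of f e] by (auto simp: Int_commute)
    then obtain a b where ab: "e - f = {a}" "f - e = {b}" by (auto simp: card_1_singleton_iff)
    then have eq: "e = insert a ?A" "f = insert b ?A" "a \<notin> ?A" "b \<notin> ?A" by blast+
    have "?A \<subseteq> C - {a, b}" using eq fin by blast
    moreover have "insert a ?A \<in> E" "insert b ?A \<in> E" using eq(1,2) ef by simp_all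
    ultimately have piv: "pivot_adjacent C E a b" unfolding pivot_adjacent_def by blast
    have X: "a \<in> ?X \<longleftrightarrow> b \<in> ?X"
      using piv pivot_adjacent_sym[OF piv] unfolding pivot_equivalent_def
      by (auto intro: rtranclp.rtrancl_into_rtrancl)
    have card_insert: "card (insert c ?A \<inter> ?X) = card (?A \<inter> ?X) + (if c \<in> ?X then 1 else 0)"
      if "c \<notin> ?A" for c
      using that fin(1) by (simp add: Int_insert_left)
    have "card (insert a ?A \<inter> ?X) = card (insert b ?A \<inter> ?X)"
      unfolding card_insert[OF eq(3)] card_insert[OF eq(4)] using X by simp
    then show ?thesis using eq(1,2) by simp
  qed
  then have "card (hd es \<inter> ?X) = card (last es \<inter> ?X)"
    using es(2) by (intro successively_invariant[OF es(5,1), of "\<lambda>e. card (e \<inter> ?X)"]) blast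
  then show ?thesis by (simp add: es)
qed

text \<open>Every edge of a properly connected component meets a given pivot class in the same number of
  nodes, so two different classes give a linear relation between the coordinates of all edges.\<close>

lemma edges_in_hyperplane:
  fixes E :: "'v::finite set set"
  assumes G: "uniform_hypergraph m UNIV E" and NI: "\<forall>x. \<not> isolated_node E x"
    and C: "C \<in> conn_components UNIV E" and proper: "properly_connected m (induced_edges E C)"
    and xy: "x \<in> C" "y \<in> C" "\<not> pivot_equivalent C (induced_edges E C) x y"
  shows "\<exists>a. a \<noteq> 0 \<and> (\<forall>e\<in>E. a \<bullet> indicator_vec e = 0)"
proof -
  let ?E = "induced_edges E C"
  define X where "X x = {w. pivot_equivalent C ?E x w}" for x
  have sym: "pivot_equivalent C ?E b a" if "pivot_equivalent C ?E a b" for a b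
    using that pivot_adjacent_sym unfolding pivot_equivalent_def
    by (metis sympD sympI symp_rtranclp)
  have disj: "X x \<inter> X y = {}"
    using xy(3) sym unfolding X_def pivot_equivalent_def by (auto intro: rtranclp_trans)
  have sub: "w \<in> C" if "w \<in> X z" "z \<in> C" for w z
    using that(1) unfolding X_def mem_Collect_eq pivot_equivalent_def
  proof (cases rule: rtranclp.cases)
    case rtrancl_refl
    then show ?thesis using that by simp
  next
    case (rtrancl_into_rtrancl b)
    then show ?thesis unfolding pivot_adjacent_def induced_edges_def by blast
  qed
  have self: "z \<in> X z" for z by (simp add: X_def pivot_equivalent_def)
  have unif: "finite e \<and> card e = m \<and> e \<subseteq> C" if "e \<in> ?E" for e
    using G that by (auto simp: uniform_hypergraph_def induced_edges_def)
  have m: "1 \<le> m" using G by (simp add: uniform_hypergraph_def)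
  obtain u where u: "u \<in> ?E" "x \<in> u" by (rule component_contains_edge[OF NI C xy(1)])
  obtain v where v: "v \<in> ?E" "y \<in> v" by (rule component_contains_edge[OF NI C xy(2)])
  define r where "r = card (u \<inter> X x)"
  define s where "s = card (v \<inter> X y)"
  have r: "card (e \<inter> X x) = r" and s: "card (e \<inter> X y) = s" if "e \<in> ?E" for e
    using card_edge_inter_pivot_class[OF unif m proper that u(1), of x]
      card_edge_inter_pivot_class[OF unif m proper that v(1), of y]
    by (simp_all add: r_def s_def X_def)
  have "s > 0" using v(2) self[of y] by (auto simp: s_def card_gt_0_iff)
  \<comment> \<open>On an edge of \<open>C\<close> the inner product is
    \<open>s * r - r * s\<close>, and edges outside \<open>C\<close> miss both classes. The class of
    \<open>y\<close> contains \<open>y\<close>, hence \<open>s > 0\<close>, and the coordinate of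
    \<open>a\<close> at \<open>x\<close> is nonzero.\<close>
  define a where "a = real s *\<^sub>R indicator_vec (X x) - real r *\<^sub>R (indicator_vec (X y) :: real^'v)"
  have inner: "indicator_vec A \<bullet> indicator_vec e = real (card (e \<inter> A))" for A e :: "'v set"
    by (simp add: inner_vec_def indicator_vec_nth if_distrib[of "\<lambda>t. t * _"] sum.If_cases Int_commute
        flip: if_if_eq_conj cong: if_cong)
  have "a $ x = real s" using self[of x] disj by (auto simp: a_def indicator_vec_nth)
  then have "a \<noteq> 0" using \<open>s > 0\<close> by auto
  moreover have "a \<bullet> indicator_vec e = 0" if "e \<in> E" for e
  proof (cases "e \<subseteq> C")
    case True
    then have "e \<in> ?E" using that by (simp add: induced_edges_def)
    then show ?thesis by (simp add: a_def inner_diff_left inner r s)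
  next
    case False
    then have "e \<inter> C = {}" using edge_subset_component[OF C that] by blast
    then have "e \<inter> X x = {}" "e \<inter> X y = {}" using sub xy(1,2) by blast+
    then show ?thesis by (simp add: a_def inner_diff_left inner)
  qed
  ultimately show ?thesis by blast
qed

section \<open>Vanishing and positivity of the volume\<close>

lemma measure_convex_hull_insert_0_eq_0:
  fixes S :: "'a::euclidean_space set"
  assumes "finite S" "a \<noteq> 0" "\<And>s. s \<in> S \<Longrightarrow> a \<bullet> s = 0"
  shows "measure lborel (convex hull (insert 0 S)) = 0"
proof -
  have "convex hull (insert 0 S) \<subseteq> {x. a \<bullet> x = 0}"
    using assms by (intro hull_minimal) (auto simp: convex_hyperplane)
  then have "negligible (convex hull (insert 0 S))"
    using negligible_hyperplane[of a 0] assms(2) by (blast intro: negligible_subset)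
  moreover have "compact (convex hull (insert 0 S))"
    by (rule finite_imp_compact_convex_hull) (simp add: assms)
  ultimately show ?thesis
    by (metis borel_compact measure_completion negligible_imp_measure0 sets_lborel)
qed

text \<open>A convex set with empty interior lies in a hyperplane. Containing the origin, it would
  force the hyperplane to be linear, and then \<open>S\<close> could not span.\<close>

lemma measure_convex_hull_insert_0_pos:
  fixes S :: "'a::euclidean_space set"
  assumes "finite S" and span: "span S = UNIV"
  shows "measure lborel (convex hull (insert 0 S)) > 0"
proof -
  let ?K = "convex hull (insert 0 S)"
  have "compact ?K" by (rule finite_imp_compact_convex_hull) (simp add: assms)
  then have meas: "?K \<in> lmeasurable" and eq: "measure lborel ?K = measure lebesgue ?K"
    by (simp_all add: lmeasurable_compact measure_completion borel_compact)
  have "interior ?K \<noteq> {}"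
  proof
    assume "interior ?K = {}"
    then obtain a b where ab: "a \<noteq> 0" "?K \<subseteq> {x. a \<bullet> x = b}"
      using empty_interior_subset_hyperplane[OF convex_convex_hull] by blast
    then have hyp: "a \<bullet> x = b" if "x \<in> insert 0 S" for x using hull_inc[OF that, of convex] by blast
    then have "b = 0" by force
    then have "S \<subseteq> {x. a \<bullet> x = 0}" using hyp by blast
    then have "span S \<subseteq> {x. a \<bullet> x = 0}" by (rule span_minimal) (rule subspace_hyperplane)
    then have "a \<bullet> a = 0" using span by blast
    with ab show False by simp
  qed
  then have "\<not> negligible ?K" by (simp add: negligible_convex_interior)
  then show ?thesis
    unfolding eq using meas measure_nonneg[of lebesgue ?K] negligible_iff_measure by (metis less_le)
qed

section \<open>Multiplicities\<close>

lemma power_ratio_tendsto_0: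
  assumes "i < j"
  shows "(\<lambda>d::nat. real d ^ i / real d ^ j) \<longlonglongrightarrow> 0"
proof -
  have "(\<lambda>d. inverse (real d) ^ (j - i)) \<longlonglongrightarrow> 0 ^ (j - i)"
    by (intro tendsto_power lim_inverse_n)
  then have "(\<lambda>d. inverse (real d) ^ (j - i)) \<longlonglongrightarrow> 0" using assms by (simp add: zero_power)
  then show ?thesis
    by (rule Lim_transform_eventually)
      (use eventually_gt_at_top[of 0] in eventually_elim,
        use assms in \<open>simp add: power_diff power_inverse field_simps\<close>)
qed

lemma poly_over_power_degree_tendsto:
  fixes P :: "real poly"
  shows "(\<lambda>d. poly P (real d) / real d ^ degree P) \<longlonglongrightarrow> lead_coeff P"
proof -
  let ?n = "degree P"
  have "(\<lambda>d. \<Sum>i\<le>?n. coeff P i * (real d ^ i / real d ^ ?n)) \<longlonglongrightarrow> (\<Sum>i\<le>?n. if i = ?n then coeff P ?n else 0)"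
  proof (rule tendsto_sum)
    fix i assume "i \<in> {..?n}"
    show "(\<lambda>d. coeff P i * (real d ^ i / real d ^ ?n)) \<longlonglongrightarrow> (if i = ?n then coeff P ?n else 0)"
    proof (cases "i = ?n")
      case True
      have "(\<lambda>d. coeff P i * (real d ^ i / real d ^ ?n)) \<longlonglongrightarrow> coeff P i"
        by (rule tendsto_eventually, use eventually_gt_at_top[of 0] in eventually_elim) (simp add: True)
      with True show ?thesis by simp
    next
      case False
      then have "i < ?n" using \<open>i \<in> {..?n}\<close> by simp
      from tendsto_mult_left[OF power_ratio_tendsto_0[OF this], of "coeff P i"] False show ?thesis by simp
    qed
  qed
  then show ?thesis by (simp add: poly_altdef sum_divide_distrib)
qed

text \<open>A degree below \<open>n\<close> would give the limit 0, and a degree above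
  \<open>n\<close> would make the leading coefficient vanish; the nonzero limit leaves only degree
  \<open>n\<close>.\<close>

lemma degree_lead_coeff_of_limit:
  fixes P :: "real poly"
  assumes lim: "(\<lambda>d. poly P (real d) / real d ^ n) \<longlonglongrightarrow> L" and "L \<noteq> 0"
  shows "degree P = n" "lead_coeff P = L"
proof -
  let ?k = "degree P"
  note deg = poly_over_power_degree_tendsto[of P]
  consider "?k < n" | "?k = n" | "n < ?k" by linarith
  then have "degree P = n \<and> lead_coeff P = L"
  proof cases
    case 1
    have "(\<lambda>d. poly P (real d) / real d ^ ?k * (real d ^ ?k / real d ^ n)) \<longlonglongrightarrow> lead_coeff P * 0"
      by (intro tendsto_mult deg power_ratio_tendsto_0 1)
    then have "(\<lambda>d. poly P (real d) / real d ^ n) \<longlonglongrightarrow> lead_coeff P * 0"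
      by (rule Lim_transform_eventually) (use eventually_gt_at_top[of 0] in eventually_elim, simp)
    with lim have "L = lead_coeff P * 0" by (rule LIMSEQ_unique)
    with \<open>L \<noteq> 0\<close> show ?thesis by simp
  next
    case 2
    then show ?thesis using LIMSEQ_unique[OF deg] lim by simp
  next
    case 3
    have "(\<lambda>d. poly P (real d) / real d ^ n * (real d ^ n / real d ^ ?k)) \<longlonglongrightarrow> L * 0"
      by (intro tendsto_mult lim power_ratio_tendsto_0 3)
    then have "(\<lambda>d. poly P (real d) / real d ^ ?k) \<longlonglongrightarrow> L * 0"
      by (rule Lim_transform_eventually) (use eventually_gt_at_top[of 0] in eventually_elim, simp)
    with deg have "lead_coeff P = L * 0" by (rule LIMSEQ_unique)
    then show ?thesis using 3 by auto
  qed
  then show "degree P = n" "lead_coeff P = L" by auto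
qed

text \<open>Supplies the uniqueness demanded by the definite description in
  \<open>hilbert_samuel_polynomial\<close>: the difference of the two polynomials would have
  infinitely many roots.\<close>

lemma poly_eq_of_eventually_eq:
  fixes P Q :: "real poly"
  assumes "\<forall>\<^sub>F d in sequentially. poly P (real d) = poly Q (real d)"
  shows "P = Q"
proof (rule ccontr)
  assume "P \<noteq> Q"
  then have "finite {x. poly (P - Q) x = 0}" by (intro poly_roots_finite) simp
  moreover obtain N where "\<And>d. d \<ge> N \<Longrightarrow> poly P (real d) = poly Q (real d)"
    using assms unfolding eventually_sequentially by blast
  then have "real ` {N..} \<subseteq> {x. poly (P - Q) x = 0}" by auto
  moreover have "infinite (real ` {N..})"
    by (simp add: finite_image_iff infinite_Ici)
  ultimately show False by (meson finite_subset)
qed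

lemma hs_multiplicity_eq:
  assumes poly: "eventually_polynomial (hilbert_samuel_function m A)"
    and lim: "(\<lambda>d. real (hilbert_samuel_function m A d) / real d ^ n) \<longlonglongrightarrow> L" and "L \<noteq> 0"
  shows "hs_multiplicity m A = fact n * L"
proof -
  obtain P where P: "\<forall>\<^sub>F d in sequentially. real (hilbert_samuel_function m A d) = poly P (real d)"
    using poly unfolding eventually_polynomial_def by blast
  have "hilbert_samuel_polynomial m A = P"
    unfolding hilbert_samuel_polynomial_def
  proof (rule the_equality)
    show "\<forall>\<^sub>F d in sequentially. real (hilbert_samuel_function m A d) = poly P (real d)" by (rule P)
    fix Q assume "\<forall>\<^sub>F d in sequentially. real (hilbert_samuel_function m A d) = poly Q (real d)"
    with P have "\<forall>\<^sub>F d in sequentially. poly Q (real d) = poly P (real d)" by eventually_elim simp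
    then show "Q = P" by (rule poly_eq_of_eventually_eq)
  qed
  moreover have "(\<lambda>d. poly P (real d) / real d ^ n) \<longlonglongrightarrow> L"
    using lim by (rule Lim_transform_eventually) (use P in eventually_elim, simp)
  from degree_lead_coeff_of_limit[OF this \<open>L \<noteq> 0\<close>] have "degree P = n" "lead_coeff P = L" .
  ultimately show ?thesis by (simp add: hs_multiplicity_def)
qed

text \<open>An enumeration of \<open>S\<close> writes the sums as images of exponent functions under
  the additive map \<open>\<phi>\<close>. Equal images have equal degree, because the coordinate sum
  is \<open>m\<close> times the degree.\<close>

lemma eventually_polynomial_card_bounded_sums:
  fixes S :: "(real^'n::finite) set"
  assumes fin: "finite S" and m: "0 < m" "\<And>s. s \<in> S \<Longrightarrow> coord_sum s = m"
  shows "eventually_polynomial (\<lambda>d. card (bounded_sums S d))"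
proof -
  define k where "k = card S"
  obtain h where h: "bij_betw h {..<k} S"
    using ex_bij_betw_nat_finite[OF fin] by (auto simp: k_def atLeast0LessThan)
  define \<phi> where "\<phi> f = (\<Sum>j<k. real (f j) *\<^sub>R h j)" for f :: "nat \<Rightarrow> nat"
  have hS: "h j \<in> S" if "j < k" for j using h that by (auto simp: bij_betw_def)
  have "eventually_polynomial (\<lambda>d. card (\<phi> ` {f. (\<forall>i\<ge>k. f i = 0) \<and> sum f {..<k} \<le> d}))"
  proof (rule eventually_polynomial_image)
    fix f g l :: "nat \<Rightarrow> nat" assume "\<phi> f = \<phi> g"
    then show "\<phi> (\<lambda>i. f i + l i) = \<phi> (\<lambda>i. g i + l i)"
      by (simp add: \<phi>_def scaleR_left_distrib sum.distrib)
  next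
    fix f g :: "nat \<Rightarrow> nat" assume eq: "\<phi> f = \<phi> g"
    have "coord_sum (\<phi> f) = real (sum f {..<k}) * m" for f
      using m(2) hS by (simp add: \<phi>_def sum_distrib_right)
    then have "real (sum f {..<k}) * m = real (sum g {..<k}) * m" using eq by metis
    then show "sum f {..<k} = sum g {..<k}" using m(1) by (simp only: mult_cancel_right of_nat_eq_iff) simp
  qed
  moreover have "\<phi> ` {f. (\<forall>i\<ge>k. f i = 0) \<and> sum f {..<k} \<le> d} = bounded_sums S d" for d
  proof
    show "\<phi> ` {f. (\<forall>i\<ge>k. f i = 0) \<and> sum f {..<k} \<le> d} \<subseteq> bounded_sums S d"
    proof
      fix z assume "z \<in> \<phi> ` {f. (\<forall>i\<ge>k. f i = 0) \<and> sum f {..<k} \<le> d}"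
      then obtain f where f: "sum f {..<k} \<le> d" "z = \<phi> f" by blast
      define g where "g s = f (inv_into {..<k} h s)" for s
      have gh: "g (h j) = f j" if "j < k" for j
        using h that by (simp add: g_def bij_betw_def)
      have "sum g S = sum f {..<k}" "(\<Sum>s\<in>S. real (g s) *\<^sub>R s) = \<phi> f"
        unfolding \<phi>_def by (simp_all add: gh flip: sum.reindex_bij_betw[OF h])
      then show "z \<in> bounded_sums S d"
        unfolding bounded_sums_def using f by (intro CollectI exI[of _ g]) simp
    qed
    show "bounded_sums S d \<subseteq> \<phi> ` {f. (\<forall>i\<ge>k. f i = 0) \<and> sum f {..<k} \<le> d}"
    proof
      fix z assume "z \<in> bounded_sums S d"
      then obtain g where g: "sum g S \<le> d" "z = (\<Sum>s\<in>S. real (g s) *\<^sub>R s)"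
        unfolding bounded_sums_def by blast
      define f where "f j = (if j < k then g (h j) else 0)" for j
      have "sum f {..<k} = sum g S" "\<phi> f = z"
        unfolding \<phi>_def g(2) by (simp_all add: f_def flip: sum.reindex_bij_betw[OF h])
      then show "z \<in> \<phi> ` {f. (\<forall>i\<ge>k. f i = 0) \<and> sum f {..<k} \<le> d}"
        using g(1) by (intro image_eqI[of _ _ f]) (auto simp: f_def)
    qed
  qed
  ultimately show ?thesis by simp
qed

theorem corollary7p7:
  fixes E :: "'v::finite set set" and m c :: nat
  assumes "uniform_hypergraph m UNIV E"
    and "\<forall>x. \<not> isolated_node E x"
    and "\<forall>C \<in> conn_components UNIV E. properly_connected m (induced_edges E C)"
    and "c = card (conn_components UNIV E)"
  shows "(normalized_volume (edge_polytope E) \<noteq> 0 \<longleftrightarrow>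
            (\<forall>C \<in> conn_components UNIV E. \<forall>x\<in>C. \<forall>y\<in>C.
               pivot_equivalent C (induced_edges E C) x y)) \<and>
         (normalized_volume (edge_polytope E) \<noteq> 0 \<longrightarrow>
            normalized_volume (edge_polytope E) =
              real m ^ (c - 1) * hs_multiplicity m (edge_subring E :: ('v, 'k::field) mpol set))"
proof -
  let ?P = "conn_components UNIV E" and ?n = "CARD('v)"
  define S where "S = (indicator_vec ` E :: (real^'v) set)"
  define K where "K = convex hull (insert 0 S)"
  define L where "L = (block_lattice m ?P :: (real^'v) set)"
  have m: "0 < m" using assms(1) by (simp add: uniform_hypergraph_def)
  have fin: "finite S" by (simp add: S_def)
  have S: "coord_sum s = real m" if "s \<in> S" for s
    using that assms(1) by (auto simp: S_def uniform_hypergraph_def coord_sum_indicator_vec)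
  have "S \<noteq> {}" using assms(2) by (auto simp: S_def isolated_node_def)
  have polytope: "edge_polytope E = convex hull S"
    by (simp add: edge_polytope_def S_def indicator_vec_def[abs_def])
  have vol: "normalized_volume (edge_polytope E) = fact ?n / real m * measure lborel K"
    unfolding polytope K_def
    by (rule normalized_volume_eq_measure[OF fin \<open>S \<noteq> {}\<close>]) (use S m in \<open>auto simp: coord_sum_def\<close>)
  have iff: "measure lborel K \<noteq> 0 \<longleftrightarrow>
      (\<forall>C\<in>?P. \<forall>x\<in>C. \<forall>y\<in>C. pivot_equivalent C (induced_edges E C) x y)" (is "_ \<longleftrightarrow> ?piv")
  proof
    assume nz: "measure lborel K \<noteq> 0"
    show ?piv
    proof (rule ccontr)
      assume "\<not> ?piv"
      then obtain C x y where "C \<in> ?P" "x \<in> C" "y \<in> C" "\<not> pivot_equivalent C (induced_edges E C) x y" by blast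
      then obtain a :: "real^'v" where "a \<noteq> 0" "\<forall>e\<in>E. a \<bullet> indicator_vec e = 0"
        using edges_in_hyperplane[OF assms(1,2)] assms(3) by blast
      then have "measure lborel K = 0"
        unfolding K_def by (intro measure_convex_hull_insert_0_eq_0[OF fin]) (auto simp: S_def)
      with nz show False by simp
    qed
  next
    assume piv: ?piv
    \<comment> \<open>Over the reals the multiples \<open>real m *\<^sub>R axis x 1\<close> from the
      integer span already yield the whole space, so \<open>K\<close> has interior points.\<close>
    have "axis x 1 \<in> span S" for x
    proof -
      obtain C where C: "C \<in> ?P" "x \<in> C"
        using partition_onD1[OF partition_on_conn_components, of E] by blast
      have "int_span S \<subseteq> span S"
        unfolding int_span_def by (auto intro: span_sum span_scale span_base)
      then have "real m *\<^sub>R axis x 1 \<in> span S"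
        using scaled_axis_int_span[OF assms(1,2) C] piv C unfolding S_def by blast
      then have "(1 / real m) *\<^sub>R (real m *\<^sub>R axis x 1) \<in> span S" by (rule span_scale)
      then show ?thesis using m by simp
    qed
    then have "Basis \<subseteq> span S" by (auto simp: Basis_vec_def)
    then have "span S = UNIV" by (metis span_Basis span_mono span_span top.extremum_uniqueI)
    then show "measure lborel K \<noteq> 0"
      unfolding K_def using measure_convex_hull_insert_0_pos[OF fin] by simp
  qed
  have "normalized_volume (edge_polytope E) =
      real m ^ (c - 1) * hs_multiplicity m (edge_subring E :: ('v, 'k) mpol set)"
    if nz: "measure lborel K \<noteq> 0"
  proof -
    let ?F = "hilbert_samuel_function m (edge_subring E :: ('v, 'k) mpol set)"
    have F: "?F d = card (bounded_sums S d)" for d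
      unfolding S_def by (rule hilbert_samuel_function_edge_subring[OF assms(1)])
    have "compact K" unfolding K_def by (rule finite_imp_compact_convex_hull) (simp add: fin)
    then have count: "(\<lambda>d. real (card {z \<in> L. (1 / real d) *\<^sub>R z \<in> K}) / real d ^ ?n)
        \<longlonglongrightarrow> measure lborel K / real m ^ c"
      unfolding L_def assms(4)
      by (intro card_block_lattice_limit[OF partition_on_conn_components m])
        (auto simp: K_def compact_imp_bounded borel_compact convex_convex_hull intro!: negligible_convex_frontier)
    have SL: "s \<in> L" if "s \<in> S" for s
      using that indicator_vec_block_lattice[OF assms(1)] by (auto simp: S_def L_def)
    have L_span: "L \<subseteq> int_span S"
      unfolding L_def S_def using iff nz by (intro block_lattice_subset_int_span[OF assms(1,2)]) blast
    have "(\<lambda>d. real (card (bounded_sums S d)) / real d ^ ?n) \<longlonglongrightarrow> measure lborel K / real m ^ c"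
    proof (rule card_bounded_sums_limit[OF fin])
      show "0 < real m" using m by simp
      show "coord_sum s = real m" if "s \<in> S" for s using that by (rule S)
      show "integral_vec z" if "z \<in> L" for z using that by (simp add: L_def block_lattice_def)
      show "z - (\<Sum>s\<in>S. of_int (f s) *\<^sub>R s) \<in> L" if "z \<in> L" for z f
        using that SL unfolding L_def by (intro block_lattice_diff block_lattice_combination)
      show "\<exists>f. z = (\<Sum>s\<in>S. of_int (f s) *\<^sub>R s)" if "z \<in> L" for z
        using that L_span unfolding int_span_def by blast
      show "0 \<in> L" by (simp add: L_def block_lattice_0)
    qed (use count in \<open>simp only: K_def\<close>)
    then have "hs_multiplicity m (edge_subring E :: ('v, 'k) mpol set) = fact ?n * (measure lborel K / real m ^ c)"
      using eventually_polynomial_card_bounded_sums[OF fin _ S] m nz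
      by (intro hs_multiplicity_eq) (simp_all add: F F[abs_def])
    moreover have "c \<ge> 1"
    proof -
      have "?P \<noteq> {}" using partition_onD1[OF partition_on_conn_components, of E] by auto
      then show ?thesis by (simp add: assms(4) Suc_le_eq card_gt_0_iff)
    qed
    \<comment> \<open>Since \<open>c\<close> is at least 1 the exponent \<open>c - 1\<close> is not
      truncated, and the extra factor \<open>m\<close> matches the division by \<open>m\<close> in
      \<open>vol\<close>.\<close>
    then have "real m ^ c = real m ^ (c - 1) * real m" by (simp flip: power_Suc2)
    ultimately show ?thesis using m by (simp add: vol)
  qed
  then show ?thesis using iff m by (simp add: vol)
qed

end
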